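(* Let $1\le K\le d_1+1$ and $1\le J\le d_2+1$. The differential-deformation systems $$\partial_y\mathbf\Phi_N=-D_2^N(y)\mathbf\Phi_N,\quad \partial_{u_K}\mathbf\Phi_N=-\mathbf U_K^{N,\Phi}\mathbf\Phi_N,\quad \partial_{v_J}\mathbf\Phi_N=\mathbf V_J^{N,\Phi}\mathbf\Phi_N,$$ $$\partial_y\underline{\mathbf\Psi}^{N-1}=\underline{\mathbf\Psi}^{N-1}\underline D_2^N(y),\quad \partial_{u_K}\underline{\mathbf\Psi}^{N-1}=\underline{\mathbf\Psi}^{N-1}\underline{\mathbf U}_K^{N,\Psi},\quad \partial_{v_J}\underline{\mathbf\Psi}^{N-1}=-\underline{\mathbf\Psi}^{N-1}\underline{\mathbf V}_J^{N,\Psi}$$ are put in duality by the matrix $\mathbb B^N$; that is, for every $N$ for which the matrices involved are defined, $$\mathbb B^ND_2^N(y)=\underline D_2^N(y)\,\mathbb B^N\qquad(N\ge\max(d_1,d_2)+1),$$ $$\partial_{u_K}\mathbb B^N=\mathbb B^N\mathbf U_K^{N,\Phi}(y)-\underline{\mathbf U}_K^{N,\Psi}(y)\,\mathbb B^N\qquad(N\ge d_1+K),$$ $$\partial_{v_J}\mathbb B^N=\underline{\mathbf V}_J^{N,\Psi}(y)\,\mathbb B^N-\mathbb B^N\mathbf V_J^{N,\Phi}(y)\qquad(N\ge\max(d_1,J+1)).$$ In particular $D_2^N(y)$ and $\underline D_2^N(y)$ are conjugate, and their spectral curves are the same: $\det[x\mathbf 1-D_2^N(y)]=\det[x\mathbf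 1-\underline D_2^N(y)]$. Similarly, the systems $$\partial_x\mathbf\Psi_N=-D_1^N(x)\mathbf\Psi_N,\quad \partial_{u_K}\mathbf\Psi_N=\mathbf U_K^{N,\Psi}\mathbf\Psi_N,\quad \partial_{v_J}\mathbf\Psi_N=-\mathbf V_J^{N,\Psi}\mathbf\Psi_N,$$ $$\partial_x\underline{\mathbf\Phi}^{N-1}=\underline{\mathbf\Phi}^{N-1}\underline D_1^N(x),\quad \partial_{u_K}\underline{\mathbf\Phi}^{N-1}=-\underline{\mathbf\Phi}^{N-1}\underline{\mathbf U}_K^{N,\Phi},\quad \partial_{v_J}\underline{\mathbf\Phi}^{N-1}=\underline{\mathbf\Phi}^{N-1}\underline{\mathbf V}_J^{N,\Phi}$$ are put in duality by the matrix $\mathbb A^N$: $$\mathbb A^ND_1^N(x)=\underline D_1^N(x)\,\mathbb A^N\qquad(N\ge\max(d_1,d_2)+1),$$ $$\partial_{v_J}\mathbb A^N=\mathbb A^N\mathbf V_J^{N,\Psi}(x)-\underline{\mathbf V}_J^{N,\Phi}(x)\,\mathbb A^N\qquad(N\ge d_2+J),$$ $$\partial_{u_K}\mathbb A^N=\underline{\mathbf U}_K^{N,\Phi}(x)\,\mathbb A^N-\mathbb A^N\mathbf U_K^{N,\Psi}(x)\qquad(N\ge\max(d_2,K+1)),$$ and hence the spectral curves of $\underline D_1^N(x)$ and $D_1^N(x)$ are also the same: $\det[y\mathbf 1-D_1^N(x)]=\det[y\mathbf 1-\underline D_1^N(x)]$.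
   Context: **Setting.** Fix integers $d_1,d_2\ge1$ and $V_1(x)=\sum_{K=1}^{d_1+1}\frac{u_K}{K}x^K$, $V_2(y)=\sum_{J=1}^{d_2+1}\frac{v_J}{J}y^J$ with $u_{d_1+1}\ne0$, $v_{d_2+1}\ne0$, and contours $\Gamma_x,\Gamma_y$ such that all integrals below converge and integrations by parts produce no boundary terms. Assume there are monic polynomials $\pi_n,\sigma_n$ of degree $n$ ($n\ge0$) with $\int_{\Gamma_x}\int_{\Gamma_y}\pi_n(x)\sigma_m(y)e^{-V_1(x)-V_2(y)+xy}\,dy\,dx=h_n\delta_{nm}$, $h_n\neq0$. The parameters $(u_K,v_J)$ vary in a simply connected open set on which this holds (contours fixed), with $\sqrt{h_n}$ chosen smoothly. Put $\psi_n(x)=\pi_n(x)e^{-V_1(x)}/\sqrt{h_n}$, $\phi_n(y)=\sigma_n(y)e^{-V_2(y)}/\sqrt{h_n}$. **Recursion coefficients.** There are unique numbers $\alpha_j(n)$ ($-1\le j\le d_2$), $\beta_j(n)$ ($-1\le j\le d_1$), with $\alpha_{-1}(n)=\beta_{-1}(n)=\gamma(n)=\sqrt{h_{n+1}}/\sqrt{h_n}$ and $\alpha_j(n)=\beta_j(n)=0$ for $n<j$, such that for all $n\ge0$ (terms with negative index omitted) $x\psi_n=\sum_{j=-1}^{d_2}\alpha_j(n)\psi_{n-j}$ and $\partial_x\psi_n=-\sum_{j=-1}^{d_1}\beta_j(n+j)\psi_{n+j}$. Moreover $\alpha_{d_2}(n)=v_{d_2+1}\prod_{j=1}^{d_2}\gamma(n-j)\ne0$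 ($n\ge d_2$) and $\beta_{d_1}(n)=u_{d_1+1}\prod_{j=1}^{d_1}\gamma(n-j)\neq0$ ($n\ge d_1$). Let $Q,P$ be the (finite band) semi-infinite matrices (indices $\ge0$) with $x\psi_n=\sum_mQ_{nm}\psi_m$, $\partial_x\psi_n=\sum_mP_{nm}\psi_m$. **Christoffel–Darboux matrices** (indices from $0$). $\mathbb A^N$ is $(d_2+1)\times(d_2+1)$ with $(\mathbb A^N)_{0,d_2}=-\gamma(N-1)$, $(\mathbb A^N)_{k+1,c}=\alpha_{d_2+k-c}(N+k)$ for $0\le k\le c\le d_2-1$, other entries $0$. $\mathbb B^N$ is $(d_1+1)\times(d_1+1)$ with $(\mathbb B^N)_{0,d_1}=-\gamma(N-1)$, $(\mathbb B^N)_{k+1,c}=\beta_{d_1+k-c}(N+k)$ for $0\le k\le c\le d_1-1$, other entries $0$. **Ladder matrices.** $\mathbf a_N(x)$ ($N\ge d_2$) is the $(d_2+1)\times(d_2+1)$ matrix with $1$'s on the first superdiagonal, last row $\frac1{\gamma(N)}(-\alpha_{d_2}(N),\dots,-\alpha_1(N),x-\alpha_0(N))$, other entries $0$; $\mathbf b_N(y)$ ($N\ge d_1$) is the $(d_1+1)\times(d_1+1)$ matrix with $1$'s on the first superdiagonal, last row $\frac1{\gamma(N)}(-\beta_{d_1}(N),\dots,-\beta_1(N),y-\beta_0(N))$, other entries $0$. Write $\mathbf a^N=\mathbf a_N^{-1}$, $\mathbf b^N=\mathbf b_N^{-1}$. For $N\ge1$, $\underline{\mathbf a}^N(x)$ is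 the $(d_2+1)\times(d_2+1)$ matrix with $1$'s on the first superdiagonal, first column $\frac1{\gamma(N-1)}(x-\alpha_0(N),-\alpha_1(N+1),\dots,-\alpha_{d_2}(N+d_2))^t$, other entries $0$; $\underline{\mathbf b}^N(y)$ is the $(d_1+1)\times(d_1+1)$ matrix with $1$'s on the first superdiagonal, first column $\frac1{\gamma(N-1)}(y-\beta_0(N),-\beta_1(N+1),\dots,-\beta_{d_1}(N+d_1))^t$, other entries $0$. Write $\underline{\mathbf a}_N=(\underline{\mathbf a}^N)^{-1}$, $\underline{\mathbf b}_N=(\underline{\mathbf b}^N)^{-1}$. **Differential matrices.** For $j\ge-1$ put $\beta^N_j=\mathrm{diag}(\beta_j(N+j-d_2),\dots,\beta_j(N+j))$, $\alpha^N_j=\mathrm{diag}(\alpha_j(N+j-d_1),\dots,\alpha_j(N+j))$, $\underline\alpha^N_j=\mathrm{diag}(\alpha_j(N),\dots,\alpha_j(N+d_1))$, $\underline\beta^N_j=\mathrm{diag}(\beta_j(N),\dots,\beta_j(N+d_2))$. Then $D_1^N(x)=\beta^N_{-1}\mathbf a^{N-1}+\beta_0^N+\sum_{j=1}^{d_1}\beta_j^N\mathbf a_{N+j-1}\cdots\mathbf a_N$ ($N\ge d_2+1$), $D_2^N(y)=\alpha^N_{-1}\mathbf b^{N-1}+\alpha_0^N+\sum_{j=1}^{d_2}\alpha_j^N\mathbf b_{N+j-1}\cdots\mathbf b_N$ ($N\ge d_1+1$), $\underline D_2^N(y)=\underline{\mathbf b}_N\underline\alpha_{-1}^{N-1}+\underline\alpha_0^{N-1}+\sum_{j=1}^{d_2}\underline{\mathbf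 b}^{N-1}\cdots\underline{\mathbf b}^{N-j}\underline\alpha_j^{N-1}$ ($N\ge d_2+1$), $\underline D_1^N(x)=\underline{\mathbf a}_N\underline\beta_{-1}^{N-1}+\underline\beta_0^{N-1}+\sum_{j=1}^{d_1}\underline{\mathbf a}^{N-1}\cdots\underline{\mathbf a}^{N-j}\underline\beta_j^{N-1}$ ($N\ge d_1+1$). **Deformation matrices.** $U^K:=-\frac1K\{(Q^K)_{>0}+\frac12(Q^K)_0\}$, $V^J:=-\frac1J\{((-P^t)^J)_{>0}+\frac12((-P^t)^J)_0\}$ ($>0$: strictly upper triangular part; $0$: diagonal part), $U^K_j(n)=(U^K)_{n,n+j}$, $V^J_j(n)=(V^J)_{n,n+j}$. For integers $p\ge0$ and $d$ write $U^K_j[p;d]=\mathrm{diag}(U^K_j(p),U^K_j(p+1),\dots,U^K_j(p+d))$ and similarly $V^J_j[p;d]$ (entries with negative argument are $0$). Empty products are $\mathbf 1$. Then $\mathbf U_K^{N,\Psi}=\sum_{j=0}^KU^K_j[N-d_2;d_2]\,\mathbf a_{N+j-1}\cdots\mathbf a_N$ ($N\ge d_2$); $\mathbf V_J^{N,\Psi}=\sum_{j=0}^JV^J_j[N-d_2-j;d_2]\,\mathbf a^{N-j}\cdots\mathbf a^{N-1}$ ($N\ge d_2+J$); $\underline{\mathbf U}_K^{N,\Psi}=\sum_{j=0}^K\underline{\mathbf b}_N\cdots\underline{\mathbf b}_{N+j-1}\,U^K_j[N-1;d_1]$ ($N\ge1$); $\underline{\mathbf V}_J^{N,\Psi}=\sum_{j=0}^J\underline{\mathbf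 b}^{N-1}\cdots\underline{\mathbf b}^{N-j}\,V^J_j[N-1-j;d_1]$ ($N\ge J+1$); $\mathbf U_K^{N,\Phi}=\sum_{j=0}^KU^K_j[N-j-d_1;d_1]\,\mathbf b^{N-j}\cdots\mathbf b^{N-1}$ ($N\ge d_1+K$); $\mathbf V_J^{N,\Phi}=\sum_{j=0}^JV^J_j[N-d_1;d_1]\,\mathbf b_{N+j-1}\cdots\mathbf b_N$ ($N\ge d_1$); $\underline{\mathbf U}_K^{N,\Phi}=\sum_{j=0}^K\underline{\mathbf a}^{N-1}\cdots\underline{\mathbf a}^{N-j}\,U^K_j[N-1-j;d_2]$ ($N\ge K+1$); $\underline{\mathbf V}_J^{N,\Phi}=\sum_{j=0}^J\underline{\mathbf a}_N\cdots\underline{\mathbf a}_{N+j-1}\,V^J_j[N-1;d_2]$ ($N\ge1$). *)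

theory Defs
  imports
    "HOL-Analysis.Analysis"
    "HOL-Computational_Algebra.Polynomial"
    "Jordan_Normal_Form.Determinant"
    "Jordan_Normal_Form.Gauss_Jordan_Elimination"
begin

section \<open>Contours and double integrals\<close>

text \<open>A contour is a finite formal linear combination of oriented, piecewise continuously
  differentiable curves parametrised by the real line; a single curve \<open>g\<close> is \<open>[(1, g)]\<close>.
  Infinite ends correspond to the parameter tending to plus or minus infinity.\<close>

type_synonym contour = "(complex \<times> (real \<Rightarrow> complex)) list"

definition valid_contour :: "contour \<Rightarrow> bool" where
  "valid_contour \<Gamma> \<longleftrightarrow> (\<forall>(a, g) \<in> set \<Gamma>. g piecewise_C1_differentiable_on UNIV)"

definition pullback ::
  "(real \<Rightarrow> complex) \<Rightarrow> (real \<Rightarrow> complex) \<Rightarrow> (complex \<Rightarrow> complex \<Rightarrow> complex) \<Rightarrow> real \<times> real \<Rightarrow> complex" where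
  "pullback g k F = (\<lambda>(s, t). F (g s) (k t) * vector_derivative g (at s) * vector_derivative k (at t))"

definition double_integrable :: "contour \<Rightarrow> contour \<Rightarrow> (complex \<Rightarrow> complex \<Rightarrow> complex) \<Rightarrow> bool" where
  "double_integrable \<Gamma>x \<Gamma>y F \<longleftrightarrow>
     (\<forall>(a, g) \<in> set \<Gamma>x. \<forall>(b, k) \<in> set \<Gamma>y. integrable (lborel \<Otimes>\<^sub>M lborel) (pullback g k F))"

definition double_integral :: "contour \<Rightarrow> contour \<Rightarrow> (complex \<Rightarrow> complex \<Rightarrow> complex) \<Rightarrow> complex" where
  "double_integral \<Gamma>x \<Gamma>y F =
     (\<Sum>(a, g)\<leftarrow>\<Gamma>x. \<Sum>(b, k)\<leftarrow>\<Gamma>y. a * b * integral\<^sup>L (lborel \<Otimes>\<^sub>M lborel) (pullback g k F))"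


section \<open>The biorthogonal setting\<close>

text \<open>The parameters are a pair of functions \<open>u\<close>, \<open>v\<close> on the naturals, supported on
  \<open>{1..d1+1}\<close> and \<open>{1..d2+1}\<close>; with the product topology, \<open>param_space d1 d2\<close> is
  a copy of complex affine space of dimension \<open>d1 + d2 + 2\<close>.\<close>

type_synonym param = "(nat \<Rightarrow> complex) \<times> (nat \<Rightarrow> complex)"

definition param_space :: "nat \<Rightarrow> nat \<Rightarrow> param set" where
  "param_space d1 d2 =
     {u. \<forall>K. K \<notin> {1..d1+1} \<longrightarrow> u K = 0} \<times> {v. \<forall>J. J \<notin> {1..d2+1} \<longrightarrow> v J = 0}"

definition potential :: "nat \<Rightarrow> (nat \<Rightarrow> complex) \<Rightarrow> complex \<Rightarrow> complex" where
  "potential d u x = (\<Sum>K = 1..d+1. u K / of_nat K * x ^ K)"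

definition weight :: "nat \<Rightarrow> nat \<Rightarrow> param \<Rightarrow> complex \<Rightarrow> complex \<Rightarrow> complex" where
  "weight d1 d2 p x y = exp (- potential d1 (fst p) x - potential d2 (snd p) y + x * y)"

definition quasi_polynomial :: "nat \<Rightarrow> (nat \<Rightarrow> complex) \<Rightarrow> complex poly \<Rightarrow> complex \<Rightarrow> complex \<Rightarrow> complex" where
  "quasi_polynomial d u q s x = poly q x * exp (- potential d u x) / s"

locale biorthogonal_setting =
  fixes d1 d2 :: nat
    and \<Gamma>x \<Gamma>y :: contour
    and \<Omega> :: "param set"
    and \<pi> \<sigma> :: "param \<Rightarrow> nat \<Rightarrow> complex poly"
    and h :: "param \<Rightarrow> nat \<Rightarrow> complex"
    and r :: "param \<Rightarrow> nat \<Rightarrow> complex" \<comment> \<open>the chosen square roots of \<open>h\<close>\<close>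
  assumes degrees: "d1 \<ge> 1" "d2 \<ge> 1"
    and contours: "valid_contour \<Gamma>x" "valid_contour \<Gamma>y"
    and param_domain: "openin (top_of_set (param_space d1 d2)) \<Omega>" "simply_connected \<Omega>"
    and leading_coeffs: "\<And>u v. (u, v) \<in> \<Omega> \<Longrightarrow> u (d1 + 1) \<noteq> 0 \<and> v (d2 + 1) \<noteq> 0"
    and convergence: "\<And>p f g. p \<in> \<Omega> \<Longrightarrow>
      double_integrable \<Gamma>x \<Gamma>y (\<lambda>x y. poly f x * poly g y * weight d1 d2 p x y)"
    and no_boundary_x: "\<And>p f g. p \<in> \<Omega> \<Longrightarrow>
      double_integral \<Gamma>x \<Gamma>y (\<lambda>x y. deriv (\<lambda>z. poly f z * poly g y * weight d1 d2 p z y) x) = 0"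
    and no_boundary_y: "\<And>p f g. p \<in> \<Omega> \<Longrightarrow>
      double_integral \<Gamma>x \<Gamma>y (\<lambda>x y. deriv (\<lambda>z. poly f x * poly g z * weight d1 d2 p x z) y) = 0"
    and monic: "\<And>p n. p \<in> \<Omega> \<Longrightarrow>
      degree (\<pi> p n) = n \<and> lead_coeff (\<pi> p n) = 1 \<and> degree (\<sigma> p n) = n \<and> lead_coeff (\<sigma> p n) = 1"
    and biorthogonal: "\<And>p n m. p \<in> \<Omega> \<Longrightarrow>
      double_integral \<Gamma>x \<Gamma>y (\<lambda>x y. poly (\<pi> p n) x * poly (\<sigma> p m) y * weight d1 d2 p x y)
        = (if n = m then h p n else 0)"
    and nonzero: "\<And>p n. p \<in> \<Omega> \<Longrightarrow> h p n \<noteq> 0"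
    and sqrt: "\<And>p n. p \<in> \<Omega> \<Longrightarrow> r p n ^ 2 = h p n"
    \<comment> \<open>A continuous branch is automatically smooth (holomorphic), because \<open>h\<close> is
      holomorphic and has no zeros.\<close>
    and sqrt_smooth: "\<And>n. continuous_on \<Omega> (\<lambda>p. r p n)"
begin

definition psi :: "param \<Rightarrow> nat \<Rightarrow> complex \<Rightarrow> complex" where
  "psi p n = quasi_polynomial d1 (fst p) (\<pi> p n) (r p n)"

end

text \<open>The recursion coefficients \<open>\<alpha> p j n\<close> and \<open>\<beta> p j n\<close>, lower index \<open>j \<ge> -1\<close> first,
  characterised by their defining properties.\<close>

locale recursion_setting = biorthogonal_setting +
  fixes \<alpha> \<beta> :: "param \<Rightarrow> int \<Rightarrow> nat \<Rightarrow> complex"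
  assumes gamma: "\<And>p n. p \<in> \<Omega> \<Longrightarrow>
      \<alpha> p (-1) n = r p (n + 1) / r p n \<and> \<beta> p (-1) n = r p (n + 1) / r p n"
    and alpha_zero: "\<And>p j n. p \<in> \<Omega> \<Longrightarrow> j \<in> {-1..int d2} \<Longrightarrow> int n < j \<Longrightarrow> \<alpha> p j n = 0"
    and beta_zero: "\<And>p j n. p \<in> \<Omega> \<Longrightarrow> j \<in> {-1..int d1} \<Longrightarrow> int n < j \<Longrightarrow> \<beta> p j n = 0"
    and x_recursion: "\<And>p n x. p \<in> \<Omega> \<Longrightarrow>
      x * psi p n x = (\<Sum>j | j \<in> {-1..int d2} \<and> int n - j \<ge> 0. \<alpha> p j n * psi p (nat (int n - j)) x)"
    and d_recursion: "\<And>p n x. p \<in> \<Omega> \<Longrightarrow>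
      deriv (psi p n) x = - (\<Sum>j | j \<in> {-1..int d1} \<and> int n + j \<ge> 0.
        \<beta> p j (nat (int n + j)) * psi p (nat (int n + j)) x)"


section \<open>Matrices built from the recursion coefficients\<close>

text \<open>In this section \<open>\<alpha>\<close> and \<open>\<beta>\<close> are the coefficients at a fixed parameter value. A generic
  argument \<open>c\<close> stands for \<open>\<alpha>\<close> (with \<open>d = d2\<close>) or \<open>\<beta>\<close> (with \<open>d = d1\<close>); in both cases
  \<open>\<gamma>(n)\<close> is \<open>c (-1) n\<close>.\<close>

type_synonym coeffs = "int \<Rightarrow> nat \<Rightarrow> complex"

abbreviation inv_mat :: "complex mat \<Rightarrow> complex mat" where
  "inv_mat A \<equiv> the (mat_inverse A)"

text \<open>\<open>window f p d\<close> is \<open>diag (f p, ..., f (p + d))\<close>.\<close>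

definition window :: "(nat \<Rightarrow> complex) \<Rightarrow> nat \<Rightarrow> nat \<Rightarrow> complex mat" where
  "window f p d = Matrix.mat (d + 1) (d + 1) (\<lambda>(i, k). if i = k then f (p + i) else 0)"

definition mat_prod :: "nat \<Rightarrow> complex mat list \<Rightarrow> complex mat" where
  "mat_prod n As = foldr (*) As (1\<^sub>m n)"

definition mat_sum :: "nat \<Rightarrow> (nat \<Rightarrow> complex mat) \<Rightarrow> nat set \<Rightarrow> complex mat" where
  "mat_sum n F S = Matrix.mat n n (\<lambda>ik. \<Sum>j\<in>S. F j $$ ik)"

text \<open>Christoffel--Darboux matrix: \<open>\<A>\<^sup>N\<close> is \<open>CD_mat d2 \<alpha> N\<close> and \<open>\<B>\<^sup>N\<close> is \<open>CD_mat d1 \<beta> N\<close>.\<close>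

definition CD_mat :: "nat \<Rightarrow> coeffs \<Rightarrow> nat \<Rightarrow> complex mat" where
  "CD_mat d c N = Matrix.mat (d + 1) (d + 1) (\<lambda>(i, l).
     if i = 0 then (if l = d then - c (-1) (N - 1) else 0)
     else (let k = i - 1 in
       if k \<le> l \<and> l \<le> d - 1 then c (int d + int k - int l) (N + k) else 0))"

text \<open>Ladder matrices: \<open>ladder d2 \<alpha> N x\<close> is \<open>a\<^sub>N(x)\<close> and \<open>ladder d1 \<beta> N y\<close> is \<open>b\<^sub>N(y)\<close>;
  \<open>dual_ladder\<close> gives the underlined matrices with upper index \<open>N\<close>.\<close>

definition ladder :: "nat \<Rightarrow> coeffs \<Rightarrow> nat \<Rightarrow> complex \<Rightarrow> complex mat" where
  "ladder d c N z = Matrix.mat (d + 1) (d + 1) (\<lambda>(i, l).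
     if i < d then (if l = i + 1 then 1 else 0)
     else ((if l = d then z else 0) - c (int d - int l) N) / c (-1) N)"

definition dual_ladder :: "nat \<Rightarrow> coeffs \<Rightarrow> nat \<Rightarrow> complex \<Rightarrow> complex mat" where
  "dual_ladder d c N z = Matrix.mat (d + 1) (d + 1) (\<lambda>(i, l).
     if l = 0 then ((if i = 0 then z else 0) - c (int i) (N + i)) / c (-1) (N - 1)
     else (if l = i + 1 then 1 else 0))"

abbreviation "ladder_inv d c N z \<equiv> inv_mat (ladder d c N z)"
abbreviation "dual_ladder_inv d c N z \<equiv> inv_mat (dual_ladder d c N z)"


subsection \<open>Differential matrices\<close>

text \<open>Here and below a product such as \<open>a\<^bsub>N+j-1\<^esub> ... a\<^sub>N\<close> runs over \<open>rev [N..<N+j]\<close>, and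
  \<open>a\<^bsup>N-j\<^esup> ... a\<^bsup>N-1\<^esup>\<close> runs over \<open>[N-j..<N]\<close>. The prefix \<open>dual_\<close> marks an underlined matrix.\<close>

definition D1 :: "nat \<Rightarrow> nat \<Rightarrow> coeffs \<Rightarrow> coeffs \<Rightarrow> nat \<Rightarrow> complex \<Rightarrow> complex mat" where
  "D1 d1 d2 \<alpha> \<beta> N x =
     window (\<beta> (-1)) (N - 1 - d2) d2 * ladder_inv d2 \<alpha> (N - 1) x
     + window (\<beta> 0) (N - d2) d2
     + mat_sum (d2 + 1) (\<lambda>j. window (\<beta> (int j)) (N + j - d2) d2
         * mat_prod (d2 + 1) (map (\<lambda>k. ladder d2 \<alpha> k x) (rev [N..<N+j]))) {1..d1}"

definition D2 :: "nat \<Rightarrow> nat \<Rightarrow> coeffs \<Rightarrow> coeffs \<Rightarrow> nat \<Rightarrow> complex \<Rightarrow> complex mat" where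
  "D2 d1 d2 \<alpha> \<beta> N y =
     window (\<alpha> (-1)) (N - 1 - d1) d1 * ladder_inv d1 \<beta> (N - 1) y
     + window (\<alpha> 0) (N - d1) d1
     + mat_sum (d1 + 1) (\<lambda>j. window (\<alpha> (int j)) (N + j - d1) d1
         * mat_prod (d1 + 1) (map (\<lambda>k. ladder d1 \<beta> k y) (rev [N..<N+j]))) {1..d2}"

definition dual_D1 :: "nat \<Rightarrow> nat \<Rightarrow> coeffs \<Rightarrow> coeffs \<Rightarrow> nat \<Rightarrow> complex \<Rightarrow> complex mat" where
  "dual_D1 d1 d2 \<alpha> \<beta> N x =
     dual_ladder_inv d2 \<alpha> N x * window (\<beta> (-1)) (N - 1) d2
     + window (\<beta> 0) (N - 1) d2
     + mat_sum (d2 + 1) (\<lambda>j.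
         mat_prod (d2 + 1) (map (\<lambda>k. dual_ladder d2 \<alpha> k x) (rev [N-j..<N]))
         * window (\<beta> (int j)) (N - 1) d2) {1..d1}"

definition dual_D2 :: "nat \<Rightarrow> nat \<Rightarrow> coeffs \<Rightarrow> coeffs \<Rightarrow> nat \<Rightarrow> complex \<Rightarrow> complex mat" where
  "dual_D2 d1 d2 \<alpha> \<beta> N y =
     dual_ladder_inv d1 \<beta> N y * window (\<alpha> (-1)) (N - 1) d1
     + window (\<alpha> 0) (N - 1) d1
     + mat_sum (d1 + 1) (\<lambda>j.
         mat_prod (d1 + 1) (map (\<lambda>k. dual_ladder d1 \<beta> k y) (rev [N-j..<N]))
         * window (\<alpha> (int j)) (N - 1) d1) {1..d2}"


subsection \<open>Deformation matrices\<close>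

type_synonym imat = "nat \<Rightarrow> nat \<Rightarrow> complex"

definition Q_imat :: "nat \<Rightarrow> coeffs \<Rightarrow> imat" where
  "Q_imat d2 \<alpha> n m = (if int n - int m \<in> {-1..int d2} then \<alpha> (int n - int m) n else 0)"

definition P_imat :: "nat \<Rightarrow> coeffs \<Rightarrow> imat" where
  "P_imat d1 \<beta> n m = (if int m - int n \<in> {-1..int d1} then - \<beta> (int m - int n) m else 0)"

text \<open>Powers of a row-finite semi-infinite matrix; the sum is over the finitely many nonzero
  entries of a row.\<close>

fun imat_power :: "imat \<Rightarrow> nat \<Rightarrow> imat" where
  "imat_power A 0 n m = (if n = m then 1 else 0)"
| "imat_power A (Suc k) n m = (\<Sum>l | A n l \<noteq> 0. A n l * imat_power A k l m)"

definition upper_half :: "imat \<Rightarrow> imat" where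
  "upper_half A n m = (if n < m then A n m else if n = m then A n m / 2 else 0)"

definition U_imat :: "nat \<Rightarrow> coeffs \<Rightarrow> nat \<Rightarrow> imat" where
  "U_imat d2 \<alpha> K n m = - (1 / of_nat K) * upper_half (imat_power (Q_imat d2 \<alpha>) K) n m"

definition V_imat :: "nat \<Rightarrow> coeffs \<Rightarrow> nat \<Rightarrow> imat" where
  "V_imat d1 \<beta> J n m =
     - (1 / of_nat J) * upper_half (imat_power (\<lambda>i k. - P_imat d1 \<beta> k i) J) n m"

text \<open>\<open>idiag A j\<close> is the \<open>j\<close>-th superdiagonal of \<open>A\<close>, so that \<open>U\<^sub>j\<^sup>K[p;d]\<close> is
  \<open>window (idiag (U_imat d2 \<alpha> K) j) p d\<close>.\<close>

definition idiag :: "imat \<Rightarrow> nat \<Rightarrow> nat \<Rightarrow> complex" where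
  "idiag A j n = A n (n + j)"

definition U_Psi :: "nat \<Rightarrow> nat \<Rightarrow> coeffs \<Rightarrow> coeffs \<Rightarrow> nat \<Rightarrow> nat \<Rightarrow> complex \<Rightarrow> complex mat" where
  "U_Psi d1 d2 \<alpha> \<beta> K N x = mat_sum (d2 + 1) (\<lambda>j.
     window (idiag (U_imat d2 \<alpha> K) j) (N - d2) d2
     * mat_prod (d2 + 1) (map (\<lambda>k. ladder d2 \<alpha> k x) (rev [N..<N+j]))) {0..K}"

definition V_Psi :: "nat \<Rightarrow> nat \<Rightarrow> coeffs \<Rightarrow> coeffs \<Rightarrow> nat \<Rightarrow> nat \<Rightarrow> complex \<Rightarrow> complex mat" where
  "V_Psi d1 d2 \<alpha> \<beta> J N x = mat_sum (d2 + 1) (\<lambda>j.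
     window (idiag (V_imat d1 \<beta> J) j) (N - d2 - j) d2
     * mat_prod (d2 + 1) (map (\<lambda>k. ladder_inv d2 \<alpha> k x) [N-j..<N])) {0..J}"

definition dual_U_Psi :: "nat \<Rightarrow> nat \<Rightarrow> coeffs \<Rightarrow> coeffs \<Rightarrow> nat \<Rightarrow> nat \<Rightarrow> complex \<Rightarrow> complex mat" where
  "dual_U_Psi d1 d2 \<alpha> \<beta> K N y = mat_sum (d1 + 1) (\<lambda>j.
     mat_prod (d1 + 1) (map (\<lambda>k. dual_ladder_inv d1 \<beta> k y) [N..<N+j])
     * window (idiag (U_imat d2 \<alpha> K) j) (N - 1) d1) {0..K}"

definition dual_V_Psi :: "nat \<Rightarrow> nat \<Rightarrow> coeffs \<Rightarrow> coeffs \<Rightarrow> nat \<Rightarrow> nat \<Rightarrow> complex \<Rightarrow> complex mat" where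
  "dual_V_Psi d1 d2 \<alpha> \<beta> J N y = mat_sum (d1 + 1) (\<lambda>j.
     mat_prod (d1 + 1) (map (\<lambda>k. dual_ladder d1 \<beta> k y) (rev [N-j..<N]))
     * window (idiag (V_imat d1 \<beta> J) j) (N - 1 - j) d1) {0..J}"

definition U_Phi :: "nat \<Rightarrow> nat \<Rightarrow> coeffs \<Rightarrow> coeffs \<Rightarrow> nat \<Rightarrow> nat \<Rightarrow> complex \<Rightarrow> complex mat" where
  "U_Phi d1 d2 \<alpha> \<beta> K N y = mat_sum (d1 + 1) (\<lambda>j.
     window (idiag (U_imat d2 \<alpha> K) j) (N - j - d1) d1
     * mat_prod (d1 + 1) (map (\<lambda>k. ladder_inv d1 \<beta> k y) [N-j..<N])) {0..K}"

definition V_Phi :: "nat \<Rightarrow> nat \<Rightarrow> coeffs \<Rightarrow> coeffs \<Rightarrow> nat \<Rightarrow> nat \<Rightarrow> complex \<Rightarrow> complex mat" where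
  "V_Phi d1 d2 \<alpha> \<beta> J N y = mat_sum (d1 + 1) (\<lambda>j.
     window (idiag (V_imat d1 \<beta> J) j) (N - d1) d1
     * mat_prod (d1 + 1) (map (\<lambda>k. ladder d1 \<beta> k y) (rev [N..<N+j]))) {0..J}"

definition dual_U_Phi :: "nat \<Rightarrow> nat \<Rightarrow> coeffs \<Rightarrow> coeffs \<Rightarrow> nat \<Rightarrow> nat \<Rightarrow> complex \<Rightarrow> complex mat" where
  "dual_U_Phi d1 d2 \<alpha> \<beta> K N x = mat_sum (d2 + 1) (\<lambda>j.
     mat_prod (d2 + 1) (map (\<lambda>k. dual_ladder d2 \<alpha> k x) (rev [N-j..<N]))
     * window (idiag (U_imat d2 \<alpha> K) j) (N - 1 - j) d2) {0..K}"

definition dual_V_Phi :: "nat \<Rightarrow> nat \<Rightarrow> coeffs \<Rightarrow> coeffs \<Rightarrow> nat \<Rightarrow> nat \<Rightarrow> complex \<Rightarrow> complex mat" where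
  "dual_V_Phi d1 d2 \<alpha> \<beta> J N x = mat_sum (d2 + 1) (\<lambda>j.
     mat_prod (d2 + 1) (map (\<lambda>k. dual_ladder_inv d2 \<alpha> k x) [N..<N+j])
     * window (idiag (V_imat d1 \<beta> J) j) (N - 1) d2) {0..J}"


section \<open>Entrywise derivatives of matrices\<close>

definition has_mat_derivative ::
  "(complex \<Rightarrow> complex mat) \<Rightarrow> complex mat \<Rightarrow> complex \<Rightarrow> bool" where
  "has_mat_derivative F M z \<longleftrightarrow>
     (\<forall>w. F w \<in> carrier_mat (dim_row M) (dim_col M)) \<and>
     (\<forall>i < dim_row M. \<forall>j < dim_col M.
        ((\<lambda>w. F w $$ (i, j)) has_field_derivative M $$ (i, j)) (at z))"

text \<open>Partial derivatives of a matrix-valued function of the parameters with respect to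
  \<open>u\<^sub>K\<close> and \<open>v\<^sub>J\<close>.\<close>

definition has_u_derivative :: "nat \<Rightarrow> (param \<Rightarrow> complex mat) \<Rightarrow> complex mat \<Rightarrow> param \<Rightarrow> bool" where
  "has_u_derivative K F M p \<longleftrightarrow>
     has_mat_derivative (\<lambda>w. F ((fst p)(K := w), snd p)) M (fst p K)"

definition has_v_derivative :: "nat \<Rightarrow> (param \<Rightarrow> complex mat) \<Rightarrow> complex mat \<Rightarrow> param \<Rightarrow> bool" where
  "has_v_derivative J F M p \<longleftrightarrow>
     has_mat_derivative (\<lambda>w. F (fst p, (snd p)(J := w))) M (snd p J)"

definition spectral_det :: "nat \<Rightarrow> complex mat \<Rightarrow> complex \<Rightarrow> complex" where
  "spectral_det n D z = Determinant.det (z \<cdot>\<^sub>m 1\<^sub>m n - D)"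

end

theory Submission
  imports Defs
begin

text \<open>Let \<open>\<Pi>\<close> be the projection onto the indices below \<open>N\<close>. The Christoffel--Darboux matrix is the
  nonzero block of \<open>[L, \<Pi>]\<close>, for \<open>L = Q\<close> or \<open>L = -P\<^sup>t\<close>. Every matrix of the two dual systems is
  a band matrix \<open>W\<close> (\<open>P\<close>, \<open>U\<^sup>K\<close>, \<open>V\<^sup>J\<close> or a transpose) acting on windows of sequences \<open>\<psi>\<close>, \<open>\<phi>\<close> with
  \<open>L \<psi> = x \<psi>\<close> and \<open>\<phi> L = x \<phi>\<close> near \<open>N\<close>. By the Jacobi identity
  \<open>[[L, \<Pi>], W] = [[L, W], \<Pi>] + [L, [\<Pi>, W]]\<close>, whose last term vanishes between \<open>\<phi>\<close> and \<open>\<psi>\<close>, all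
  duality relations reduce to commutators \<open>[L, W]\<close>: the string equation \<open>[Q, P] = 1\<close> (and \<open>[1, \<Pi>] = 0\<close>),
  and the flows \<open>\<partial>\<^sub>uQ = [U, Q]\<close>, \<open>\<partial>\<^sub>vQ = [Q, V\<^sup>t]\<close> together with their analogues for \<open>-P\<^sup>t\<close>. The flows follow
  by differentiating biorthonormality, after differentiation under the integral sign
  and a Gram--Schmidt argument for the differentiability of the polynomials.\<close>

section \<open>Commutators with a projection\<close>

text \<open>The sequences \<psi> and \<phi> are not the wave functions, whose windows at a fixed
  spectral parameter need not take arbitrary values. They are numbers prescribed freely on one
  window of length \<open>d + 1\<close> and continued index by index, solving the eigenvalue
  equations only on the rows that the band of \<open>W\<close> can reach across \<open>N\<close>.
  Since the windows are arbitrary, equality of bilinear forms is equality of matrices. The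
  continuation divides by the outermost diagonals of \<open>L\<close>: for the superdiagonal this is
  \<gamma>, for the lowest subdiagonal the nonvanishing is derived from the leading coefficients of
  the potentials through integration by parts.

  Infinite sums are cut at a bound \<open>M\<close>. The commutator is used at pairs of which only
  the smaller index lies below \<open>N\<close>, so truncation has to be harmless as soon as
  \<open>M\<close> exceeds \<open>min n m\<close> by a constant; bounds that grow with
  \<open>n + m\<close> do not suffice and are converted by bandedness.

  A flow in v is a flow in u for the pairing with exchanged arguments, so the analysis and the
  algebra are carried out once and instantiated twice.\<close>

definition below :: "nat \<Rightarrow> nat \<Rightarrow> complex" where
  "below N n = (if n < N then 1 else 0)"

text \<open>Rows start at index \<open>N - 1\<close>, columns at index \<open>N - d\<close>: the block that contains all nonzero entries of
  \<open>[L, \<Pi>]\<close> when \<open>L\<close> has one superdiagonal and \<open>d\<close> subdiagonals.\<close>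

definition cut_mat :: "nat \<Rightarrow> nat \<Rightarrow> imat \<Rightarrow> complex mat" where
  "cut_mat d N L = Matrix.mat (d + 1) (d + 1) (\<lambda>(i, k).
     L (N - 1 + i) (N - d + k) * (below N (N - d + k) - below N (N - 1 + i)))"

definition slice :: "(nat \<Rightarrow> complex) \<Rightarrow> nat \<Rightarrow> nat \<Rightarrow> complex Matrix.vec" where
  "slice f a d = Matrix.vec (d + 1) (\<lambda>i. f (a + i))"

definition banded :: "nat \<Rightarrow> nat \<Rightarrow> imat \<Rightarrow> bool" where
  "banded a b L \<longleftrightarrow> (\<forall>n m. L n m \<noteq> 0 \<longrightarrow> n \<le> m + a \<and> m \<le> n + b)"

lemma bandedD: "banded a b L \<Longrightarrow> L n m \<noteq> 0 \<Longrightarrow> n \<le> m + a \<and> m \<le> n + b"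
  by (auto simp: banded_def)

lemma banded_zero: "banded a b L \<Longrightarrow> \<not> (n \<le> m + a \<and> m \<le> n + b) \<Longrightarrow> L n m = 0"
  by (auto simp: banded_def)

lemma banded_Q_imat: "banded d 1 (Q_imat d c)"
  by (auto simp: banded_def Q_imat_def split: if_splits)

lemma sum_slice:
  fixes g :: "nat \<Rightarrow> complex"
  assumes "\<And>m. m < M \<Longrightarrow> g m \<noteq> 0 \<Longrightarrow> a \<le> m \<and> m \<le> a + k" "a + k < M"
  shows "(\<Sum>m<M. g m) = (\<Sum>i\<le>k. g (a + i))"
proof -
  have "(\<Sum>m<M. g m) = (\<Sum>m\<in>{a..a+k}. g m)"
    by (rule sum.mono_neutral_right) (use assms in \<open>force+\<close>)
  also have "\<dots> = (\<Sum>i\<in>{0..k}. g (a + i))"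
    using sum.shift_bounds_cl_nat_ivl[of g 0 a k] by (simp add: add.commute)
  finally show ?thesis by (simp add: atMost_atLeast0)
qed

lemma slice_carrier [simp]: "slice f a d \<in> carrier_vec (d + 1)"
  by (simp add: slice_def)

lemma slice_carrier_Suc [simp]: "slice f a d \<in> carrier_vec (Suc d)"
  by (simp add: slice_def)

lemma slice_index [simp]: "i \<le> d \<Longrightarrow> vec_index (slice f a d) i = f (a + i)"
  by (simp add: slice_def)

lemma dim_slice [simp]: "dim_vec (slice f a d) = d + 1"
  by (simp add: slice_def)

lemma cut_mat_carrier [simp]: "cut_mat d N L \<in> carrier_mat (d + 1) (d + 1)"
  by (simp add: cut_mat_def)

lemma CD_mat_carrier [simp]: "CD_mat d c N \<in> carrier_mat (d + 1) (d + 1)"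
  by (simp add: CD_mat_def)

lemma mult_vec_index:
  assumes "A \<in> carrier_mat (d + 1) (d + 1)" "v \<in> carrier_vec (d + 1)" "i \<le> d"
  shows "vec_index (A *\<^sub>v v) i = (\<Sum>l\<le>d. A $$ (i, l) * vec_index v l)"
  using assms by (auto simp: scalar_prod_def atLeast0LessThan lessThan_Suc_atMost intro!: sum.cong)

lemma scalar_prod_sum:
  assumes "v \<in> carrier_vec (d + 1)" "w \<in> carrier_vec (d + 1)"
  shows "scalar_prod v w = (\<Sum>i\<le>d. vec_index v i * vec_index w i)"
  using assms by (auto simp: scalar_prod_def atLeast0LessThan lessThan_Suc_atMost intro!: sum.cong)

text \<open>The negative corner is the single entry leading from row \<open>N - 1\<close>, below the
  cut, to column \<open>N\<close>. Every other nonzero entry leads from a row at or above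
  \<open>N\<close> to a column below \<open>N\<close>, where the difference of the indicators is
  +1.\<close>

lemma CD_mat_eq_cut_mat:
  assumes "1 \<le> N" "d \<le> N" "1 \<le> d"
  shows "CD_mat d c N = cut_mat d N (Q_imat d c)"
proof (rule eq_matI)
  fix i k assume "i < dim_row (cut_mat d N (Q_imat d c))" "k < dim_col (cut_mat d N (Q_imat d c))"
  then have ik: "i \<le> d" "k \<le> d" by (auto simp: cut_mat_def)
  show "CD_mat d c N $$ (i, k) = cut_mat d N (Q_imat d c) $$ (i, k)"
  proof (cases i)
    case 0
    have "int (N - 1) - int (N - d + d) = -1" using assms by simp
    then show ?thesis
      using ik assms 0 by (auto simp: CD_mat_def cut_mat_def below_def Q_imat_def)
  next
    case (Suc j)
    have "int (N - 1 + i) - int (N - d + k) = int d + int j - int k" "N - 1 + i = N + j"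
      using assms Suc by auto
    then show ?thesis
      using ik assms Suc by (auto simp: CD_mat_def cut_mat_def below_def Q_imat_def algebra_simps)
  qed
qed (auto simp: cut_mat_def CD_mat_def)

text \<open>A nonzero entry of the commutator joins an index below \<open>N\<close> with one that is
  not, so the band confines it to the block; the bound \<open>M\<close> only stands for an infinite
  range of summation.\<close>

lemma cut_mat_form:
  assumes N: "1 \<le> N" "d \<le> N" "1 \<le> d" and M: "N + d \<le> M" and L: "banded d 1 L"
  shows "scalar_prod (slice \<phi> (N - 1) d) (cut_mat d N L *\<^sub>v slice \<eta> (N - d) d)
    = (\<Sum>n<M. \<Sum>m<M. \<phi> n * (L n m * (below N m - below N n)) * \<eta> m)"
proof -
  let ?X = "\<lambda>n m. L n m * (below N m - below N n)"
  have nz: "N - 1 \<le> n \<and> n \<le> N - 1 + d \<and> N - d \<le> m \<and> m \<le> N - d + d" if "?X n m \<noteq> 0" for n m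
  proof -
    have "n \<le> m + d" "m \<le> n + 1" "below N m \<noteq> below N n"
      using that bandedD[OF L, of n m] by auto
    then show ?thesis using N by (auto simp: below_def split: if_splits)
  qed
  have "(\<Sum>n<M. \<Sum>m<M. \<phi> n * ?X n m * \<eta> m) = (\<Sum>i\<le>d. \<Sum>m<M. \<phi> (N - 1 + i) * ?X (N - 1 + i) m * \<eta> m)"
  proof (rule sum_slice)
    fix n assume "(\<Sum>m<M. \<phi> n * ?X n m * \<eta> m) \<noteq> 0"
    then obtain m where "\<phi> n * ?X n m * \<eta> m \<noteq> 0" by (meson sum.not_neutral_contains_not_neutral)
    then have "?X n m \<noteq> 0" by auto
    from nz[OF this] show "N - 1 \<le> n \<and> n \<le> N - 1 + d" by simp
  qed (use N M in auto)
  also have "\<dots> = (\<Sum>i\<le>d. \<Sum>k\<le>d. \<phi> (N - 1 + i) * ?X (N - 1 + i) (N - d + k) * \<eta> (N - d + k))"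
  proof (rule sum.cong[OF refl], rule sum_slice)
    fix i m assume "\<phi> (N - 1 + i) * ?X (N - 1 + i) m * \<eta> m \<noteq> 0"
    then have "?X (N - 1 + i) m \<noteq> 0" by auto
    from nz[OF this] show "N - d \<le> m \<and> m \<le> N - d + d" by simp
  qed (use N M in auto)
  also have "\<dots> = (\<Sum>i\<le>d. \<phi> (N - 1 + i) * vec_index (cut_mat d N L *\<^sub>v slice \<eta> (N - d) d) i)"
    by (intro sum.cong refl, subst mult_vec_index[OF cut_mat_carrier slice_carrier])
      (auto simp: sum_distrib_left mult.assoc cut_mat_def)
  also have "\<dots> = scalar_prod (slice \<phi> (N - 1) d) (cut_mat d N L *\<^sub>v slice \<eta> (N - d) d)"
    by (subst scalar_prod_sum[of _ d]) (auto intro!: mult_mat_vec_carrier[of _ _ "d+1"] cut_mat_carrier slice_carrier simp del: mult_mat_vec_carrier One_nat_def)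
  finally show ?thesis by simp
qed

text \<open>The matrix \<open>X\<close> in the proof is \<open>[\<Pi>, W]\<close>, which only sees indices where \<open>\<psi>\<close> and \<open>\<phi>\<close> satisfy their
  eigenvalue equations.\<close>

lemma commutator_jacobi:
  fixes \<phi> \<psi> :: "nat \<Rightarrow> complex"
  assumes W: "banded t s W"
    and comm: "\<And>n m. n < M \<Longrightarrow> m < M \<Longrightarrow> n \<noteq> m \<Longrightarrow> min n m < N \<Longrightarrow>
      L' n m = (\<Sum>l<M. L n l * W l m - W n l * L l m)"
    and rows: "\<And>n. N \<le> n + t \<Longrightarrow> n < N + s \<Longrightarrow> (\<Sum>m<M. L n m * \<psi> m) = x * \<psi> n"
    and cols: "\<And>n. N \<le> n + s \<Longrightarrow> n < N + t \<Longrightarrow> (\<Sum>m<M. \<phi> m * L m n) = x * \<phi> n"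
  shows "(\<Sum>n<M. \<Sum>l<M. \<phi> n * (L n l * (below N l - below N n)) * (\<Sum>m<M. W l m * \<psi> m))
       - (\<Sum>l<M. \<Sum>m<M. (\<Sum>n<M. \<phi> n * W n l) * (L l m * (below N m - below N l)) * \<psi> m)
       = (\<Sum>n<M. \<Sum>m<M. \<phi> n * (L' n m * (below N m - below N n)) * \<psi> m)"
    (is "?T1 - ?T2 = ?T3")
proof -
  let ?b = "below N"
  define X where "X l m = W l m * (?b l - ?b m)" for l m
  \<comment> \<open>A nonzero entry of \<open>X\<close> straddles \<open>N\<close>, so the band
    widths \<open>t\<close> and \<open>s\<close> confine its two indices exactly to the ranges on
    which \<open>cols\<close> and \<open>rows\<close> are assumed.\<close>
  have X0: "N \<le> l + s \<and> l < N + t \<and> N \<le> m + t \<and> m < N + s" if "X l m \<noteq> 0" for l m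
    using that bandedD[OF W, of l m] by (auto simp: X_def below_def split: if_splits)
  have T1: "?T1 = (\<Sum>n<M. \<Sum>l<M. \<Sum>m<M. \<phi> n * L n l * (?b l - ?b n) * W l m * \<psi> m)"
    by (simp add: sum_distrib_left mult.assoc)
  have "?T2 = (\<Sum>l<M. \<Sum>m<M. \<Sum>n<M. \<phi> n * W n l * L l m * (?b m - ?b l) * \<psi> m)"
    by (simp add: sum_distrib_right mult.assoc)
  also have "\<dots> = (\<Sum>l<M. \<Sum>n<M. \<Sum>m<M. \<phi> n * W n l * L l m * (?b m - ?b l) * \<psi> m)"
    by (intro sum.cong refl sum.swap)
  also have "\<dots> = (\<Sum>n<M. \<Sum>l<M. \<Sum>m<M. \<phi> n * W n l * L l m * (?b m - ?b l) * \<psi> m)"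
    by (rule sum.swap)
  finally have T2: "?T2 = \<dots>" .
  have "?T3 = (\<Sum>n<M. \<Sum>m<M. \<Sum>l<M. \<phi> n * (L n l * W l m - W n l * L l m) * (?b m - ?b n) * \<psi> m)"
  proof (intro sum.cong refl)
    fix n m assume "n \<in> {..<M}" "m \<in> {..<M}"
    then show "\<phi> n * (L' n m * (?b m - ?b n)) * \<psi> m =
      (\<Sum>l<M. \<phi> n * (L n l * W l m - W n l * L l m) * (?b m - ?b n) * \<psi> m)"
    proof (cases "?b m = ?b n")
      case False
      then have "n \<noteq> m" "min n m < N" by (auto simp: below_def split: if_splits)
      then show ?thesis using comm[of n m] \<open>n \<in> _\<close> \<open>m \<in> _\<close>
        by (simp add: sum_distrib_left sum_distrib_right mult.assoc)
    qed auto
  qed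
  also have "\<dots> = (\<Sum>n<M. \<Sum>l<M. \<Sum>m<M. \<phi> n * (L n l * W l m - W n l * L l m) * (?b m - ?b n) * \<psi> m)"
    by (intro sum.cong refl sum.swap)
  finally have T3: "?T3 = \<dots>" .
  have "(\<Sum>n<M. \<Sum>l<M. \<Sum>m<M. \<phi> n * L n l * X l m * \<psi> m)
      = (\<Sum>l<M. \<Sum>n<M. \<Sum>m<M. \<phi> n * L n l * X l m * \<psi> m)"
    by (rule sum.swap)
  also have "\<dots> = (\<Sum>l<M. \<Sum>m<M. \<Sum>n<M. \<phi> n * L n l * X l m * \<psi> m)"
    by (intro sum.cong refl sum.swap)
  also have "\<dots> = (\<Sum>l<M. \<Sum>m<M. x * (\<phi> l * X l m * \<psi> m))"
  proof (intro sum.cong refl)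
    fix l m
    show "(\<Sum>n<M. \<phi> n * L n l * X l m * \<psi> m) = x * (\<phi> l * X l m * \<psi> m)"
    proof (cases "X l m = 0")
      case False
      have "(\<Sum>n<M. \<phi> n * L n l * X l m * \<psi> m) = (\<Sum>n<M. \<phi> n * L n l) * X l m * \<psi> m"
        by (simp add: sum_distrib_right)
      then show ?thesis using cols[of l] X0[of l m] False by simp
    qed auto
  qed
  finally have E1: "(\<Sum>n<M. \<Sum>l<M. \<Sum>m<M. \<phi> n * L n l * X l m * \<psi> m)
      = (\<Sum>l<M. \<Sum>m<M. x * (\<phi> l * X l m * \<psi> m))" .
  have E2: "(\<Sum>n<M. \<Sum>l<M. \<Sum>m<M. \<phi> n * X n l * L l m * \<psi> m)
      = (\<Sum>n<M. \<Sum>l<M. x * (\<phi> n * X n l * \<psi> l))"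
  proof (intro sum.cong refl)
    fix n l
    show "(\<Sum>m<M. \<phi> n * X n l * L l m * \<psi> m) = x * (\<phi> n * X n l * \<psi> l)"
    proof (cases "X n l = 0")
      case False
      have "(\<Sum>m<M. \<phi> n * X n l * L l m * \<psi> m) = \<phi> n * X n l * (\<Sum>m<M. L l m * \<psi> m)"
        by (simp add: sum_distrib_left mult.assoc)
      then show ?thesis using rows[of l] X0[of n l] False by simp
    qed auto
  qed
  have "?T1 - ?T2 - ?T3 = (\<Sum>n<M. \<Sum>l<M. \<Sum>m<M. \<phi> n * L n l * X l m * \<psi> m)
      - (\<Sum>n<M. \<Sum>l<M. \<Sum>m<M. \<phi> n * X n l * L l m * \<psi> m)"
    unfolding T1 T2 T3 sum_subtractf[symmetric]
    by (intro sum.cong refl) (simp add: X_def algebra_simps)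
  then show ?thesis unfolding E1 E2 by simp
qed

section \<open>Local solutions of banded equations with a prescribed window\<close>

lemma band_solution_aux:
  fixes E :: imat and f0 :: "nat \<Rightarrow> complex"
  assumes band: "banded a b E" and lo: "a \<le> N" "N \<le> M"
    and up: "\<And>n. N \<le> n \<Longrightarrow> n < N + k \<Longrightarrow> E n (n + b) \<noteq> 0" and M: "N + k + b \<le> M"
  shows "\<exists>f. (\<forall>m<N + b. f m = f0 m) \<and> (\<forall>n. N \<le> n \<and> n < N + k \<longrightarrow> (\<Sum>m<M. E n m * f m) = 0)"
  using up M
proof (induction k)
  case 0 then show ?case by auto
next
  case (Suc k)
  then obtain f where f: "\<forall>m<N + b. f m = f0 m"
    "\<forall>n. N \<le> n \<and> n < N + k \<longrightarrow> (\<Sum>m<M. E n m * f m) = 0" by auto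
  let ?n = "N + k" let ?q = "N + k + b"
  \<comment> \<open>No row solved so far reaches column \<open>?q\<close>, so its value is still
    free; it is chosen to solve row \<open>?n\<close>.\<close>
  define g where "g = f(?q := - (\<Sum>m\<in>{..<M} - {?q}. E ?n m * f m) / E ?n ?q)"
  have nz: "E ?n ?q \<noteq> 0" using Suc.prems(1)[of ?n] by simp
  have "(\<Sum>m<M. E n m * g m) = 0" if n: "N \<le> n" "n < N + Suc k" for n
  proof (cases "n = ?n")
    case True
    have "(\<Sum>m<M. E ?n m * g m) = E ?n ?q * g ?q + (\<Sum>m\<in>{..<M} - {?q}. E ?n m * g m)"
      by (rule sum.remove) (use Suc.prems in auto)
    also have "(\<Sum>m\<in>{..<M} - {?q}. E ?n m * g m) = (\<Sum>m\<in>{..<M} - {?q}. E ?n m * f m)"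
      by (intro sum.cong) (auto simp: g_def)
    finally show ?thesis using True nz by (simp add: g_def)
  next
    case False
    then have "n < N + k" using n by simp
    moreover have "E n ?q = 0" using banded_zero[OF band, of n ?q] \<open>n < N + k\<close> by simp
    then have "(\<Sum>m<M. E n m * g m) = (\<Sum>m<M. E n m * f m)"
      by (intro sum.cong refl) (auto simp: g_def)
    ultimately show ?thesis using f(2) n by simp
  qed
  then show ?case using f(1) by (intro exI[of _ g]) (auto simp: g_def)
qed

text \<open>The \<open>a + b\<close> values around \<open>N\<close> are free data. Each row from
  \<open>N\<close> upwards then determines one new value through the outermost superdiagonal, each
  row below \<open>N\<close> one through the outermost subdiagonal. Only finitely many rows are
  solved, which is all that a cut at \<open>N\<close> sees and keeps the downward continuation away
  from index 0.\<close>

lemma band_solution: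
  fixes E :: imat and f0 :: "nat \<Rightarrow> complex"
  assumes band: "banded a b E" and N: "a + t \<le> N"
    and up: "\<And>n. N \<le> n \<Longrightarrow> n < N + k \<Longrightarrow> E n (n + b) \<noteq> 0" and M: "N + k + b \<le> M"
    and down: "\<And>n. N \<le> n + t \<Longrightarrow> n < N \<Longrightarrow> E n (n - a) \<noteq> 0"
  shows "\<exists>f. (\<forall>m. N \<le> m + a \<and> m < N + b \<longrightarrow> f m = f0 m) \<and>
    (\<forall>n. N \<le> n + t \<and> n < N + k \<longrightarrow> (\<Sum>m<M. E n m * f m) = 0)"
  using N down
proof (induction t)
  case 0
  then show ?case using band_solution_aux[OF band _ _ up M, of f0] M by auto
next
  case (Suc t)
  then obtain f where f: "\<forall>m. N \<le> m + a \<and> m < N + b \<longrightarrow> f m = f0 m"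
    "\<forall>n. N \<le> n + t \<and> n < N + k \<longrightarrow> (\<Sum>m<M. E n m * f m) = 0" by auto
  let ?n = "N - Suc t" let ?q = "N - Suc t - a"
  define g where "g = f(?q := - (\<Sum>m\<in>{..<M} - {?q}. E ?n m * f m) / E ?n ?q)"
  have nz: "E ?n ?q \<noteq> 0" using Suc.prems(1) by (intro Suc.prems(2)) auto
  have "(\<Sum>m<M. E n m * g m) = 0" if n: "N \<le> n + Suc t" "n < N + k" for n
  proof (cases "n = ?n")
    case True
    have "(\<Sum>m<M. E ?n m * g m) = E ?n ?q * g ?q + (\<Sum>m\<in>{..<M} - {?q}. E ?n m * g m)"
      by (rule sum.remove) (use Suc.prems M in auto)
    also have "(\<Sum>m\<in>{..<M} - {?q}. E ?n m * g m) = (\<Sum>m\<in>{..<M} - {?q}. E ?n m * f m)"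
      by (intro sum.cong) (auto simp: g_def)
    finally show ?thesis using True nz by (simp add: g_def)
  next
    case False
    then have n': "N \<le> n + t" using n Suc.prems(1) by linarith
    have "E n ?q = 0" using banded_zero[OF band, of n ?q] n' Suc.prems(1) by simp
    then have "(\<Sum>m<M. E n m * g m) = (\<Sum>m<M. E n m * f m)"
      by (intro sum.cong refl) (auto simp: g_def)
    then show ?thesis using f(2) n n' by simp
  qed
  then show ?case using f(1) Suc.prems(1) by (intro exI[of _ g]) (auto simp: g_def)
qed

section \<open>Ladder matrices shift windows of solutions\<close>

lemma sum_slice_rev:
  fixes g :: "nat \<Rightarrow> complex"
  assumes "\<And>m. m < M \<Longrightarrow> g m \<noteq> 0 \<Longrightarrow> m \<le> b \<and> b \<le> m + k" "k \<le> b" "b < M"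
  shows "(\<Sum>m<M. g m) = (\<Sum>j\<le>k. g (b - j))"
proof -
  have "(\<Sum>m<M. g m) = (\<Sum>i\<le>k. g (b - k + i))"
    by (rule sum_slice) (use assms in force)+
  also have "\<dots> = (\<Sum>j\<le>k. g (b - j))"
    using sum.nat_diff_reindex[of "\<lambda>i. g (b - k + i)" "Suc k"] assms(2)
    by (auto simp: lessThan_Suc_atMost intro!: sum.cong)
  finally show ?thesis .
qed

lemma Q_row_sum:
  assumes "d \<le> n" "n + 1 < M"
  shows "(\<Sum>m<M. Q_imat d c n m * \<psi> m)
    = (\<Sum>j\<le>d. c (int j) n * \<psi> (n - j)) + c (-1) n * \<psi> (n + 1)"
proof -
  have "(\<Sum>m<M. Q_imat d c n m * \<psi> m) = (\<Sum>j\<le>d+1. Q_imat d c n (n + 1 - j) * \<psi> (n + 1 - j))"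
    by (rule sum_slice_rev) (use assms in \<open>auto simp: Q_imat_def split: if_splits\<close>)
  also have "\<dots> = Q_imat d c n (n + 1) * \<psi> (n + 1) + (\<Sum>j\<le>d. Q_imat d c n (n - j) * \<psi> (n - j))"
    by (simp add: sum.atMost_Suc_shift del: sum.atMost_Suc)
  also have "(\<Sum>j\<le>d. Q_imat d c n (n - j) * \<psi> (n - j)) = (\<Sum>j\<le>d. c (int j) n * \<psi> (n - j))"
    by (intro sum.cong refl) (use assms in \<open>auto simp: Q_imat_def of_nat_diff\<close>)
  finally show ?thesis by (simp add: Q_imat_def)
qed

lemma Q_col_sum:
  assumes "1 \<le> n" "n + d < M"
  shows "(\<Sum>m<M. \<phi> m * Q_imat d c m n)
    = \<phi> (n - 1) * c (-1) (n - 1) + (\<Sum>j\<le>d. \<phi> (n + j) * c (int j) (n + j))"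
proof -
  have "(\<Sum>m<M. \<phi> m * Q_imat d c m n) = (\<Sum>j\<le>d+1. \<phi> (n - 1 + j) * Q_imat d c (n - 1 + j) n)"
    by (rule sum_slice) (use assms in \<open>auto simp: Q_imat_def split: if_splits\<close>)
  also have "\<dots> = \<phi> (n - 1) * Q_imat d c (n - 1) n + (\<Sum>j\<le>d. \<phi> (n + j) * Q_imat d c (n + j) n)"
    using assms by (simp add: sum.atMost_Suc_shift del: sum.atMost_Suc)
  also have "(\<Sum>j\<le>d. \<phi> (n + j) * Q_imat d c (n + j) n) = (\<Sum>j\<le>d. \<phi> (n + j) * c (int j) (n + j))"
    by (intro sum.cong refl) (auto simp: Q_imat_def)
  finally show ?thesis using assms by (simp add: Q_imat_def of_nat_diff)
qed

text \<open>Stated index by index, because the sequences in use solve the right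
  (\<open>row_sol\<close>) or left (\<open>col_sol\<close>) eigenvector equation only near
  \<open>N\<close>.\<close>

definition row_sol :: "nat \<Rightarrow> coeffs \<Rightarrow> complex \<Rightarrow> nat \<Rightarrow> (nat \<Rightarrow> complex) \<Rightarrow> nat \<Rightarrow> bool" where
  "row_sol d c x M \<psi> n \<longleftrightarrow> (\<Sum>m<M. Q_imat d c n m * \<psi> m) = x * \<psi> n"

definition col_sol :: "nat \<Rightarrow> coeffs \<Rightarrow> complex \<Rightarrow> nat \<Rightarrow> (nat \<Rightarrow> complex) \<Rightarrow> nat \<Rightarrow> bool" where
  "col_sol d c x M \<phi> n \<longleftrightarrow> (\<Sum>m<M. \<phi> m * Q_imat d c m n) = x * \<phi> n"

lemma ladder_carrier [simp]: "ladder d c n x \<in> carrier_mat (d + 1) (d + 1)"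
  "dual_ladder d c n x \<in> carrier_mat (d + 1) (d + 1)"
  by (simp_all add: ladder_def dual_ladder_def)

lemma ladder_carrier_Suc [simp]: "ladder d c n x \<in> carrier_mat (Suc d) (Suc d)"
  "dual_ladder d c n x \<in> carrier_mat (Suc d) (Suc d)"
  by (simp_all add: ladder_def dual_ladder_def)

text \<open>The ladder matrix is the companion matrix of the equation at index \<open>n\<close>: its
  first \<open>d\<close> rows shift the window, its last row solves the equation for the value at
  \<open>n + 1\<close>.\<close>

lemma ladder_slice:
  assumes "row_sol d c x M \<psi> n" "d \<le> n" "n + 1 < M" "c (-1) n \<noteq> 0"
  shows "ladder d c n x *\<^sub>v slice \<psi> (n - d) d = slice \<psi> (n + 1 - d) d"
proof (rule eq_vecI)
  fix i assume "i < dim_vec (slice \<psi> (n + 1 - d) d)"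
  then have i: "i \<le> d" by simp
  have "vec_index (ladder d c n x *\<^sub>v slice \<psi> (n - d) d) i
    = (\<Sum>l\<le>d. ladder d c n x $$ (i, l) * \<psi> (n - d + l))"
    using mult_vec_index[OF ladder_carrier(1) slice_carrier i] by simp
  also have "\<dots> = \<psi> (n + 1 - d + i)"
  proof (cases "i < d")
    case True
    have "(\<Sum>l\<le>d. ladder d c n x $$ (i, l) * \<psi> (n - d + l))
        = (\<Sum>l\<le>d. if l = i + 1 then \<psi> (n - d + l) else 0)"
      by (intro sum.cong refl) (use True in \<open>auto simp: ladder_def\<close>)
    then show ?thesis using True assms(2) by (simp add: Suc_diff_le)
  next
    case False
    have "(\<Sum>l\<le>d. ladder d c n x $$ (i, l) * \<psi> (n - d + l))
        = (\<Sum>l\<le>d. ((if l = d then x * \<psi> n else 0) - c (int d - int l) n * \<psi> (n - d + l)) / c (-1) n)"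
      by (intro sum.cong refl) (use False i assms(2) in \<open>auto simp: ladder_def divide_simps algebra_simps\<close>)
    also have "\<dots> = (x * \<psi> n - (\<Sum>l\<le>d. c (int d - int l) n * \<psi> (n - d + l))) / c (-1) n"
      by (simp add: sum_divide_distrib[symmetric] sum_subtractf)
    also have "(\<Sum>l\<le>d. c (int d - int l) n * \<psi> (n - d + l)) = (\<Sum>j\<le>d. c (int j) n * \<psi> (n - j))"
      using sum.nat_diff_reindex[of "\<lambda>j. c (int j) n * \<psi> (n - j)" "Suc d"] assms(2)
      by (auto simp: lessThan_Suc_atMost of_nat_diff intro!: sum.cong)
    also have "x * \<psi> n - \<dots> = c (-1) n * \<psi> (n + 1)"
      using assms(1) Q_row_sum[OF assms(2,3), of c \<psi>] by (simp add: row_sol_def algebra_simps)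
    finally show ?thesis using assms(2,4) False i by simp
  qed
  finally show "vec_index (ladder d c n x *\<^sub>v slice \<psi> (n - d) d) i = vec_index (slice \<psi> (n + 1 - d) d) i"
    using i by simp
qed (simp add: ladder_def)

text \<open>Dual ladders act on row vectors, hence the transpose. The columns after the first shift
  the window, and the first column solves the left eigenvector equation at \<open>n\<close> for the
  value at \<open>n - 1\<close>.\<close>

lemma dual_ladder_slice:
  assumes "col_sol d c x M \<phi> n" "1 \<le> n" "n + d < M" "c (-1) (n - 1) \<noteq> 0"
  shows "transpose_mat (dual_ladder d c n x) *\<^sub>v slice \<phi> n d = slice \<phi> (n - 1) d"
proof (rule eq_vecI)
  fix i assume "i < dim_vec (slice \<phi> (n - 1) d)"
  then have i: "i \<le> d" by simp
  have "vec_index (transpose_mat (dual_ladder d c n x) *\<^sub>v slice \<phi> n d) i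
    = (\<Sum>l\<le>d. transpose_mat (dual_ladder d c n x) $$ (i, l) * \<phi> (n + l))"
    by (subst mult_vec_index[of _ d, OF _ slice_carrier i]) auto
  also have "\<dots> = (\<Sum>l\<le>d. dual_ladder d c n x $$ (l, i) * \<phi> (n + l))"
    by (intro sum.cong refl, subst index_transpose_mat) (use i in \<open>auto simp: dual_ladder_def\<close>)
  also have "\<dots> = \<phi> (n - 1 + i)"
  proof (cases i)
    case (Suc k)
    have "(\<Sum>l\<le>d. dual_ladder d c n x $$ (l, i) * \<phi> (n + l))
        = (\<Sum>l\<le>d. if l = k then \<phi> (n + l) else 0)"
      by (intro sum.cong refl) (use Suc i in \<open>auto simp: dual_ladder_def\<close>)
    then show ?thesis using Suc i assms(2) by simp
  next
    case 0
    have "(\<Sum>l\<le>d. dual_ladder d c n x $$ (l, i) * \<phi> (n + l))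
        = (\<Sum>l\<le>d. ((if l = 0 then x * \<phi> n else 0) - \<phi> (n + l) * c (int l) (n + l)) / c (-1) (n - 1))"
      by (intro sum.cong refl) (use 0 in \<open>auto simp: dual_ladder_def divide_simps algebra_simps\<close>)
    also have "\<dots> = (x * \<phi> n - (\<Sum>j\<le>d. \<phi> (n + j) * c (int j) (n + j))) / c (-1) (n - 1)"
      by (simp add: sum_divide_distrib[symmetric] sum_subtractf)
    also have "x * \<phi> n - (\<Sum>j\<le>d. \<phi> (n + j) * c (int j) (n + j)) = \<phi> (n - 1) * c (-1) (n - 1)"
      using assms(1) Q_col_sum[OF assms(2,3), of \<phi> c] by (simp add: col_sol_def algebra_simps)
    finally show ?thesis using assms(4) 0 by simp
  qed
  finally show "vec_index (transpose_mat (dual_ladder d c n x) *\<^sub>v slice \<phi> n d) i = vec_index (slice \<phi> (n - 1) d) i"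
    using i by simp
qed (simp add: dual_ladder_def)

section \<open>Inverses of the ladder matrices, and products of ladders\<close>

lemma inv_mat:
  assumes A: "A \<in> carrier_mat n n"
    and inj: "\<And>v. v \<in> carrier_vec n \<Longrightarrow> A *\<^sub>v v = 0\<^sub>v n \<Longrightarrow> v = 0\<^sub>v n"
  shows "inv_mat A \<in> carrier_mat n n" "A * inv_mat A = 1\<^sub>m n" "inv_mat A * A = 1\<^sub>m n"
proof -
  have "Determinant.det A \<noteq> 0"
    using inj det_0_iff_vec_prod_zero_field[OF A] by blast
  from det_non_zero_imp_unit[OF A this, of "()"] mat_inverse(1)[OF A, where b = "()"]
  obtain B where "mat_inverse A = Some B" by (cases "mat_inverse A") auto
  with mat_inverse(2)[OF A this]
  show "inv_mat A \<in> carrier_mat n n" "A * inv_mat A = 1\<^sub>m n" "inv_mat A * A = 1\<^sub>m n" by auto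
qed

text \<open>On a kernel vector the shift rows annihilate every component but the first, and the last
  row multiplies that one by \<open>c (int d) n\<close> up to a nonzero factor.\<close>

lemma ladder_inv:
  assumes "1 \<le> d" "c (-1) n \<noteq> 0" "c (int d) n \<noteq> 0"
  shows "ladder_inv d c n x \<in> carrier_mat (d + 1) (d + 1)"
    "ladder_inv d c n x * ladder d c n x = 1\<^sub>m (d + 1)"
proof -
  have "v = 0\<^sub>v (d + 1)" if v: "v \<in> carrier_vec (d + 1)" and 0: "ladder d c n x *\<^sub>v v = 0\<^sub>v (d + 1)" for v
  proof -
    have eq: "(\<Sum>l\<le>d. ladder d c n x $$ (i, l) * vec_index v l) = 0" if "i \<le> d" for i
      using mult_vec_index[OF ladder_carrier(1) v that, symmetric] 0 that by simp
    have up: "vec_index v (Suc i) = 0" if "i < d" for i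
    proof -
      have "(\<Sum>l\<le>d. ladder d c n x $$ (i, l) * vec_index v l) = (\<Sum>l\<le>d. if l = Suc i then vec_index v l else 0)"
        by (intro sum.cong refl) (use that in \<open>auto simp: ladder_def\<close>)
      then show ?thesis using eq[of i] that by simp
    qed
    have "(\<Sum>l\<le>d. ladder d c n x $$ (d, l) * vec_index v l)
        = (\<Sum>l\<le>d. if l = 0 then - c (int d) n / c (-1) n * vec_index v 0 else 0)"
    proof (intro sum.cong refl)
      fix l assume "l \<in> {..d}"
      then show "ladder d c n x $$ (d, l) * vec_index v l
        = (if l = 0 then - c (int d) n / c (-1) n * vec_index v 0 else 0)"
        using assms(1) up[of "l - 1"] by (cases l) (auto simp: ladder_def)
    qed
    then have "vec_index v 0 = 0" using eq[of d] assms by simp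
    with up have "vec_index v i = 0" if "i \<le> d" for i using that by (cases i) auto
    then show ?thesis using v by (intro eq_vecI) auto
  qed
  from inv_mat[OF ladder_carrier(1) this]
  show "ladder_inv d c n x \<in> carrier_mat (d + 1) (d + 1)"
    "ladder_inv d c n x * ladder d c n x = 1\<^sub>m (d + 1)" by blast+
qed

lemma dual_ladder_inv:
  assumes "1 \<le> d" "c (-1) (n - 1) \<noteq> 0" "c (int d) (n + d) \<noteq> 0"
  shows "dual_ladder_inv d c n x \<in> carrier_mat (d + 1) (d + 1)"
    "dual_ladder d c n x * dual_ladder_inv d c n x = 1\<^sub>m (d + 1)"
proof -
  have "v = 0\<^sub>v (d + 1)" if v: "v \<in> carrier_vec (d + 1)" and 0: "dual_ladder d c n x *\<^sub>v v = 0\<^sub>v (d + 1)" for v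
  proof -
    let ?g = "\<lambda>i. ((if i = 0 then x else 0) - c (int i) (n + i)) / c (-1) (n - 1)"
    have eq: "?g i * vec_index v 0 + (if i < d then vec_index v (Suc i) else 0) = 0" if "i \<le> d" for i
    proof -
      have "0 = (\<Sum>l\<le>d. dual_ladder d c n x $$ (i, l) * vec_index v l)"
        using mult_vec_index[OF ladder_carrier(2) v that, symmetric] 0 that by simp
      also have "\<dots> = (\<Sum>l\<le>d. (if l = 0 then ?g i * vec_index v 0 else 0) + (if l = Suc i then vec_index v l else 0))"
        by (intro sum.cong refl) (use that in \<open>auto simp: dual_ladder_def\<close>)
      also have "\<dots> = ?g i * vec_index v 0 + (if i < d then vec_index v (Suc i) else 0)"
        by (auto simp: sum.distrib)
      finally show ?thesis by simp
    qed
    have v0: "vec_index v 0 = 0" using eq[of d] assms by simp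
    have "vec_index v i = 0" if "i \<le> d" for i using that v0 eq[of "i - 1"] by (cases i) auto
    then show ?thesis using v by (intro eq_vecI) auto
  qed
  from inv_mat[OF ladder_carrier(2) this]
  show "dual_ladder_inv d c n x \<in> carrier_mat (d + 1) (d + 1)"
    "dual_ladder d c n x * dual_ladder_inv d c n x = 1\<^sub>m (d + 1)" by blast+
qed

lemma ladder_inv_slice:
  assumes "row_sol d c x M \<psi> n" "d \<le> n" "n + 1 < M" "1 \<le> d" "c (-1) n \<noteq> 0" "c (int d) n \<noteq> 0"
  shows "ladder_inv d c n x *\<^sub>v slice \<psi> (n + 1 - d) d = slice \<psi> (n - d) d"
proof -
  note inv = ladder_inv[where c = c and n = n and x = x, OF assms(4,5,6)]
  have "ladder_inv d c n x *\<^sub>v (ladder d c n x *\<^sub>v slice \<psi> (n - d) d)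
      = ladder_inv d c n x * ladder d c n x *\<^sub>v slice \<psi> (n - d) d"
    by (rule assoc_mult_mat_vec[symmetric]) (rule inv ladder_carrier slice_carrier)+
  also have "\<dots> = slice \<psi> (n - d) d" unfolding inv by (rule one_mult_mat_vec[OF slice_carrier])
  finally show ?thesis using ladder_slice[OF assms(1,2,3,5)] by simp
qed

lemma dual_ladder_inv_slice:
  assumes "col_sol d c x M \<phi> n" "1 \<le> n" "n + d < M" "1 \<le> d" "c (-1) (n - 1) \<noteq> 0" "c (int d) (n + d) \<noteq> 0"
  shows "transpose_mat (dual_ladder_inv d c n x) *\<^sub>v slice \<phi> (n - 1) d = slice \<phi> n d"
proof -
  note inv = dual_ladder_inv[where c = c and n = n and x = x, OF assms(4,5,6)]
  have "transpose_mat (dual_ladder_inv d c n x) *\<^sub>v (transpose_mat (dual_ladder d c n x) *\<^sub>v slice \<phi> n d)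
      = transpose_mat (dual_ladder_inv d c n x) * transpose_mat (dual_ladder d c n x) *\<^sub>v slice \<phi> n d"
    by (rule assoc_mult_mat_vec[symmetric, of _ "d + 1" "d + 1" _ "d + 1"]) (use inv(1) in simp_all)
  also have "transpose_mat (dual_ladder_inv d c n x) * transpose_mat (dual_ladder d c n x)
      = transpose_mat (dual_ladder d c n x * dual_ladder_inv d c n x)"
    by (rule transpose_mult[symmetric]) (rule inv ladder_carrier)+
  also have "\<dots> *\<^sub>v slice \<phi> n d = slice \<phi> n d"
    unfolding inv transpose_one by (rule one_mult_mat_vec[OF slice_carrier])
  finally show ?thesis using dual_ladder_slice[OF assms(1,2,3,5)] by simp
qed

lemma mat_prod_Nil [simp]: "mat_prod n [] = 1\<^sub>m n"
  and mat_prod_Cons [simp]: "mat_prod n (A # As) = A * mat_prod n As"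
  by (simp_all add: mat_prod_def)

lemma mat_prod_carrier: "(\<And>A. A \<in> set As \<Longrightarrow> A \<in> carrier_mat n n) \<Longrightarrow> mat_prod n As \<in> carrier_mat n n"
proof (induction As)
  case (Cons A As)
  then have "A \<in> carrier_mat n n" "mat_prod n As \<in> carrier_mat n n" by simp_all
  then show ?case by simp
qed simp

lemma mult_mat_vec_assoc:
  "A \<in> carrier_mat n n \<Longrightarrow> B \<in> carrier_mat n n \<Longrightarrow> v \<in> carrier_vec n \<Longrightarrow> A * B *\<^sub>v v = A *\<^sub>v (B *\<^sub>v v)"
  by (rule assoc_mult_mat_vec)

lemma transpose_mult_mat_vec:
  fixes A B :: "complex mat"
  assumes "A \<in> carrier_mat n n" "B \<in> carrier_mat n n" "v \<in> carrier_vec n"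
  shows "transpose_mat (A * B) *\<^sub>v v = transpose_mat B *\<^sub>v (transpose_mat A *\<^sub>v v)"
  unfolding transpose_mult[OF assms(1,2)]
  by (rule mult_mat_vec_assoc) (use assms in auto)

lemma ladder_prod_slice:
  assumes "\<And>n. N \<le> n \<Longrightarrow> n < N + j \<Longrightarrow> row_sol d c x M \<psi> n" "d \<le> N" "N + j < M" "\<And>n. c (-1) n \<noteq> 0"
  shows "mat_prod (d + 1) (map (\<lambda>k. ladder d c k x) (rev [N..<N+j])) *\<^sub>v slice \<psi> (N - d) d
    = slice \<psi> (N - d + j) d"
  using assms(1,3)
proof (induction j)
  case (Suc j)
  let ?P = "mat_prod (d + 1) (map (\<lambda>k. ladder d c k x) (rev [N..<N+j]))"
  have "?P \<in> carrier_mat (d + 1) (d + 1)" by (rule mat_prod_carrier) auto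
  then have "mat_prod (d + 1) (map (\<lambda>k. ladder d c k x) (rev [N..<N+Suc j])) *\<^sub>v slice \<psi> (N - d) d
    = ladder d c (N + j) x *\<^sub>v (?P *\<^sub>v slice \<psi> (N - d) d)"
    using mult_mat_vec_assoc[of "ladder d c (N + j) x" "d + 1" ?P] by simp
  also have "?P *\<^sub>v slice \<psi> (N - d) d = slice \<psi> (N + j - d) d"
    using Suc assms(2) by simp
  also have "ladder d c (N + j) x *\<^sub>v \<dots> = slice \<psi> (N + j + 1 - d) d"
    by (rule ladder_slice[of _ _ _ M]) (use Suc.prems assms in auto)
  finally show ?case using assms(2) by (simp add: algebra_simps Suc_diff_le)
qed simp

lemma ladder_inv_prod_slice:
  assumes "\<And>n. N - j \<le> n \<Longrightarrow> n < N \<Longrightarrow> row_sol d c x M \<psi> n" "d + j \<le> N" "N < M"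
    "1 \<le> d" "\<And>n. c (-1) n \<noteq> 0" "\<And>n. d \<le> n \<Longrightarrow> c (int d) n \<noteq> 0"
  shows "mat_prod (d + 1) (map (\<lambda>k. ladder_inv d c k x) [N-j..<N]) *\<^sub>v slice \<psi> (N - d) d
    = slice \<psi> (N - d - j) d"
  using assms(1,2)
proof (induction j)
  case (Suc j)
  let ?P = "mat_prod (d + 1) (map (\<lambda>k. ladder_inv d c k x) [N-j..<N])"
  have inv: "ladder_inv d c k x \<in> carrier_mat (d + 1) (d + 1)" if "d \<le> k" for k
    by (rule ladder_inv(1)) (use assms that in auto)
  have P: "?P \<in> carrier_mat (d + 1) (d + 1)"
    by (rule mat_prod_carrier) (use inv Suc.prems(2) in auto)
  \<comment> \<open>The factor of lowest index stands leftmost and acts last, so it is the one split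
    off.\<close>
  have "[N - Suc j..<N] = (N - Suc j) # [N-j..<N]"
    using Suc.prems(2) by (subst upt_conv_Cons) (auto simp: Suc_diff_Suc)
  then have "mat_prod (d + 1) (map (\<lambda>k. ladder_inv d c k x) [N - Suc j..<N]) *\<^sub>v slice \<psi> (N - d) d
    = ladder_inv d c (N - Suc j) x *\<^sub>v (?P *\<^sub>v slice \<psi> (N - d) d)"
    using mult_mat_vec_assoc[OF inv P, of "N - Suc j"] Suc.prems(2) by simp
  also have "?P *\<^sub>v slice \<psi> (N - d) d = slice \<psi> (N - Suc j + 1 - d) d"
    using Suc by (simp add: Suc_diff_Suc algebra_simps)
  also have "ladder_inv d c (N - Suc j) x *\<^sub>v \<dots> = slice \<psi> (N - Suc j - d) d"
    by (rule ladder_inv_slice[of _ _ _ M]) (use Suc.prems assms in auto)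
  finally show ?case by (simp add: algebra_simps)
qed simp

lemma dual_ladder_prod_slice:
  assumes "\<And>n. N - j \<le> n \<Longrightarrow> n < N \<Longrightarrow> col_sol d c x M \<phi> n" "j + 1 \<le> N" "N + d \<le> M" "\<And>n. c (-1) n \<noteq> 0"
  shows "transpose_mat (mat_prod (d + 1) (map (\<lambda>k. dual_ladder d c k x) (rev [N-j..<N]))) *\<^sub>v slice \<phi> (N - 1) d
    = slice \<phi> (N - 1 - j) d"
  using assms(1-3)
proof (induction j arbitrary: N)
  \<comment> \<open>Transposition reverses the product: the leftmost factor, of index
    \<open>N - 1\<close>, now acts first. Splitting it off moves the starting window, hence the
    induction over arbitrary \<open>N\<close>.\<close>
  case (Suc j)
  let ?P = "mat_prod (d + 1) (map (\<lambda>k. dual_ladder d c k x) (rev [N-Suc j..<N-1]))"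
  have P: "?P \<in> carrier_mat (d + 1) (d + 1)" by (rule mat_prod_carrier) auto
  obtain N' where N': "N = Suc N'" using Suc.prems(2) by (cases N) auto
  have "transpose_mat (mat_prod (d + 1) (map (\<lambda>k. dual_ladder d c k x) (rev [N-Suc j..<N]))) *\<^sub>v slice \<phi> (N - 1) d
    = transpose_mat ?P *\<^sub>v (transpose_mat (dual_ladder d c (N - 1) x) *\<^sub>v slice \<phi> (N - 1) d)"
    using transpose_mult_mat_vec[OF ladder_carrier(2) P slice_carrier, of c N' x \<phi> N'] N' by simp
  also have "transpose_mat (dual_ladder d c (N - 1) x) *\<^sub>v slice \<phi> (N - 1) d = slice \<phi> (N - 1 - 1) d"
    by (rule dual_ladder_slice[of _ _ _ M]) (use Suc.prems assms(4) in auto)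
  also have "transpose_mat ?P *\<^sub>v slice \<phi> (N - 1 - 1) d = slice \<phi> (N - 1 - 1 - j) d"
    using Suc.IH[of "N - 1"] Suc.prems by simp
  finally show ?case by simp
qed simp

lemma dual_ladder_inv_prod_slice:
  assumes "\<And>n. N \<le> n \<Longrightarrow> n < N + j \<Longrightarrow> col_sol d c x M \<phi> n" "1 \<le> N" "N + j + d \<le> M"
    "1 \<le> d" "\<And>n. c (-1) n \<noteq> 0" "\<And>n. d \<le> n \<Longrightarrow> c (int d) n \<noteq> 0"
  shows "transpose_mat (mat_prod (d + 1) (map (\<lambda>k. dual_ladder_inv d c k x) [N..<N+j])) *\<^sub>v slice \<phi> (N - 1) d
    = slice \<phi> (N - 1 + j) d"
  using assms(1-3)
proof (induction j arbitrary: N)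
  case (Suc j)
  let ?P = "mat_prod (d + 1) (map (\<lambda>k. dual_ladder_inv d c k x) [Suc N..<Suc N + j])"
  have inv: "dual_ladder_inv d c k x \<in> carrier_mat (d + 1) (d + 1)" for k
    by (rule dual_ladder_inv(1)) (use assms in auto)
  have P: "?P \<in> carrier_mat (d + 1) (d + 1)" by (rule mat_prod_carrier) (use inv in auto)
  have "[N..<N + Suc j] = N # [Suc N..<Suc N + j]" by (simp add: upt_conv_Cons)
  then have "transpose_mat (mat_prod (d + 1) (map (\<lambda>k. dual_ladder_inv d c k x) [N..<N + Suc j])) *\<^sub>v slice \<phi> (N - 1) d
    = transpose_mat ?P *\<^sub>v (transpose_mat (dual_ladder_inv d c N x) *\<^sub>v slice \<phi> (N - 1) d)"
    using transpose_mult_mat_vec[OF inv P slice_carrier, of N \<phi> "N - 1"] by simp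
  also have "transpose_mat (dual_ladder_inv d c N x) *\<^sub>v slice \<phi> (N - 1) d = slice \<phi> (Suc N - 1) d"
    using dual_ladder_inv_slice[of d c x M \<phi> N] Suc.prems assms by simp
  also have "transpose_mat ?P *\<^sub>v slice \<phi> (Suc N - 1) d = slice \<phi> (Suc N - 1 + j) d"
    using Suc.IH[of "Suc N"] Suc.prems by simp
  finally show ?case using Suc.prems(2) by simp
qed simp

section \<open>Band matrices folded onto windows\<close>

lemma window_carrier [simp]: "window f a d \<in> carrier_mat (d + 1) (d + 1)"
  by (simp add: window_def)

lemma window_slice: "window f a d *\<^sub>v slice \<psi> b d = Matrix.vec (d + 1) (\<lambda>i. f (a + i) * \<psi> (b + i))"
proof (rule eq_vecI)
  fix i assume "i < dim_vec (Matrix.vec (d + 1) (\<lambda>i. f (a + i) * \<psi> (b + i)))"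
  then have i: "i \<le> d" by simp
  have "vec_index (window f a d *\<^sub>v slice \<psi> b d) i
    = (\<Sum>l\<le>d. if l = i then f (a + i) * \<psi> (b + i) else 0)"
    unfolding mult_vec_index[OF window_carrier slice_carrier i]
    by (intro sum.cong refl) (use i in \<open>auto simp: window_def\<close>)
  then show "vec_index (window f a d *\<^sub>v slice \<psi> b d) i = vec_index (Matrix.vec (d + 1) (\<lambda>i. f (a + i) * \<psi> (b + i))) i"
    using i by simp
qed (simp add: window_def)

lemma transpose_window: "transpose_mat (window f a d) = window f a d"
  by (auto simp: window_def intro!: eq_matI)

lemma mat_sum_carrier [simp]: "mat_sum n F S \<in> carrier_mat n n"
  by (simp add: mat_sum_def)

lemma mat_sum_mult_vec:
  assumes "v \<in> carrier_vec (d + 1)" "\<And>j. j \<in> S \<Longrightarrow> F j \<in> carrier_mat (d + 1) (d + 1)"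
  shows "mat_sum (d + 1) F S *\<^sub>v v = Matrix.vec (d + 1) (\<lambda>i. \<Sum>j\<in>S. vec_index (F j *\<^sub>v v) i)"
proof (rule eq_vecI)
  fix i assume "i < dim_vec (Matrix.vec (d + 1) (\<lambda>i. \<Sum>j\<in>S. vec_index (F j *\<^sub>v v) i))"
  then have i: "i \<le> d" by simp
  have "vec_index (mat_sum (d + 1) F S *\<^sub>v v) i = (\<Sum>l\<le>d. \<Sum>j\<in>S. F j $$ (i, l) * vec_index v l)"
    unfolding mult_vec_index[OF mat_sum_carrier assms(1) i]
    by (intro sum.cong refl) (use i in \<open>auto simp: mat_sum_def sum_distrib_right\<close>)
  also have "\<dots> = (\<Sum>j\<in>S. \<Sum>l\<le>d. F j $$ (i, l) * vec_index v l)" by (rule sum.swap)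
  also have "\<dots> = (\<Sum>j\<in>S. vec_index (F j *\<^sub>v v) i)"
    by (intro sum.cong refl) (simp add: mult_vec_index[OF assms(2) assms(1) i])
  finally show "vec_index (mat_sum (d + 1) F S *\<^sub>v v) i
    = vec_index (Matrix.vec (d + 1) (\<lambda>i. \<Sum>j\<in>S. vec_index (F j *\<^sub>v v) i)) i" using i by simp
qed (simp add: mat_sum_def)

lemma transpose_mat_sum:
  assumes "\<And>j. j \<in> S \<Longrightarrow> F j \<in> carrier_mat n n"
  shows "transpose_mat (mat_sum n F S) = mat_sum n (\<lambda>j. transpose_mat (F j)) S"
proof (rule eq_matI)
  fix i k assume "i < dim_row (mat_sum n (\<lambda>j. transpose_mat (F j)) S)" "k < dim_col (mat_sum n (\<lambda>j. transpose_mat (F j)) S)"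
  then have "i < n" "k < n" by (auto simp: mat_sum_def)
  moreover from this have "transpose_mat (F j) $$ (i, k) = F j $$ (k, i)" if "j \<in> S" for j
    using assms[OF that] by (intro index_transpose_mat) auto
  ultimately show "transpose_mat (mat_sum n F S) $$ (i, k) = mat_sum n (\<lambda>j. transpose_mat (F j)) S $$ (i, k)"
    by (auto simp: mat_sum_def)
qed (auto simp: mat_sum_def)

text \<open>Each \<open>B j\<close> transports the window from \<open>a\<close> to
  \<open>b j\<close>, after which the diagonal matrix multiplies by one diagonal of a band matrix.
  The sum over \<open>j\<close> is therefore a band matrix applied to the sequence and cut to a
  window, which is what all the differential and deformation matrices encode.\<close>

lemma fold_rows:
  assumes "\<And>j. j \<in> S \<Longrightarrow> B j \<in> carrier_mat (d + 1) (d + 1)"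
    "\<And>j. j \<in> S \<Longrightarrow> B j *\<^sub>v slice \<psi> a d = slice \<psi> (b j) d"
  shows "mat_sum (d + 1) (\<lambda>j. window (g j) (e j) d * B j) S *\<^sub>v slice \<psi> a d
    = Matrix.vec (d + 1) (\<lambda>i. \<Sum>j\<in>S. g j (e j + i) * \<psi> (b j + i))"
proof -
  have "window (g j) (e j) d * B j \<in> carrier_mat (d + 1) (d + 1)" if "j \<in> S" for j
    by (rule mult_carrier_mat[OF window_carrier assms(1)[OF that]])
  then have "mat_sum (d + 1) (\<lambda>j. window (g j) (e j) d * B j) S *\<^sub>v slice \<psi> a d
    = Matrix.vec (d + 1) (\<lambda>i. \<Sum>j\<in>S. vec_index (window (g j) (e j) d * B j *\<^sub>v slice \<psi> a d) i)"
    by (intro mat_sum_mult_vec slice_carrier)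
  also have "\<dots> = Matrix.vec (d + 1) (\<lambda>i. \<Sum>j\<in>S. g j (e j + i) * \<psi> (b j + i))"
  proof (rule eq_vecI, goal_cases)
    case (1 i)
    have "vec_index (window (g j) (e j) d * B j *\<^sub>v slice \<psi> a d) i = g j (e j + i) * \<psi> (b j + i)" if "j \<in> S" for j
      using mult_mat_vec_assoc[OF window_carrier assms(1)[OF that] slice_carrier] assms(2)[OF that] 1
      by (simp add: window_slice)
    then show ?case using 1 by simp
  qed simp
  finally show ?thesis .
qed

lemma fold_cols:
  assumes "\<And>j. j \<in> S \<Longrightarrow> B j \<in> carrier_mat (d + 1) (d + 1)"
    "\<And>j. j \<in> S \<Longrightarrow> transpose_mat (B j) *\<^sub>v slice \<phi> a d = slice \<phi> (b j) d"
  shows "transpose_mat (mat_sum (d + 1) (\<lambda>j. B j * window (g j) (e j) d) S) *\<^sub>v slice \<phi> a d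
    = Matrix.vec (d + 1) (\<lambda>i. \<Sum>j\<in>S. g j (e j + i) * \<phi> (b j + i))"
proof -
  have "transpose_mat (mat_sum (d + 1) (\<lambda>j. B j * window (g j) (e j) d) S)
      = mat_sum (d + 1) (\<lambda>j. transpose_mat (B j * window (g j) (e j) d)) S"
    by (rule transpose_mat_sum) (rule mult_carrier_mat[OF assms(1) window_carrier])
  also have "\<dots> = mat_sum (d + 1) (\<lambda>j. window (g j) (e j) d * transpose_mat (B j)) S"
  proof -
    have "transpose_mat (B j * window (g j) (e j) d) = window (g j) (e j) d * transpose_mat (B j)" if "j \<in> S" for j
      using transpose_mult[OF assms(1)[OF that] window_carrier] by (simp add: transpose_window)
    then show ?thesis by (auto simp: mat_sum_def intro!: eq_matI sum.cong)
  qed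
  also have "\<dots> *\<^sub>v slice \<phi> a d = Matrix.vec (d + 1) (\<lambda>i. \<Sum>j\<in>S. g j (e j + i) * \<phi> (b j + i))"
    by (rule fold_rows) (use assms in auto)
  finally show ?thesis .
qed

lemma mat_eq_forms:
  fixes A B :: "complex mat"
  assumes "A \<in> carrier_mat n n" "B \<in> carrier_mat n n"
    "\<And>v w. v \<in> carrier_vec n \<Longrightarrow> w \<in> carrier_vec n \<Longrightarrow> scalar_prod v (A *\<^sub>v w) = scalar_prod v (B *\<^sub>v w)"
  shows "A = B"
proof (rule eq_matI)
  fix i k assume "i < dim_row B" "k < dim_col B"
  then have ik: "i < n" "k < n" using assms by auto
  have *: "scalar_prod (unit_vec n i) (C *\<^sub>v unit_vec n k) = C $$ (i, k)" if "C \<in> carrier_mat n n" for C :: "complex mat"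
    using that ik by (auto simp: scalar_prod_left_unit[where n = n] scalar_prod_right_unit[where n = n])
  show "A $$ (i, k) = B $$ (i, k)"
    using *[OF assms(1)] *[OF assms(2)] assms(3)[of "unit_vec n i" "unit_vec n k"] by simp
qed (use assms in auto)

text \<open>The hypotheses on \<open>F\<close> and \<open>G\<close> say that these matrices are \<open>W\<close> folded onto windows of right and
  left solutions.\<close>

lemma CD_mat_intertwine:
  assumes N: "1 \<le> d" "d + t \<le> N" "1 + s \<le> N"
    and c: "\<And>n. c (-1) n \<noteq> 0" "\<And>n. d \<le> n \<Longrightarrow> c (int d) n \<noteq> 0"
    and FG: "F \<in> carrier_mat (d + 1) (d + 1)" "G \<in> carrier_mat (d + 1) (d + 1)"
    and W: "banded t s W" and L': "banded d 1 L'"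
    and comm: "\<And>n m M. n \<noteq> m \<Longrightarrow> min n m + b \<le> M \<Longrightarrow>
      L' n m = (\<Sum>l<M. Q_imat d c n l * W l m - W n l * Q_imat d c l m)"
    and F: "\<And>\<psi> M. N + d + s + t < M \<Longrightarrow> (\<And>n. N \<le> n + t \<Longrightarrow> n < N + s \<Longrightarrow> row_sol d c x M \<psi> n) \<Longrightarrow>
      F *\<^sub>v slice \<psi> (N - d) d = slice (\<lambda>n. \<Sum>m<M. W n m * \<psi> m) (N - d) d"
    and G: "\<And>\<phi> M. N + d + s + t < M \<Longrightarrow> (\<And>n. N \<le> n + s \<Longrightarrow> n < N + t \<Longrightarrow> col_sol d c x M \<phi> n) \<Longrightarrow>
      transpose_mat G *\<^sub>v slice \<phi> (N - 1) d = slice (\<lambda>m. \<Sum>n<M. \<phi> n * W n m) (N - 1) d"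
  shows "CD_mat d c N * F - G * CD_mat d c N = cut_mat d N L'"
proof (rule mat_eq_forms[of _ "d + 1"])
  note CD = CD_mat_carrier[of d c N]
  show "CD_mat d c N * F - G * CD_mat d c N \<in> carrier_mat (d + 1) (d + 1)"
    using FG CD by auto
  fix v w :: "complex Matrix.vec" assume v: "v \<in> carrier_vec (d + 1)" and w: "w \<in> carrier_vec (d + 1)"
  \<comment> \<open>The summand \<open>b\<close> makes the truncated commutator exact at every pair
    with \<open>min n m < N\<close>.\<close>
  obtain M where M: "N + d + s + t + b + 2 \<le> M" by blast
  define E where "E n m = Q_imat d c n m - (if n = m then x else 0)" for n m
  have E: "banded d 1 E" "banded 1 d (\<lambda>n m. E m n)"
    using N(1) by (auto simp: banded_def E_def Q_imat_def split: if_splits)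
  \<comment> \<open>With \<open>d\<close> subdiagonals and one superdiagonal the free data number
    \<open>d + 1\<close>, the length of \<open>w\<close>, and sit at \<open>N - d\<close>, ...,
    \<open>N\<close>. The solved rows \<open>N - t\<close>, ..., \<open>N + s - 1\<close> are those
    that \<open>F\<close> and the Jacobi identity require.\<close>
  have "\<exists>\<psi>. (\<forall>m. N \<le> m + d \<and> m < N + 1 \<longrightarrow> \<psi> m = vec_index w (m - (N - d))) \<and>
    (\<forall>n. N \<le> n + t \<and> n < N + s \<longrightarrow> (\<Sum>m<M. E n m * \<psi> m) = 0)"
    by (rule band_solution[OF E(1)]) (use N c M in \<open>auto simp: E_def Q_imat_def of_nat_diff\<close>)
  then obtain \<psi> where \<psi>: "\<And>m. N \<le> m + d \<Longrightarrow> m < N + 1 \<Longrightarrow> \<psi> m = vec_index w (m - (N - d))"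
    "\<And>n. N \<le> n + t \<Longrightarrow> n < N + s \<Longrightarrow> (\<Sum>m<M. E n m * \<psi> m) = 0" by blast
  \<comment> \<open>Transposing exchanges the band widths, so the free window becomes
    \<open>N - 1\<close>, ..., \<open>N + d - 1\<close>, and \<open>s\<close> and \<open>t\<close>
    trade places.\<close>
  have "\<exists>\<phi>. (\<forall>m. N \<le> m + 1 \<and> m < N + d \<longrightarrow> \<phi> m = vec_index v (m - (N - 1))) \<and>
    (\<forall>n. N \<le> n + s \<and> n < N + t \<longrightarrow> (\<Sum>m<M. E m n * \<phi> m) = 0)"
    by (rule band_solution[OF E(2)]) (use N c M in \<open>auto simp: E_def Q_imat_def of_nat_diff\<close>)
  then obtain \<phi> where \<phi>: "\<And>m. N \<le> m + 1 \<Longrightarrow> m < N + d \<Longrightarrow> \<phi> m = vec_index v (m - (N - 1))"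
    "\<And>n. N \<le> n + s \<Longrightarrow> n < N + t \<Longrightarrow> (\<Sum>m<M. E m n * \<phi> m) = 0" by blast
  have wE: "slice \<psi> (N - d) d = w"
    by (rule eq_vecI) (use w \<psi>(1) N in auto)
  have vE: "slice \<phi> (N - 1) d = v"
    by (rule eq_vecI) (use v \<phi>(1) N in auto)
  have rows: "row_sol d c x M \<psi> n" if "N \<le> n + t" "n < N + s" for n
  proof -
    have "n < M" using that M by simp
    then have "(\<Sum>m<M. E n m * \<psi> m) = (\<Sum>m<M. Q_imat d c n m * \<psi> m) - x * \<psi> n"
      by (simp add: E_def left_diff_distrib sum_subtractf if_distrib[of "\<lambda>z. z * _"] cong: if_cong)
    then show ?thesis using \<psi>(2)[OF that] by (simp add: row_sol_def)
  qed
  have cols: "col_sol d c x M \<phi> n" if "N \<le> n + s" "n < N + t" for n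
  proof -
    have "n < M" using that M by simp
    then have "(\<Sum>m<M. E m n * \<phi> m) = (\<Sum>m<M. Q_imat d c m n * \<phi> m) - x * \<phi> n"
      by (simp add: E_def left_diff_distrib sum_subtractf if_distrib[of "\<lambda>z. z * _"] cong: if_cong)
    then show ?thesis using \<phi>(2)[OF that] by (simp add: col_sol_def mult.commute)
  qed
  have N1: "1 \<le> N" "d \<le> N" "1 \<le> d" "N + d \<le> M" using N M by auto
  note CDe = CD_mat_eq_cut_mat[OF N1(1-3), of c]
  have Fw: "F *\<^sub>v w \<in> carrier_vec (d + 1)" "CD_mat d c N *\<^sub>v w \<in> carrier_vec (d + 1)"
    using FG CD w mult_mat_vec_carrier by blast+
  have 1: "scalar_prod v (CD_mat d c N *\<^sub>v (F *\<^sub>v w)) =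
     (\<Sum>n<M. \<Sum>l<M. \<phi> n * (Q_imat d c n l * (below N l - below N n)) * (\<Sum>m<M. W l m * \<psi> m))"
    using F[of M \<psi>, OF _ rows] M unfolding wE[symmetric] vE[symmetric] CDe
    by (simp add: cut_mat_form[OF N1 banded_Q_imat] del: One_nat_def)
  have "scalar_prod v (G *\<^sub>v (CD_mat d c N *\<^sub>v w)) = scalar_prod (transpose_mat G *\<^sub>v v) (CD_mat d c N *\<^sub>v w)"
    by (rule transpose_vec_mult_scalar[symmetric, OF FG(2) Fw(2) v])
  also have "\<dots> = (\<Sum>l<M. \<Sum>m<M. (\<Sum>n<M. \<phi> n * W n l) * (Q_imat d c l m * (below N m - below N l)) * \<psi> m)"
    using G[of M \<phi>, OF _ cols] M unfolding wE[symmetric] vE[symmetric] CDe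
    by (simp add: cut_mat_form[OF N1 banded_Q_imat] del: One_nat_def)
  finally have 2: "scalar_prod v (G *\<^sub>v (CD_mat d c N *\<^sub>v w)) = \<dots>" .
  have "(CD_mat d c N * F - G * CD_mat d c N) *\<^sub>v w = CD_mat d c N *\<^sub>v (F *\<^sub>v w) - G *\<^sub>v (CD_mat d c N *\<^sub>v w)"
    using minus_mult_distrib_mat_vec[OF mult_carrier_mat[OF CD FG(1)] mult_carrier_mat[OF FG(2) CD] w]
    by (simp add: mult_mat_vec_assoc[OF CD FG(1) w] mult_mat_vec_assoc[OF FG(2) CD w])
  then have "scalar_prod v ((CD_mat d c N * F - G * CD_mat d c N) *\<^sub>v w)
    = scalar_prod v (CD_mat d c N *\<^sub>v (F *\<^sub>v w)) - scalar_prod v (G *\<^sub>v (CD_mat d c N *\<^sub>v w))"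
    using scalar_prod_minus_distrib[OF v mult_mat_vec_carrier[OF CD Fw(1)] mult_mat_vec_carrier[OF FG(2) Fw(2)]] by simp
  also have "\<dots> = (\<Sum>n<M. \<Sum>m<M. \<phi> n * (L' n m * (below N m - below N n)) * \<psi> m)"
    unfolding 1 2
    by (rule commutator_jacobi[OF W, of M N L' "Q_imat d c" \<psi> x \<phi>])
      (use comm rows cols M in \<open>auto simp: row_sol_def col_sol_def\<close>)
  also have "\<dots> = scalar_prod v (cut_mat d N L' *\<^sub>v w)"
    using cut_mat_form[OF N1 L', of \<phi> \<psi>] by (simp add: wE vE del: One_nat_def)
  finally show "scalar_prod v ((CD_mat d c N * F - G * CD_mat d c N) *\<^sub>v w) = scalar_prod v (cut_mat d N L' *\<^sub>v w)" .
qed (rule cut_mat_carrier)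

section \<open>The duality relations from commutation relations\<close>

lemma imat_power_banded:
  assumes "banded a b A"
  shows "banded (k * a) (k * b) (imat_power A k)"
proof (induction k)
  case 0 then show ?case by (auto simp: banded_def split: if_splits)
next
  case (Suc k)
  have "n \<le> m + Suc k * a \<and> m \<le> n + Suc k * b" if nz: "imat_power A (Suc k) n m \<noteq> 0" for n m
  proof -
    from nz have "(\<Sum>l | A n l \<noteq> 0. A n l * imat_power A k l m) \<noteq> 0" by simp
    then obtain l where "A n l * imat_power A k l m \<noteq> 0" by (meson sum.not_neutral_contains_not_neutral)
    then have "A n l \<noteq> 0" "imat_power A k l m \<noteq> 0" by auto
    then show ?thesis using bandedD[OF assms, of n l] bandedD[OF Suc, of l m] by simp
  qed
  then show ?case by (simp add: banded_def)
qed

lemma U_imat_banded: "banded 0 K (U_imat d c K)"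
  unfolding banded_def
proof (intro allI impI)
  fix n m assume "U_imat d c K n m \<noteq> 0"
  then have "n \<le> m" "imat_power (Q_imat d c) K n m \<noteq> 0"
    by (auto simp: U_imat_def upper_half_def split: if_splits)
  then show "n \<le> m + 0 \<and> m \<le> n + K"
    using bandedD[OF imat_power_banded[OF banded_Q_imat]] by fastforce
qed

lemma U_imat_nonzero: "U_imat d c K n m \<noteq> 0 \<Longrightarrow> n \<le> m \<and> m \<le> n + K"
  using bandedD[OF U_imat_banded] by force

text \<open>The matrix -P^t is \<open>Q_imat\<close> of \<beta>, so one construction serves both
  families of deformations.\<close>

lemma V_imat_eq_U_imat: "V_imat = U_imat"
proof -
  have "(\<lambda>i k. - P_imat d c k i) = Q_imat d c" for d c
    by (auto simp: P_imat_def Q_imat_def fun_eq_iff)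
  then show ?thesis by (auto simp: V_imat_def U_imat_def fun_eq_iff)
qed

text \<open>Here \<open>W\<close> is upper triangular: it looks up along right solutions and down
  along left solutions. These are the directions of \<open>ladder\<close> and
  \<open>dual_ladder\<close> themselves, so no inverses occur.\<close>

lemma U_Psi_intertwine:
  assumes N: "1 \<le> d" "d \<le> N" "K + 1 \<le> N"
    and c: "\<And>n. c (-1) n \<noteq> 0" "\<And>n. d \<le> n \<Longrightarrow> c (int d) n \<noteq> 0"
    and L': "banded d 1 L'"
    and comm: "\<And>n m M. min n m + B \<le> M \<Longrightarrow>
      L' n m = (\<Sum>l<M. Q_imat d c n l * U_imat d c K l m - U_imat d c K n l * Q_imat d c l m)"
  shows "CD_mat d c N * U_Psi e d c b K N x - dual_U_Phi e d c b K N x * CD_mat d c N = cut_mat d N L'"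
proof (rule CD_mat_intertwine[where t = 0 and s = K and W = "U_imat d c K" and x = x and b = B])
  have P: "mat_prod (d + 1) (map (\<lambda>k. ladder d c k x) ks) \<in> carrier_mat (d + 1) (d + 1)"
      "mat_prod (d + 1) (map (\<lambda>k. dual_ladder d c k x) ks) \<in> carrier_mat (d + 1) (d + 1)" for ks
    by (rule mat_prod_carrier; auto)+
  {
    fix \<psi> M assume M: "N + d + K + 0 < M"
      and row: "\<And>n. N \<le> n + 0 \<Longrightarrow> n < N + K \<Longrightarrow> row_sol d c x M \<psi> n"
    have "U_Psi e d c b K N x *\<^sub>v slice \<psi> (N - d) d = Matrix.vec (d + 1)
        (\<lambda>i. \<Sum>j\<in>{0..K}. idiag (U_imat d c K) j (N - d + i) * \<psi> (N - d + j + i))"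
      unfolding U_Psi_def
      by (rule fold_rows[OF P(1) ladder_prod_slice[where M = M]]) (use N M c row in auto)
    also have "\<dots> = slice (\<lambda>n. \<Sum>m<M. U_imat d c K n m * \<psi> m) (N - d) d"
    proof (rule eq_vecI, goal_cases)
      case (1 i)
      have "(\<Sum>m<M. U_imat d c K (N - d + i) m * \<psi> m)
          = (\<Sum>j\<le>K. U_imat d c K (N - d + i) (N - d + i + j) * \<psi> (N - d + i + j))"
        by (rule sum_slice) (use 1 N M in \<open>auto dest!: U_imat_nonzero\<close>)
      then show ?case using 1 by (simp add: idiag_def algebra_simps atMost_atLeast0)
    qed simp
    finally show "U_Psi e d c b K N x *\<^sub>v slice \<psi> (N - d) d
      = slice (\<lambda>n. \<Sum>m<M. U_imat d c K n m * \<psi> m) (N - d) d" .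
  next
    fix \<phi> M assume M: "N + d + K + 0 < M"
      and col: "\<And>n. N \<le> n + K \<Longrightarrow> n < N + 0 \<Longrightarrow> col_sol d c x M \<phi> n"
    have "transpose_mat (dual_U_Phi e d c b K N x) *\<^sub>v slice \<phi> (N - 1) d = Matrix.vec (d + 1)
        (\<lambda>i. \<Sum>j\<in>{0..K}. idiag (U_imat d c K) j (N - 1 - j + i) * \<phi> (N - 1 - j + i))"
      unfolding dual_U_Phi_def
      by (rule fold_cols[OF P(2) dual_ladder_prod_slice[where M = M]]) (use N M c col in auto)
    also have "\<dots> = slice (\<lambda>m. \<Sum>n<M. \<phi> n * U_imat d c K n m) (N - 1) d"
    proof (rule eq_vecI, goal_cases)
      case (1 i)
      have "(\<Sum>n<M. \<phi> n * U_imat d c K n (N - 1 + i))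
          = (\<Sum>j\<le>K. \<phi> (N - 1 + i - j) * U_imat d c K (N - 1 + i - j) (N - 1 + i))"
        by (rule sum_slice_rev) (use 1 N M in \<open>auto dest!: U_imat_nonzero\<close>)
      also have "\<dots> = (\<Sum>j\<in>{0..K}. idiag (U_imat d c K) j (N - 1 - j + i) * \<phi> (N - 1 - j + i))"
        unfolding atMost_atLeast0 by (intro sum.cong refl) (use N in \<open>auto simp: idiag_def\<close>)
      finally show ?case using 1 by simp
    qed simp
    finally show "transpose_mat (dual_U_Phi e d c b K N x) *\<^sub>v slice \<phi> (N - 1) d
      = slice (\<lambda>m. \<Sum>n<M. \<phi> n * U_imat d c K n m) (N - 1) d" .
  }
qed (use N c comm L' in \<open>auto simp: U_imat_banded U_Psi_def dual_U_Phi_def\<close>)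

text \<open>Now \<open>W\<close> is lower triangular, both directions are reversed, and inverse
  ladders appear on both sides. The bound \<open>d + J \<le> N\<close> keeps the indices of the
  inverted ladders at or above \<open>d\<close>, where the top coefficient is nonzero.\<close>

lemma V_Psi_intertwine:
  assumes N: "1 \<le> d" "d + J \<le> N"
    and c: "\<And>n. c (-1) n \<noteq> 0" "\<And>n. d \<le> n \<Longrightarrow> c (int d) n \<noteq> 0"
    and L': "banded d 1 L'"
    and comm: "\<And>n m M. min n m + B \<le> M \<Longrightarrow>
      L' n m = (\<Sum>l<M. Q_imat d c n l * U_imat e b J m l - U_imat e b J l n * Q_imat d c l m)"
  shows "CD_mat d c N * V_Psi e d c b J N x - dual_V_Phi e d c b J N x * CD_mat d c N = cut_mat d N L'"
proof (rule CD_mat_intertwine[where t = J and s = 0 and W = "\<lambda>n m. U_imat e b J m n" and x = x and b = B])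
  have "ladder_inv d c k x \<in> carrier_mat (d + 1) (d + 1)" if "d \<le> k" for k
    by (rule ladder_inv(1)) (use that N c in auto)
  then have P1: "mat_prod (d + 1) (map (\<lambda>k. ladder_inv d c k x) [N - j..<N]) \<in> carrier_mat (d + 1) (d + 1)"
    if "j \<in> {0..J}" for j by (intro mat_prod_carrier) (use that N in auto)
  have "dual_ladder_inv d c k x \<in> carrier_mat (d + 1) (d + 1)" for k
    by (rule dual_ladder_inv(1)) (use N c in auto)
  then have P2: "mat_prod (d + 1) (map (\<lambda>k. dual_ladder_inv d c k x) ks) \<in> carrier_mat (d + 1) (d + 1)" for ks
    by (intro mat_prod_carrier) auto
  {
    fix \<psi> M assume M: "N + d + 0 + J < M"
      and row: "\<And>n. N \<le> n + J \<Longrightarrow> n < N + 0 \<Longrightarrow> row_sol d c x M \<psi> n"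
    have "V_Psi e d c b J N x *\<^sub>v slice \<psi> (N - d) d = Matrix.vec (d + 1)
        (\<lambda>i. \<Sum>j\<in>{0..J}. idiag (U_imat e b J) j (N - d - j + i) * \<psi> (N - d - j + i))"
      unfolding V_Psi_def V_imat_eq_U_imat
      by (rule fold_rows[OF P1 ladder_inv_prod_slice[where M = M]]) (use N M c row in auto)
    also have "\<dots> = slice (\<lambda>n. \<Sum>m<M. U_imat e b J m n * \<psi> m) (N - d) d"
    proof (rule eq_vecI, goal_cases)
      case (1 i)
      have "(\<Sum>m<M. U_imat e b J m (N - d + i) * \<psi> m)
          = (\<Sum>j\<le>J. U_imat e b J (N - d + i - j) (N - d + i) * \<psi> (N - d + i - j))"
        by (rule sum_slice_rev) (use 1 N M in \<open>auto dest!: U_imat_nonzero\<close>)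
      also have "\<dots> = (\<Sum>j\<in>{0..J}. idiag (U_imat e b J) j (N - d - j + i) * \<psi> (N - d - j + i))"
        unfolding atMost_atLeast0 by (intro sum.cong refl) (use N in \<open>auto simp: idiag_def\<close>)
      finally show ?case using 1 by simp
    qed simp
    finally show "V_Psi e d c b J N x *\<^sub>v slice \<psi> (N - d) d
      = slice (\<lambda>n. \<Sum>m<M. U_imat e b J m n * \<psi> m) (N - d) d" .
  next
    fix \<phi> M assume M: "N + d + 0 + J < M"
      and col: "\<And>n. N \<le> n + 0 \<Longrightarrow> n < N + J \<Longrightarrow> col_sol d c x M \<phi> n"
    have "transpose_mat (dual_V_Phi e d c b J N x) *\<^sub>v slice \<phi> (N - 1) d = Matrix.vec (d + 1)
        (\<lambda>i. \<Sum>j\<in>{0..J}. idiag (U_imat e b J) j (N - 1 + i) * \<phi> (N - 1 + j + i))"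
      unfolding dual_V_Phi_def V_imat_eq_U_imat
      by (rule fold_cols[OF P2 dual_ladder_inv_prod_slice[where M = M]]) (use N M c col in auto)
    also have "\<dots> = slice (\<lambda>m. \<Sum>n<M. \<phi> n * U_imat e b J m n) (N - 1) d"
    proof (rule eq_vecI, goal_cases)
      case (1 i)
      have "(\<Sum>n<M. \<phi> n * U_imat e b J (N - 1 + i) n)
          = (\<Sum>j\<le>J. \<phi> (N - 1 + i + j) * U_imat e b J (N - 1 + i) (N - 1 + i + j))"
        by (rule sum_slice) (use 1 N M in \<open>auto dest!: U_imat_nonzero\<close>)
      then show ?case using 1 by (simp add: idiag_def algebra_simps atMost_atLeast0)
    qed simp
    finally show "transpose_mat (dual_V_Phi e d c b J N x) *\<^sub>v slice \<phi> (N - 1) d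
      = slice (\<lambda>m. \<Sum>n<M. \<phi> n * U_imat e b J m n) (N - 1) d" .
  }
  show "banded J 0 (\<lambda>n m. U_imat e b J m n)" using U_imat_banded[of J e b] by (auto simp: banded_def)
qed (use N c comm L' in \<open>auto simp: V_Psi_def dual_V_Phi_def\<close>)

lemma eq_mat_if_diff_zero:
  fixes A B :: "complex mat"
  assumes "A \<in> carrier_mat n k" "B \<in> carrier_mat n k" "A - B = 0\<^sub>m n k"
  shows "A = B"
proof (rule eq_matI)
  fix i j assume "i < dim_row B" "j < dim_col B"
  then have ij: "i < dim_row B" "j < dim_col B" "i < n" "j < k" using assms(2) by auto
  have "A $$ (i, j) - B $$ (i, j) = (A - B) $$ (i, j)" using ij(1,2) by (rule index_minus_mat(1)[symmetric])
  also have "\<dots> = 0" unfolding assms(3) using ij(3,4) by simp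
  finally show "A $$ (i, j) = B $$ (i, j)" by simp
qed (use assms in auto)

lemma sum_atMost_head: "(\<Sum>j\<le>e. f j) = f 0 + (\<Sum>j\<in>{1..e}. f j :: complex)" for e :: nat
  by (simp add: atMost_atLeast0 sum.atLeast_Suc_atMost)

text \<open>For \<open>b\<close> equal to \<beta>, \<open>W\<close> is -P. Its one subdiagonal
  produces the term with a single inverse ladder, its \<open>e\<close> superdiagonals the products
  of ladders. The cut discards the diagonal of the commutator, so \<open>comm\<close> is needed only
  for \<open>n \<noteq> m\<close> and the target is the zero matrix.\<close>

lemma D1_intertwine:
  assumes N: "1 \<le> d" "d + 1 \<le> N" "e + 1 \<le> N"
    and c: "\<And>n. c (-1) n \<noteq> 0" "\<And>n. d \<le> n \<Longrightarrow> c (int d) n \<noteq> 0"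
    and comm: "\<And>n m M. n \<noteq> m \<Longrightarrow> min n m + B \<le> M \<Longrightarrow>
      (\<Sum>l<M. Q_imat d c n l * Q_imat e b m l - Q_imat e b l n * Q_imat d c l m) = 0"
  shows "CD_mat d c N * D1 e d c b N x = dual_D1 e d c b N x * CD_mat d c N"
proof -
  have inv: "ladder_inv d c (N - 1) x \<in> carrier_mat (d + 1) (d + 1)"
    by (rule ladder_inv(1)) (use N c in auto)
  have dinv: "dual_ladder_inv d c N x \<in> carrier_mat (d + 1) (d + 1)"
    by (rule dual_ladder_inv(1)) (use N c in auto)
  have P: "mat_prod (d + 1) (map (\<lambda>k. ladder d c k x) ks) \<in> carrier_mat (d + 1) (d + 1)"
      "mat_prod (d + 1) (map (\<lambda>k. dual_ladder d c k x) ks) \<in> carrier_mat (d + 1) (d + 1)" for ks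
    by (rule mat_prod_carrier; auto)+
  let ?F1 = "window (b (-1)) (N - 1 - d) d * ladder_inv d c (N - 1) x"
  let ?F2 = "window (b 0) (N - d) d"
  let ?F3 = "mat_sum (d + 1) (\<lambda>j. window (b (int j)) (N + j - d) d
         * mat_prod (d + 1) (map (\<lambda>k. ladder d c k x) (rev [N..<N+j]))) {1..e}"
  let ?G1 = "dual_ladder_inv d c N x * window (b (-1)) (N - 1) d"
  let ?G2 = "window (b 0) (N - 1) d"
  let ?G3 = "mat_sum (d + 1) (\<lambda>j.
         mat_prod (d + 1) (map (\<lambda>k. dual_ladder d c k x) (rev [N-j..<N]))
         * window (b (int j)) (N - 1) d) {1..e}"
  have F1: "?F1 \<in> carrier_mat (d + 1) (d + 1)" by (rule mult_carrier_mat[OF window_carrier inv])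
  have G1: "?G1 \<in> carrier_mat (d + 1) (d + 1)" by (rule mult_carrier_mat[OF dinv window_carrier])
  have F12: "?F1 + ?F2 \<in> carrier_mat (d + 1) (d + 1)" using F1 window_carrier by auto
  have G12: "?G1 + ?G2 \<in> carrier_mat (d + 1) (d + 1)" using G1 window_carrier by auto
  have "CD_mat d c N * D1 e d c b N x - dual_D1 e d c b N x * CD_mat d c N = cut_mat d N (\<lambda>_ _. 0)"
  proof (rule CD_mat_intertwine[where t = 1 and s = e and W = "\<lambda>n m. Q_imat e b m n" and x = x and b = B])
    show "D1 e d c b N x \<in> carrier_mat (d + 1) (d + 1)"
      unfolding D1_def by (rule add_carrier_mat) (rule mat_sum_carrier)
    show "dual_D1 e d c b N x \<in> carrier_mat (d + 1) (d + 1)"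
      unfolding dual_D1_def by (rule add_carrier_mat) (rule mat_sum_carrier)
    show "banded 1 e (\<lambda>n m. Q_imat e b m n)" using banded_Q_imat[of e b] by (auto simp: banded_def)
    show "0 = (\<Sum>l<M. Q_imat d c n l * Q_imat e b m l - Q_imat e b l n * Q_imat d c l m)"
      if "n \<noteq> m" "min n m + B \<le> M" for n m M using comm[OF that] by simp
  next
    fix \<psi> M assume M: "N + d + e + 1 < M"
      and row: "\<And>n. N \<le> n + 1 \<Longrightarrow> n < N + e \<Longrightarrow> row_sol d c x M \<psi> n"
    have r1: "row_sol d c x M \<psi> (N - 1)" by (rule row) (use N in auto)
    have "ladder_inv d c (N - 1) x *\<^sub>v slice \<psi> (N - 1 + 1 - d) d = slice \<psi> (N - 1 - d) d"
      by (rule ladder_inv_slice[OF r1]) (use N M c in auto)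
    then have 1: "?F1 *\<^sub>v slice \<psi> (N - d) d = Matrix.vec (d + 1) (\<lambda>i. b (-1) (N - 1 - d + i) * \<psi> (N - 1 - d + i))"
      using mult_mat_vec_assoc[OF window_carrier inv slice_carrier] N by (simp add: window_slice)
    have 3: "?F3 *\<^sub>v slice \<psi> (N - d) d = Matrix.vec (d + 1)
        (\<lambda>i. \<Sum>j\<in>{1..e}. b (int j) (N + j - d + i) * \<psi> (N - d + j + i))"
      by (rule fold_rows[OF P(1) ladder_prod_slice[where M = M]]) (use N M c row in auto)
    have "D1 e d c b N x *\<^sub>v slice \<psi> (N - d) d
      = ?F1 *\<^sub>v slice \<psi> (N - d) d + ?F2 *\<^sub>v slice \<psi> (N - d) d + ?F3 *\<^sub>v slice \<psi> (N - d) d"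
      unfolding D1_def
      by (simp only: add_mult_distrib_mat_vec[OF F12 mat_sum_carrier slice_carrier]
          add_mult_distrib_mat_vec[OF F1 window_carrier slice_carrier])
    also have "\<dots> = slice (\<lambda>n. \<Sum>m<M. Q_imat e b m n * \<psi> m) (N - d) d"
      unfolding 1 3 window_slice
    proof (rule eq_vecI, goal_cases)
      case (1 i)
      let ?n = "N - d + i"
      have "(\<Sum>m<M. Q_imat e b m ?n * \<psi> m) = \<psi> (?n - 1) * b (-1) (?n - 1)
          + (\<Sum>j\<le>e. \<psi> (?n + j) * b (int j) (?n + j))"
        using Q_col_sum[of ?n e M \<psi> b] N M 1 by (simp add: mult.commute)
      also have "\<dots> = b (-1) (?n - 1) * \<psi> (?n - 1) + b 0 ?n * \<psi> ?n
          + (\<Sum>j\<in>{1..e}. b (int j) (?n + j) * \<psi> (?n + j))"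
        by (simp add: sum_atMost_head mult.commute)
      finally show ?case using 1 N by (simp add: algebra_simps)
    next
      case 2
      show ?case unfolding index_add_vec dim_slice dim_vec ..
    qed
    finally show "D1 e d c b N x *\<^sub>v slice \<psi> (N - d) d = slice (\<lambda>n. \<Sum>m<M. Q_imat e b m n * \<psi> m) (N - d) d" .
  next
    fix \<phi> M assume M: "N + d + e + 1 < M"
      and col: "\<And>n. N \<le> n + e \<Longrightarrow> n < N + 1 \<Longrightarrow> col_sol d c x M \<phi> n"
    have r1: "col_sol d c x M \<phi> N" by (rule col) (use N in auto)
    have "transpose_mat (dual_ladder_inv d c N x) *\<^sub>v slice \<phi> (N - 1) d = slice \<phi> N d"
      by (rule dual_ladder_inv_slice[OF r1]) (use N M c in auto)
    then have 1: "transpose_mat ?G1 *\<^sub>v slice \<phi> (N - 1) d = Matrix.vec (d + 1) (\<lambda>i. b (-1) (N - 1 + i) * \<phi> (N + i))"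
      using transpose_mult_mat_vec[OF dinv window_carrier slice_carrier]
      by (simp add: transpose_window window_slice)
    have 3: "transpose_mat ?G3 *\<^sub>v slice \<phi> (N - 1) d = Matrix.vec (d + 1)
        (\<lambda>i. \<Sum>j\<in>{1..e}. b (int j) (N - 1 + i) * \<phi> (N - 1 - j + i))"
      by (rule fold_cols[OF P(2) dual_ladder_prod_slice[where M = M]]) (use N M c col in auto)
    have T: "transpose_mat (dual_D1 e d c b N x) = transpose_mat ?G1 + transpose_mat ?G2 + transpose_mat ?G3"
      unfolding dual_D1_def
      by (simp only: transpose_add[OF G12 mat_sum_carrier] transpose_add[OF G1 window_carrier])
    have "transpose_mat (dual_D1 e d c b N x) *\<^sub>v slice \<phi> (N - 1) d = transpose_mat ?G1 *\<^sub>v slice \<phi> (N - 1) d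
        + transpose_mat ?G2 *\<^sub>v slice \<phi> (N - 1) d + transpose_mat ?G3 *\<^sub>v slice \<phi> (N - 1) d"
    proof -
      have t: "transpose_mat A \<in> carrier_mat (d + 1) (d + 1)" if "A \<in> carrier_mat (d + 1) (d + 1)" for A :: "complex mat"
        using that by simp
      show ?thesis unfolding T
        by (simp only: add_mult_distrib_mat_vec[OF add_carrier_mat[OF t[OF window_carrier]] t[OF mat_sum_carrier] slice_carrier]
            add_mult_distrib_mat_vec[OF t[OF G1] t[OF window_carrier] slice_carrier])
    qed
    also have "\<dots> = slice (\<lambda>m. \<Sum>n<M. \<phi> n * Q_imat e b m n) (N - 1) d"
      unfolding 1 3 transpose_window window_slice
    proof (rule eq_vecI, goal_cases)
      case (1 i)
      let ?n = "N - 1 + i"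
      have "(\<Sum>m<M. \<phi> m * Q_imat e b ?n m) = (\<Sum>j\<le>e. b (int j) ?n * \<phi> (?n - j)) + b (-1) ?n * \<phi> (?n + 1)"
        unfolding mult.commute[of "\<phi> _"] by (rule Q_row_sum) (use N M 1 in auto)
      also have "\<dots> = b (-1) ?n * \<phi> (?n + 1) + b 0 ?n * \<phi> ?n
          + (\<Sum>j\<in>{1..e}. b (int j) ?n * \<phi> (?n - j))"
        unfolding sum_atMost_head by simp
      also have "\<dots> = b (-1) ?n * \<phi> (?n + 1) + b 0 ?n * \<phi> ?n
          + (\<Sum>j\<in>{1..e}. b (int j) ?n * \<phi> (N - 1 - j + i))"
        by (intro arg_cong2[where f = "(+)"] sum.cong refl) (use N in auto)
      finally show ?case using 1 N by simp
    next
      case 2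
      show ?case unfolding index_add_vec dim_slice dim_vec ..
    qed
    finally show "transpose_mat (dual_D1 e d c b N x) *\<^sub>v slice \<phi> (N - 1) d = slice (\<lambda>m. \<Sum>n<M. \<phi> n * Q_imat e b m n) (N - 1) d" .
  qed (use N c in \<open>auto simp: banded_def\<close>)
  then have eq: "CD_mat d c N * D1 e d c b N x - dual_D1 e d c b N x * CD_mat d c N = 0\<^sub>m (d + 1) (d + 1)"
    by (auto simp: cut_mat_def)
  have C: "CD_mat d c N * D1 e d c b N x \<in> carrier_mat (d + 1) (d + 1)"
    "dual_D1 e d c b N x * CD_mat d c N \<in> carrier_mat (d + 1) (d + 1)"
    by (rule mult_carrier_mat[OF CD_mat_carrier] mult_carrier_mat[OF _ CD_mat_carrier],
        simp add: D1_def dual_D1_def)+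
  show ?thesis by (rule eq_mat_if_diff_zero[OF C eq])
qed

section \<open>Nondegeneracy of the Christoffel-Darboux matrix and similarity\<close>

lemma CD_mat_det:
  assumes N: "1 \<le> d" "d \<le> N"
    and c: "\<And>n. c (-1) n \<noteq> 0" "\<And>n. d \<le> n \<Longrightarrow> c (int d) n \<noteq> 0"
  shows "Determinant.det (CD_mat d c N) \<noteq> 0"
proof -
  have "v = 0\<^sub>v (d + 1)" if v: "v \<in> carrier_vec (d + 1)" and 0: "CD_mat d c N *\<^sub>v v = 0\<^sub>v (d + 1)" for v
  proof -
    have eq: "(\<Sum>l\<le>d. CD_mat d c N $$ (i, l) * vec_index v l) = 0" if "i \<le> d" for i
      using mult_vec_index[OF CD_mat_carrier v that, symmetric] 0 that by simp
    have "(\<Sum>l\<le>d. CD_mat d c N $$ (0, l) * vec_index v l) = (\<Sum>l\<le>d. if l = d then - c (-1) (N - 1) * vec_index v d else 0)"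
      by (intro sum.cong refl) (auto simp: CD_mat_def)
    then have top: "vec_index v d = 0" using eq[of 0] c(1) by simp
    \<comment> \<open>Back substitution from the last component down, with \<open>k\<close> the
      distance from \<open>d\<close>: row \<open>l + 1\<close> involves only components from
      \<open>l\<close> on, and component \<open>l\<close> with the nonzero coefficient
      \<open>c (int d) (N + l)\<close>.\<close>
    have "vec_index v (d - k) = 0" if "k \<le> d" for k
      using that
    proof (induction k rule: less_induct)
      case (less k)
      show ?case
      proof (cases "k = 0")
        case True then show ?thesis using top by simp
      next
        case False
        let ?l = "d - k"
        have "(\<Sum>l\<le>d. CD_mat d c N $$ (Suc ?l, l) * vec_index v l)
          = (\<Sum>l\<le>d. if l = ?l then c (int d) (N + ?l) * vec_index v ?l else 0)"
        proof (intro sum.cong refl)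
          fix l assume "l \<in> {..d}"
          then have "vec_index v l = 0" if "?l < l"
            using less.IH[of "d - l"] that less.prems by simp
          then show "CD_mat d c N $$ (Suc ?l, l) * vec_index v l
            = (if l = ?l then c (int d) (N + ?l) * vec_index v ?l else 0)"
            using \<open>l \<in> _\<close> less.prems False by (cases "l < ?l"; cases "l = ?l") (auto simp: CD_mat_def Let_def)
        qed
        then show ?thesis using eq[of "Suc ?l"] c(2)[of "N + ?l"] N False less.prems by simp
      qed
    qed
    from this[of "d - _"] have "vec_index v i = 0" if "i \<le> d" for i
      using that by (metis diff_diff_cancel diff_le_self)
    then show ?thesis using v by (intro eq_vecI) auto
  qed
  then show ?thesis using det_0_iff_vec_prod_zero_field[OF CD_mat_carrier] by blast
qed

lemma intertwined_similar:
  fixes C D G :: "complex mat"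
  assumes CDG: "C \<in> carrier_mat n n" "D \<in> carrier_mat n n" "G \<in> carrier_mat n n"
    and det: "Determinant.det C \<noteq> 0" and eq: "C * D = G * C"
  shows "similar_mat D G" "spectral_det n D z = spectral_det n G z"
proof -
  from det_non_zero_imp_unit[OF CDG(1) det, of "()"]
  obtain B where B: "B \<in> carrier_mat n n" "B * C = 1\<^sub>m n" "C * B = 1\<^sub>m n"
    unfolding Units_def ring_mat_def by auto
  have "D = B * C * D" using B CDG by simp
  also have "\<dots> = B * (C * D)" by (rule assoc_mult_mat) (use B CDG in auto)
  also have "\<dots> = B * (G * C)" by (simp only: eq)
  also have "\<dots> = B * G * C" by (rule assoc_mult_mat[symmetric]) (use B CDG in auto)
  finally have D: "D = B * G * C" .
  show sim: "similar_mat D G"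
    by (rule similar_matI[OF _ B(2,3) D]) (use B CDG in auto)
  have "C * (z \<cdot>\<^sub>m 1\<^sub>m n - D) = z \<cdot>\<^sub>m C - C * D"
    using CDG by (simp add: mult_minus_distrib_mat[of C n n _ n] mult_smult_distrib[of C n n _ n])
  also have "\<dots> = (z \<cdot>\<^sub>m 1\<^sub>m n - G) * C"
    using CDG by (simp add: eq minus_mult_distrib_mat[of _ n n _ C n] mult_smult_assoc_mat[of _ n n C n])
  finally have "Determinant.det C * Determinant.det (z \<cdot>\<^sub>m 1\<^sub>m n - D)
     = Determinant.det (z \<cdot>\<^sub>m 1\<^sub>m n - G) * Determinant.det C"
    using CDG by (metis det_mult minus_carrier_mat)
  then show "spectral_det n D z = spectral_det n G z"
    using det by (simp add: spectral_det_def)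
qed

section \<open>Biorthonormal polynomials under a flow of the pairing\<close>

text \<open>Vanishing of the coefficients from \<open>n\<close> on expresses degree below
  \<open>n\<close> in a form that also covers \<open>n = 0\<close>, where only the zero polynomial
  remains.\<close>

lemma poly_expansion:
  fixes f :: "nat \<Rightarrow> complex poly"
  assumes f: "\<And>k. k < n \<Longrightarrow> degree (f k) = k \<and> f k \<noteq> 0" and q: "\<And>i. n \<le> i \<Longrightarrow> coeff q i = 0"
  shows "\<exists>a. q = (\<Sum>k<n. Polynomial.smult (a k) (f k))"
  using assms
proof (induction n arbitrary: q)
  case 0
  then have "q = 0" by (intro poly_eqI) simp
  then show ?case by simp
next
  case (Suc n)
  have fn: "degree (f n) = n" "coeff (f n) n \<noteq> 0" using Suc.prems(1)[of n] leading_coeff_0_iff[of "f n"] by auto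
  let ?b = "coeff q n / coeff (f n) n"
  have "\<exists>a. q - Polynomial.smult ?b (f n) = (\<Sum>k<n. Polynomial.smult (a k) (f k))"
  proof (rule Suc.IH)
    fix i assume "n \<le> i"
    then show "coeff (q - Polynomial.smult ?b (f n)) i = 0"
      using fn Suc.prems(2)[of i] by (cases "i = n") (auto simp: coeff_eq_0)
  qed (use Suc.prems in auto)
  then obtain a where a: "q - Polynomial.smult ?b (f n) = (\<Sum>k<n. Polynomial.smult (a k) (f k))" by blast
  have "q = (\<Sum>k<Suc n. Polynomial.smult ((a(n := ?b)) k) (f k))"
    using a by (simp add: algebra_simps)
  then show ?case by blast
qed

locale bilinear_pairing =
  fixes pair :: "complex poly \<Rightarrow> complex poly \<Rightarrow> complex"
  assumes add_left: "pair (a + a') b = pair a b + pair a' b"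
    and smult_left: "pair (Polynomial.smult s a) b = s * pair a b"
    and add_right: "pair a (b + b') = pair a b + pair a b'"
    and smult_right: "pair a (Polynomial.smult s b) = s * pair a b"
begin

lemma zero_left [simp]: "pair 0 b = 0"
  using smult_left[of 0 0 b] by simp

lemma zero_right [simp]: "pair a 0 = 0"
  using smult_right[of a 0 0] by simp

lemma sum_left: "pair (\<Sum>k\<in>A. h k) b = (\<Sum>k\<in>A. pair (h k) b)"
  by (induction A rule: infinite_finite_induct) (auto simp: add_left)

lemma sum_right: "pair a (\<Sum>k\<in>A. h k) = (\<Sum>k\<in>A. pair a (h k))"
  by (induction A rule: infinite_finite_induct) (auto simp: add_right)

lemma minus_left: "pair (a - a') b = pair a b - pair a' b"
  using add_left[of "a - a'" a' b] by simp

lemma transposed: "bilinear_pairing (\<lambda>a b. pair b a)"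
  by unfold_locales (auto simp: add_left add_right smult_left smult_right)

lemma pair_coeffs:
  assumes "degree a \<le> n" "degree b \<le> m"
  shows "pair a b = (\<Sum>i\<le>n. \<Sum>j\<le>m. coeff a i * coeff b j * pair (monom 1 i) (monom 1 j))"
proof -
  have "pair a b = pair (\<Sum>i\<le>n. Polynomial.smult (coeff a i) (monom 1 i)) (\<Sum>j\<le>m. Polynomial.smult (coeff b j) (monom 1 j))"
    using poly_as_sum_of_monoms'[OF assms(1)] poly_as_sum_of_monoms'[OF assms(2)] by (simp add: smult_monom)
  also have "\<dots> = (\<Sum>i\<le>n. \<Sum>j\<le>m. coeff a i * coeff b j * pair (monom 1 i) (monom 1 j))"
    by (simp only: sum_left smult_left) (simp add: sum_right smult_right sum_distrib_left mult.assoc)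
  finally show ?thesis .
qed

end

definition mult_X :: "complex poly \<Rightarrow> complex poly" where "mult_X a = monom 1 1 * a"

lemma coeff_mult_X [simp]: "coeff (mult_X a) i = (if i = 0 then 0 else coeff a (i - 1))"
  by (cases i) (auto simp: mult_X_def coeff_monom_mult)

lemma degree_mult_X: "degree a \<le> n \<Longrightarrow> degree (mult_X a) \<le> n + 1"
  by (intro degree_le) (auto intro!: coeff_eq_0)

lemma mult_X_sum: "mult_X (\<Sum>k\<in>A. Polynomial.smult (s k) (h k)) = (\<Sum>k\<in>A. Polynomial.smult (s k) (mult_X (h k)))"
  by (simp add: mult_X_def sum_distrib_left)

locale biorthonormal = bilinear_pairing +
  fixes f g :: "nat \<Rightarrow> complex poly"
  assumes deg_f: "degree (f n) = n" "f n \<noteq> 0" and deg_g: "degree (g n) = n" "g n \<noteq> 0"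
    and orth: "pair (f n) (g m) = (if n = m then 1 else 0)"
begin

lemma transposed_biorthonormal: "biorthonormal (\<lambda>a b. pair b a) g f"
proof -
  interpret t: bilinear_pairing "\<lambda>a b. pair b a" by (rule transposed)
  show ?thesis by unfold_locales (auto simp: deg_f deg_g orth)
qed

lemma expand_left:
  assumes "\<And>i. n \<le> i \<Longrightarrow> coeff q i = 0"
  shows "q = (\<Sum>k<n. Polynomial.smult (pair q (g k)) (f k))"
proof -
  obtain a where a: "q = (\<Sum>k<n. Polynomial.smult (a k) (f k))"
    using poly_expansion[where f = f, OF _ assms] deg_f by blast
  have "pair q (g k) = a k" if "k < n" for k
    unfolding a sum_left using that by (simp add: smult_left orth if_distrib[of "(*) _"] cong: if_cong)
  with a show ?thesis by (metis (no_types, lifting) lessThan_iff sum.cong)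
qed

lemma expand_left_degree: "degree q < n \<Longrightarrow> q = (\<Sum>k<n. Polynomial.smult (pair q (g k)) (f k))"
  by (rule expand_left) (simp add: coeff_eq_0)

lemma orth_left:
  assumes "degree q < m" shows "pair q (g m) = 0"
proof -
  have "pair q (g m) = pair (\<Sum>k<m. Polynomial.smult (pair q (g k)) (f k)) (g m)"
    using expand_left_degree[OF assms] by simp
  also have "\<dots> = 0" unfolding sum_left by (simp add: smult_left orth)
  finally show ?thesis .
qed

text \<open>Subtracting the multiple of \<open>f n\<close> that cancels the top coefficient leaves a
  polynomial of degree below \<open>n\<close>, or zero, which \<open>g n\<close>
  annihilates.\<close>

lemma lead_left:
  assumes q: "degree q \<le> n"
  shows "pair q (g n) = coeff q n / coeff (f n) n"
proof -
  let ?s = "coeff q n / coeff (f n) n"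
  have nz: "coeff (f n) n \<noteq> 0" using deg_f[of n] leading_coeff_0_iff[of "f n"] by auto
  have "coeff (q - Polynomial.smult ?s (f n)) i = 0" if "n \<le> i" for i
    using that q deg_f[of n] nz by (cases "i = n") (auto simp: coeff_eq_0)
  from expand_left[OF this] have "pair (q - Polynomial.smult ?s (f n)) (g n)
     = pair (\<Sum>k<n. Polynomial.smult (pair (q - Polynomial.smult ?s (f n)) (g k)) (f k)) (g n)"
    by simp
  also have "\<dots> = 0" unfolding sum_left by (simp add: smult_left orth)
  finally show ?thesis by (simp add: minus_left smult_left orth)
qed

text \<open>Expanding \<open>mult_X (f n)\<close> in the basis \<open>f\<close> shows that
  \<open>A\<close> represents multiplication by the variable. Row \<open>n\<close> is supported on
  \<open>l < n + 2\<close>, which identifies this expansion with the sum over nonzero entries in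
  \<open>imat_power\<close>.\<close>

lemma pair_mult_X_power:
  assumes A: "\<And>n m. A n m = pair (mult_X (f n)) (g m)"
  shows "pair ((mult_X ^^ k) (f n)) (g m) = imat_power A k n m"
proof (induction k arbitrary: n)
  case 0 then show ?case by (simp add: orth)
next
  case (Suc k)
  have lin: "(mult_X ^^ k) (\<Sum>l\<in>S. Polynomial.smult (s l) (h l)) = (\<Sum>l\<in>S. Polynomial.smult (s l) ((mult_X ^^ k) (h l)))" for s h and S :: "nat set"
    by (induction k) (auto simp: mult_X_sum)
  have fin: "{l. A n l \<noteq> 0} \<subseteq> {..<n+2}"
  proof
    fix l assume "l \<in> {l. A n l \<noteq> 0}"
    moreover have "A n l = 0" if "n + 2 \<le> l"
      unfolding A by (rule orth_left) (use degree_mult_X[of "f n" n] deg_f that in auto)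
    ultimately show "l \<in> {..<n+2}" by (meson lessThan_iff mem_Collect_eq not_less)
  qed
  have "mult_X (f n) = (\<Sum>l<n+2. Polynomial.smult (A n l) (f l))"
    unfolding A by (rule expand_left_degree) (use degree_mult_X[of "f n" n] deg_f in auto)
  then have "(mult_X ^^ Suc k) (f n) = (\<Sum>l<n+2. Polynomial.smult (A n l) ((mult_X ^^ k) (f l)))"
    unfolding funpow_Suc_right comp_def by (simp only: lin)
  then have "pair ((mult_X ^^ Suc k) (f n)) (g m) = (\<Sum>l<n+2. A n l * imat_power A k l m)"
    by (simp only: sum_left smult_left Suc)
  also have "\<dots> = (\<Sum>l | A n l \<noteq> 0. A n l * imat_power A k l m)"
    by (rule sum.mono_neutral_right) (use fin in auto)
  finally show ?case by simp
qed

lemma degree_mult_X_power: "degree a \<le> n \<Longrightarrow> degree ((mult_X ^^ k) a) \<le> n + k"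
  by (induction k) (auto dest: degree_mult_X)

end

text \<open>\<open>D\<close> is the logarithmic derivative of the weight in the parameter, a
  polynomial in the variable of the first argument. A deformation in the other variable fits after
  exchanging the arguments of the pairing.\<close>

locale pairing_flow =
  fixes pair :: "complex \<Rightarrow> complex poly \<Rightarrow> complex poly \<Rightarrow> complex" and S :: "complex set" and w0 :: complex
    and D :: "complex poly"
  assumes S: "open S" "w0 \<in> S"
    and bilinear: "w \<in> S \<Longrightarrow> bilinear_pairing (pair w)"
    and pair_deriv: "((\<lambda>w. pair w a b) has_field_derivative pair w0 (D * a) b) (at w0)"

definition coeff_deriv :: "(complex \<Rightarrow> complex poly) \<Rightarrow> complex poly \<Rightarrow> complex \<Rightarrow> bool" where
  "coeff_deriv A A' w0 \<longleftrightarrow> (\<forall>i. ((\<lambda>w. coeff (A w) i) has_field_derivative coeff A' i) (at w0))"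

lemma coeff_deriv_mult_X:
  "coeff_deriv A A' w0 \<Longrightarrow> coeff_deriv (\<lambda>w. mult_X (A w)) (mult_X A') w0"
  unfolding coeff_deriv_def by auto

lemma coeff_deriv_exists:
  assumes "open S" "w0 \<in> S" "\<And>w. w \<in> S \<Longrightarrow> degree (A w) \<le> n"
    and "\<And>i. i \<le> n \<Longrightarrow> (\<lambda>w. coeff (A w) i) field_differentiable (at w0)"
  shows "\<exists>A'. coeff_deriv A A' w0 \<and> degree A' \<le> n"
proof -
  let ?A' = "\<Sum>i\<le>n. monom (deriv (\<lambda>w. coeff (A w) i) w0) i"
  have c: "coeff ?A' i = (if i \<le> n then deriv (\<lambda>w. coeff (A w) i) w0 else 0)" for i
    by (simp add: coeff_sum)
  have "((\<lambda>w. coeff (A w) i) has_field_derivative coeff ?A' i) (at w0)" for i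
  proof (cases "i \<le> n")
    case True
    then show ?thesis using assms(4)[OF True] c by (simp add: DERIV_deriv_iff_field_differentiable)
  next
    case False
    have "((\<lambda>w. 0) has_field_derivative 0) (at w0)" by simp
    then have "((\<lambda>w. coeff (A w) i) has_field_derivative 0) (at w0)"
      by (rule has_field_derivative_transform_within_open[OF _ assms(1,2)])
        (use False assms(3) in \<open>fastforce intro: coeff_eq_0[symmetric]\<close>)
    then show ?thesis using False c by simp
  qed
  moreover have "degree ?A' \<le> n" by (intro degree_le) (use c in auto)
  ultimately show ?thesis unfolding coeff_deriv_def by blast
qed

context pairing_flow begin

text \<open>Degree bounds that are uniform on \<open>S\<close> turn the pairing into a fixed finite
  double sum over monomials, to which the product rule applies. The third term is the derivative of
  the pairing itself.\<close>

lemma pair_has_deriv: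
  assumes A: "coeff_deriv A A' w0" "\<And>w. w \<in> S \<Longrightarrow> degree (A w) \<le> n" "degree A' \<le> n"
    and B: "coeff_deriv B B' w0" "\<And>w. w \<in> S \<Longrightarrow> degree (B w) \<le> m" "degree B' \<le> m"
  shows "((\<lambda>w. pair w (A w) (B w)) has_field_derivative
     pair w0 A' (B w0) + pair w0 (A w0) B' + pair w0 (D * A w0) (B w0)) (at w0)"
proof -
  interpret w0: bilinear_pairing "pair w0" by (rule bilinear[OF S(2)])
  have A1: "((\<lambda>w. coeff (A w) i) has_field_derivative coeff A' i) (at w0)"
    and B1: "((\<lambda>w. coeff (B w) i) has_field_derivative coeff B' i) (at w0)" for i
    using A(1) B(1) by (auto simp: coeff_deriv_def)
  let ?M = "\<lambda>i j w. pair w (monom 1 i) (monom 1 j)"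
  have "((\<lambda>w. \<Sum>i\<le>n. \<Sum>j\<le>m. coeff (A w) i * coeff (B w) j * ?M i j w) has_field_derivative
     (\<Sum>i\<le>n. \<Sum>j\<le>m. (coeff A' i * coeff (B w0) j + coeff B' j * coeff (A w0) i) * ?M i j w0
       + pair w0 (D * monom 1 i) (monom 1 j) * (coeff (A w0) i * coeff (B w0) j))) (at w0)"
    by (intro DERIV_sum DERIV_mult A1 B1 pair_deriv)
  moreover have "(\<Sum>i\<le>n. \<Sum>j\<le>m. (coeff A' i * coeff (B w0) j + coeff B' j * coeff (A w0) i) * ?M i j w0
       + pair w0 (D * monom 1 i) (monom 1 j) * (coeff (A w0) i * coeff (B w0) j))
     = pair w0 A' (B w0) + pair w0 (A w0) B' + pair w0 (D * A w0) (B w0)"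
  proof -
    have "D * A w0 = (\<Sum>i\<le>n. Polynomial.smult (coeff (A w0) i) (D * monom 1 i))"
      using arg_cong[OF poly_as_sum_of_monoms'[OF A(2)[OF S(2)]], of "\<lambda>p. D * p"]
      by (simp add: sum_distrib_left smult_monom flip: mult_smult_right)
    moreover have Bw: "B w0 = (\<Sum>j\<le>m. Polynomial.smult (coeff (B w0) j) (monom 1 j))"
      using poly_as_sum_of_monoms'[OF B(2)[OF S(2)]] by (simp add: smult_monom)
    have "pair w0 a (B w0) = (\<Sum>j\<le>m. coeff (B w0) j * pair w0 a (monom 1 j))" for a
      by (subst Bw) (simp only: w0.sum_right w0.smult_right)
    ultimately have "pair w0 (D * A w0) (B w0) =
       (\<Sum>i\<le>n. \<Sum>j\<le>m. pair w0 (D * monom 1 i) (monom 1 j) * (coeff (A w0) i * coeff (B w0) j))"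
      by (simp add: w0.sum_left w0.smult_left sum_distrib_left mult_ac) (rule sum.swap)
    then show ?thesis
      unfolding w0.pair_coeffs[OF A(3) B(2)[OF S(2)]] w0.pair_coeffs[OF A(2)[OF S(2)] B(3)]
      by (simp add: sum.distrib algebra_simps)
  qed
  ultimately have "((\<lambda>w. \<Sum>i\<le>n. \<Sum>j\<le>m. coeff (A w) i * coeff (B w) j * ?M i j w) has_field_derivative
     pair w0 A' (B w0) + pair w0 (A w0) B' + pair w0 (D * A w0) (B w0)) (at w0)" by simp
  then show ?thesis
    by (rule has_field_derivative_transform_within_open[OF _ S])
      (use bilinear_pairing.pair_coeffs[OF bilinear A(2) B(2)] in simp)
qed

lemma pair_differentiable:
  assumes "\<And>w. w \<in> S \<Longrightarrow> degree (A w) \<le> n" "\<And>i. (\<lambda>w. coeff (A w) i) field_differentiable (at w0)"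
    "\<And>w. w \<in> S \<Longrightarrow> degree (B w) \<le> m" "\<And>i. (\<lambda>w. coeff (B w) i) field_differentiable (at w0)"
  shows "(\<lambda>w. pair w (A w) (B w)) field_differentiable (at w0)"
proof -
  obtain A' where "coeff_deriv A A' w0" "degree A' \<le> n" using coeff_deriv_exists[OF S assms(1,2)] by blast
  moreover obtain B' where "coeff_deriv B B' w0" "degree B' \<le> m" using coeff_deriv_exists[OF S assms(3,4)] by blast
  ultimately show ?thesis using pair_has_deriv[of A A' n B B' m] assms field_differentiable_def by blast
qed

end

text \<open>By the difference of squares, the difference quotient of \<open>r\<close> is that of
  \<open>h\<close> divided by \<open>r w + r w0\<close>, which is nonzero near \<open>w0\<close> by
  continuity. Continuity of the branch is thus enough.\<close>

lemma sqrt_branch_differentiable: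
  fixes r h :: "complex \<Rightarrow> complex"
  assumes "open S" "w0 \<in> S" and sq: "\<And>w. w \<in> S \<Longrightarrow> r w ^ 2 = h w"
    and r: "r w0 \<noteq> 0" "isCont r w0" and h: "h field_differentiable (at w0)"
  shows "r field_differentiable (at w0)"
proof -
  obtain h' where h': "(h has_field_derivative h') (at w0)" using h field_differentiable_def by blast
  have lim: "((\<lambda>w. (h w - h w0) / (w - w0) / (r w + r w0)) \<longlongrightarrow> h' / (r w0 + r w0)) (at w0)"
    using h' r(2) r(1) unfolding has_field_derivative_iff isCont_def
    by (intro tendsto_intros) auto
  have "((\<lambda>w. r w + r w0) \<longlongrightarrow> r w0 + r w0) (at w0)"
    using r(2) unfolding isCont_def by (intro tendsto_intros)
  then have "\<forall>\<^sub>F w in at w0. r w + r w0 \<noteq> 0"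
    by (rule tendsto_imp_eventually_ne) (use r in auto)
  moreover have "\<forall>\<^sub>F w in at w0. w \<in> S" using assms(1,2) by (rule eventually_at_topological[THEN iffD2, OF exI, of S, OF conjI, OF _ conjI]) auto
  ultimately have "\<forall>\<^sub>F w in at w0. (h w - h w0) / (w - w0) / (r w + r w0) = (r w - r w0) / (w - w0)"
  proof eventually_elim
    case (elim w)
    have "h w - h w0 = (r w - r w0) * (r w + r w0)"
      using sq[OF elim(2)] sq[OF assms(2)] by (simp add: power2_eq_square algebra_simps)
    then show ?case using elim by simp
  qed
  then have "((\<lambda>w. (r w - r w0) / (w - w0)) \<longlongrightarrow> h' / (r w0 + r w0)) (at w0)"
    by (rule Lim_transform_eventually[OF lim])
  then show ?thesis unfolding field_differentiable_def has_field_derivative_iff by blast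
qed

lemma mult_X_funpow: "(mult_X ^^ k) a = monom 1 k * a"
proof (induction k)
  case (Suc k)
  then show ?case by (simp add: mult_X_def mult.assoc[symmetric] mult_monom)
qed simp

text \<open>Only earlier polynomials and their pairings with a fixed monomial enter on the right.
  This recursion is what carries differentiability in the parameter from one degree to the
  next.\<close>

lemma gram_schmidt:
  assumes "bilinear_pairing pair"
    and P: "\<And>k. degree (P k) = k \<and> lead_coeff (P k) = 1" and Q: "\<And>k. degree (Q k) = k \<and> lead_coeff (Q k) = 1"
    and orth: "\<And>n m. pair (P n) (Q m) = (if n = m then h n else 0)" and h: "\<And>n. h n \<noteq> 0"
  shows "P n = monom 1 n - (\<Sum>k<n. Polynomial.smult (pair (monom 1 n) (Q k) / h k) (P k))"
proof -
  interpret bilinear_pairing pair by fact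
  have nz: "P k \<noteq> 0" "Q k \<noteq> 0" for k using P[of k] Q[of k] by auto
  interpret biorthonormal pair P "\<lambda>k. Polynomial.smult (1 / h k) (Q k)"
    by unfold_locales (use P Q nz orth h in \<open>auto simp: smult_right\<close>)
  have "coeff (monom 1 n - P n) i = 0" if "n \<le> i" for i
    using that P[of n] by (cases "i = n") (auto simp: coeff_eq_0)
  from expand_left[OF this]
  have "monom 1 n - P n = (\<Sum>k<n. Polynomial.smult (pair (monom 1 n) (Q k) / h k) (P k))"
    by (simp add: smult_right minus_left assms(4))
  then show ?thesis by (simp add: algebra_simps)
qed

lemma field_differentiable_cong_open:
  assumes "open S" "w0 \<in> S" "\<And>w. w \<in> S \<Longrightarrow> f w = g w" "f field_differentiable (at w0)"
  shows "g field_differentiable (at w0)"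
  using assms has_field_derivative_transform_within_open unfolding field_differentiable_def by blast

locale monic_flow = pairing_flow +
  fixes P Q :: "complex \<Rightarrow> nat \<Rightarrow> complex poly" and h r :: "complex \<Rightarrow> nat \<Rightarrow> complex"
  assumes monic: "w \<in> S \<Longrightarrow> degree (P w n) = n \<and> lead_coeff (P w n) = 1"
      "w \<in> S \<Longrightarrow> degree (Q w n) = n \<and> lead_coeff (Q w n) = 1"
    and orth: "w \<in> S \<Longrightarrow> pair w (P w n) (Q w m) = (if n = m then h w n else 0)"
    and h: "w \<in> S \<Longrightarrow> h w n \<noteq> 0"
    and r: "w \<in> S \<Longrightarrow> r w n ^ 2 = h w n" "isCont (\<lambda>w. r w n) w0"
begin

definition f where "f w n = Polynomial.smult (1 / r w n) (P w n)"

definition g where "g w n = Polynomial.smult (1 / r w n) (Q w n)"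

lemma coeff_PQ: "w \<in> S \<Longrightarrow> coeff (P w n) n = 1" "w \<in> S \<Longrightarrow> coeff (Q w n) n = 1"
  using monic by metis+

lemma r_nonzero: "w \<in> S \<Longrightarrow> r w n \<noteq> 0"
  using r(1)[of w n] h[of w n] by auto

lemma fg_biorthonormal:
  assumes "w \<in> S" shows "biorthonormal (pair w) (f w) (g w)"
proof -
  interpret bilinear_pairing "pair w" by (rule bilinear[OF assms])
  have "P w n \<noteq> 0" "Q w n \<noteq> 0" for n using monic[OF assms, of n] by auto
  then show ?thesis
    by unfold_locales (use monic[OF assms] orth[OF assms] r_nonzero[OF assms] r(1)[OF assms] h[OF assms] in
      \<open>auto simp: f_def g_def smult_left smult_right power2_eq_square\<close>)
qed

text \<open>Both families must be treated in one induction: the coefficients of \<open>P w n\<close>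
  involve \<open>Q w k\<close> and \<open>h w k\<close> for \<open>k < n\<close>, and conversely,
  while \<open>h w k\<close> is itself the pairing of \<open>P w k\<close> with
  \<open>Q w k\<close>.\<close>

lemma PQ_differentiable_aux:
  "\<forall>i. (\<lambda>w. coeff (P w n) i) field_differentiable (at w0) \<and> (\<lambda>w. coeff (Q w n) i) field_differentiable (at w0)"
proof (induction n rule: less_induct)
  case (less n)
  have hd: "(\<lambda>w. h w k) field_differentiable (at w0)" if "k < n" for k
    by (rule field_differentiable_cong_open[OF S, of "\<lambda>w. pair w (P w k) (Q w k)"])
      (use less[OF that] orth monic in \<open>auto intro!: pair_differentiable[where n = k and m = k]\<close>)
  have mono: "(\<lambda>w. coeff (monom 1 n) i) field_differentiable (at w0)" for i
    by (rule field_differentiable_const)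
  have d: "(\<lambda>w. pair w (monom 1 n) (Q w k)) field_differentiable (at w0)"
    "(\<lambda>w. pair w (P w k) (monom 1 n)) field_differentiable (at w0)" if "k < n" for k
    by (rule pair_differentiable[where n = "max n k" and m = "max n k"];
      use less[OF that] monic in \<open>auto simp: degree_monom_eq\<close>)+
  have P: "(\<lambda>w. coeff (P w n) i) field_differentiable (at w0)" for i
  proof (rule field_differentiable_cong_open[OF S])
    fix w assume w: "w \<in> S"
    show "coeff (monom 1 n) i - (\<Sum>k<n. pair w (monom 1 n) (Q w k) / h w k * coeff (P w k) i) = coeff (P w n) i"
      by (subst (2) gram_schmidt[where pair = "pair w" and P = "P w" and Q = "Q w" and h = "h w"])
        (use w bilinear monic coeff_PQ orth h in \<open>auto simp: coeff_sum\<close>)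
  next
    show "(\<lambda>w. coeff (monom 1 n) i - (\<Sum>k<n. pair w (monom 1 n) (Q w k) / h w k * coeff (P w k) i)) field_differentiable (at w0)"
      by (intro field_differentiable_diff mono field_differentiable_sum field_differentiable_mult
          field_differentiable_divide) (use d less hd h[OF S(2)] in auto)
  qed
  have Q: "(\<lambda>w. coeff (Q w n) i) field_differentiable (at w0)" for i
  proof (rule field_differentiable_cong_open[OF S])
    fix w assume w: "w \<in> S"
    show "coeff (monom 1 n) i - (\<Sum>k<n. pair w (P w k) (monom 1 n) / h w k * coeff (Q w k) i) = coeff (Q w n) i"
      by (subst (2) gram_schmidt[where pair = "\<lambda>a b. pair w b a" and P = "Q w" and Q = "P w" and h = "h w"])
        (use w bilinear_pairing.transposed[OF bilinear[OF w]] monic coeff_PQ orth h in \<open>auto simp: coeff_sum\<close>)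
  next
    show "(\<lambda>w. coeff (monom 1 n) i - (\<Sum>k<n. pair w (P w k) (monom 1 n) / h w k * coeff (Q w k) i)) field_differentiable (at w0)"
      by (intro field_differentiable_diff mono field_differentiable_sum field_differentiable_mult
          field_differentiable_divide) (use d less hd h[OF S(2)] in auto)
  qed
  show ?case using P Q by blast
qed

lemma PQ_differentiable:
  "(\<lambda>w. coeff (P w n) i) field_differentiable (at w0)" "(\<lambda>w. coeff (Q w n) i) field_differentiable (at w0)"
  using PQ_differentiable_aux by blast+

lemma fg_deriv_exists: "\<exists>f' g'. (\<forall>n. coeff_deriv (\<lambda>w. f w n) (f' n) w0 \<and> degree (f' n) \<le> n) \<and>
    (\<forall>n. coeff_deriv (\<lambda>w. g w n) (g' n) w0 \<and> degree (g' n) \<le> n)"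
proof -
  have "(\<lambda>w. h w n) field_differentiable (at w0)" for n
    by (rule field_differentiable_cong_open[OF S, of "\<lambda>w. pair w (P w n) (Q w n)"])
      (use PQ_differentiable orth monic in \<open>auto intro!: pair_differentiable[where n = n and m = n]\<close>)
  then have "(\<lambda>w. r w n) field_differentiable (at w0)" for n
    by (intro sqrt_branch_differentiable[OF S, of "\<lambda>w. r w n" "\<lambda>w. h w n"]) (use r r_nonzero[OF S(2)] in auto)
  then have "(\<lambda>w. 1 / r w n) field_differentiable (at w0)" for n
    by (intro field_differentiable_divide field_differentiable_const r_nonzero[OF S(2)])
  then have "(\<lambda>w. coeff (f w n) i) field_differentiable (at w0)" "(\<lambda>w. coeff (g w n) i) field_differentiable (at w0)" for n i
    unfolding f_def g_def coeff_smult
    using field_differentiable_mult PQ_differentiable by blast+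
  moreover have "degree (f w n) \<le> n" "degree (g w n) \<le> n" if "w \<in> S" for w n
    using biorthonormal.deg_f[OF fg_biorthonormal[OF that]] biorthonormal.deg_g[OF fg_biorthonormal[OF that]] by auto
  ultimately have "\<exists>f'. coeff_deriv (\<lambda>w. f w n) f' w0 \<and> degree f' \<le> n"
      "\<exists>g'. coeff_deriv (\<lambda>w. g w n) g' w0 \<and> degree g' \<le> n" for n
    by (intro coeff_deriv_exists[OF S]; blast)+
  then show ?thesis by metis
qed

text \<open>In the derivative of biorthonormality the contributions of \<open>f\<close> and \<open>g\<close> are lower and upper
  triangular. Their diagonals agree because \<open>f\<close> and \<open>g\<close> have equal leading coefficients, whence the
  halved diagonal in \<open>U\<close>.\<close>

lemma toda_flow:
  assumes D: "D = Polynomial.smult (- (1 / of_nat K)) (monom 1 K)"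
    and c: "\<And>n m. Q_imat d c n m = pair w0 (mult_X (f w0 n)) (g w0 m)"
    and M: "n + m + K + 2 \<le> M"
  defines "U \<equiv> U_imat d c K" and "Y \<equiv> \<lambda>n m. pair w0 (f w0 m) (mult_X (g w0 n))"
  shows "((\<lambda>w. pair w (mult_X (f w n)) (g w m)) has_field_derivative
      (\<Sum>l<M. U n l * Q_imat d c l m - Q_imat d c n l * U l m)) (at w0)"
    and "((\<lambda>w. pair w (f w m) (mult_X (g w n))) has_field_derivative
      (\<Sum>l<M. Y n l * U m l - U l n * Y l m)) (at w0)"
proof -
  obtain f' g' where f': "\<And>n. coeff_deriv (\<lambda>w. f w n) (f' n) w0" "\<And>n. degree (f' n) \<le> n"
    and g': "\<And>n. coeff_deriv (\<lambda>w. g w n) (g' n) w0" "\<And>n. degree (g' n) \<le> n"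
    using fg_deriv_exists by blast
  note bo = fg_biorthonormal
  interpret biorthonormal "pair w0" "f w0" "g w0" by (rule bo[OF S(2)])
  interpret t: biorthonormal "\<lambda>a b. pair w0 b a" "g w0" "f w0" by (rule transposed_biorthonormal)
  have degs: "degree (f w n) \<le> n" "degree (g w n) \<le> n" if "w \<in> S" for w n
    using biorthonormal.deg_f[OF bo[OF that]] biorthonormal.deg_g[OF bo[OF that]] by auto
  let ?Q = "Q_imat d c"
  define L where "L n a = pair w0 (f' n) (g w0 a)" for n a
  define R where "R n a = pair w0 (f w0 a) (g' n)" for n a
  define QK where "QK = imat_power ?Q K"
  have DX: "D * a = Polynomial.smult (- (1 / of_nat K)) ((mult_X ^^ K) a)" for a
    by (simp add: D mult_X_funpow)
  have QK: "pair w0 ((mult_X ^^ K) (f w0 n)) (g w0 m) = QK n m" for n m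
    unfolding QK_def by (rule pair_mult_X_power) (rule c)
  have rel: "L n m + R m n = 1 / of_nat K * QK n m" for n m
  proof -
    have "((\<lambda>w. pair w (f w n) (g w m)) has_field_derivative
       pair w0 (f' n) (g w0 m) + pair w0 (f w0 n) (g' m) + pair w0 (D * f w0 n) (g w0 m)) (at w0)"
      by (rule pair_has_deriv[where n = n and m = m]) (use f' g' degs in auto)
    moreover have "((\<lambda>w. pair w (f w n) (g w m)) has_field_derivative 0) (at w0)"
      by (rule has_field_derivative_transform_within_open[OF DERIV_const S, of "if n = m then 1 else 0"])
        (use biorthonormal.orth[OF bo] in auto)
    ultimately have "pair w0 (f' n) (g w0 m) + pair w0 (f w0 n) (g' m) + pair w0 (D * f w0 n) (g w0 m) = 0"
      by (rule DERIV_unique)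
    then show ?thesis by (simp only: L_def R_def DX smult_left QK) (simp add: algebra_simps eq_neg_iff_add_eq_0)
  qed
  have Lz: "L n a = 0" if "n < a" for n a
    unfolding L_def by (rule orth_left) (use f'(2)[of n] that in simp)
  have Rz: "R n a = 0" if "n < a" for n a
    unfolding R_def by (rule t.orth_left) (use g'(2)[of n] that in simp)
  have diag: "L n n = R n n" for n
  proof -
    have 1: "((\<lambda>w. coeff (f w n) n) has_field_derivative coeff (f' n) n) (at w0)"
      "((\<lambda>w. coeff (g w n) n) has_field_derivative coeff (g' n) n) (at w0)"
      using f'(1)[of n] g'(1)[of n] by (auto simp: coeff_deriv_def)
    have "((\<lambda>w. coeff (g w n) n) has_field_derivative coeff (f' n) n) (at w0)"
      by (rule has_field_derivative_transform_within_open[OF 1(1) S])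
        (use monic in \<open>metis (no_types, lifting) coeff_smult f_def g_def\<close>)
    with 1(2) have "coeff (f' n) n = coeff (g' n) n" by (rule DERIV_unique[OF _ , symmetric])
    then show ?thesis unfolding L_def R_def using lead_left[OF f'(2)[of n]] t.lead_left[OF g'(2)[of n]] coeff_PQ[OF S(2), of n] by (simp add: f_def g_def)
  qed
  \<comment> \<open>Above the diagonal \<open>L\<close> vanishes, so \<open>R\<close> carries all of
    \<open>QK\<close>; on the diagonal the two share it equally; below the diagonal of
    \<open>U\<close> the transposed \<open>R\<close> vanishes.\<close>
  have U: "U n m = - R m n" for n m
  proof (cases n m rule: linorder_cases)
    case less
    then show ?thesis using rel[of n m] Lz[of n m] by (simp add: U_def U_imat_def upper_half_def QK_def)
  next
    case equal
    then have "2 * R n n = 1 / of_nat K * QK n n" using rel[of n n] diag[of n] by simp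
    then have "R n n = 1 / of_nat K * QK n n / 2" by (metis nonzero_mult_div_cancel_left zero_neq_numeral)
    then show ?thesis using equal by (simp add: U_def U_imat_def upper_half_def QK_def)
  next
    case greater
    then show ?thesis using Rz[of m n] by (simp add: U_def U_imat_def upper_half_def)
  qed
  have exp_f': "f' n = (\<Sum>a<M. Polynomial.smult (L n a) (f w0 a))" if "n < M" for n
    unfolding L_def by (rule expand_left_degree) (use f'(2)[of n] that in simp)
  have exp_g': "g' n = (\<Sum>a<M. Polynomial.smult (R n a) (g w0 a))" if "n < M" for n
    unfolding R_def by (rule t.expand_left_degree) (use g'(2)[of n] that in simp)
  have exp_X: "mult_X (f w0 n) = (\<Sum>a<M. Polynomial.smult (?Q n a) (f w0 a))"
    unfolding c by (rule expand_left_degree) (use degree_mult_X[of "f w0 n" n] degs[OF S(2), of n] M in auto)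
  have exp_XK: "(mult_X ^^ K) (f w0 k) = (\<Sum>a<M. Polynomial.smult (QK k a) (f w0 a))" if "k + K < M" for k
    unfolding QK[symmetric]
    by (rule expand_left_degree) (use degree_mult_X_power[OF degs(1)[OF S(2)], of K k] that in auto)
  \<comment> \<open>Replacing \<open>L\<close> by \<open>U\<close> leaves a term in
    \<open>QK\<close>, which is cancelled by the contribution of the derivative of the weight.
    Together with \<open>RU\<close> this makes both derivatives commutators.\<close>
  have LU: "L n a = U n a + 1 / of_nat K * QK n a" for n a
    using rel[of n a] U[of n a] by (simp add: algebra_simps)
  have RU: "R m a = - U a m" for m a using U[of a m] by simp
  show "((\<lambda>w. pair w (mult_X (f w n)) (g w m)) has_field_derivative
      (\<Sum>l<M. U n l * Q_imat d c l m - Q_imat d c n l * U l m)) (at w0)"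
  proof -
    have "((\<lambda>w. pair w (mult_X (f w n)) (g w m)) has_field_derivative
       pair w0 (mult_X (f' n)) (g w0 m) + pair w0 (mult_X (f w0 n)) (g' m) + pair w0 (D * mult_X (f w0 n)) (g w0 m)) (at w0)"
      by (rule pair_has_deriv[where n = "n + 1" and m = m])
        (use f' g' degs in \<open>auto intro!: coeff_deriv_mult_X degree_mult_X[unfolded Suc_eq_plus1[symmetric]]\<close>)
    moreover have "pair w0 (mult_X (f' n)) (g w0 m) = (\<Sum>a<M. L n a * ?Q a m)"
      by (subst exp_f') (use M in \<open>auto simp: mult_X_sum sum_left smult_left c\<close>)
    moreover have "pair w0 (mult_X (f w0 n)) (g' m) = (\<Sum>a<M. ?Q n a * R m a)"
      by (subst exp_X) (auto simp: sum_left smult_left R_def)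
    moreover have "pair w0 (D * mult_X (f w0 n)) (g w0 m) = - (1 / of_nat K) * (\<Sum>a<M. QK n a * ?Q a m)"
    proof -
      \<comment> \<open>Commuting the factors puts \<open>QK\<close> to the left of \<open>Q\<close>
        in the resulting matrix product, the order required for the cancellation against
        \<open>L\<close> times \<open>Q\<close>.\<close>
      have "(mult_X ^^ K) (mult_X (f w0 n)) = mult_X ((mult_X ^^ K) (f w0 n))" by (simp add: funpow_swap1)
      also have "\<dots> = mult_X (\<Sum>a<M. Polynomial.smult (QK n a) (f w0 a))" by (subst exp_XK) (use M in auto)
      finally show ?thesis by (simp only: DX mult_X_sum sum_left smult_left c)
    qed
    moreover have "(\<Sum>a<M. L n a * ?Q a m) + (\<Sum>a<M. ?Q n a * R m a) + - (1 / of_nat K) * (\<Sum>a<M. QK n a * ?Q a m)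
      = (\<Sum>l<M. U n l * ?Q l m - ?Q n l * U l m)"
      unfolding sum_distrib_left sum.distrib[symmetric]
      by (intro sum.cong refl) (simp add: LU RU algebra_simps)
    ultimately show ?thesis by simp
  qed
  show "((\<lambda>w. pair w (f w m) (mult_X (g w n))) has_field_derivative
      (\<Sum>l<M. Y n l * U m l - U l n * Y l m)) (at w0)"
  proof -
    have "((\<lambda>w. pair w (f w m) (mult_X (g w n))) has_field_derivative
       pair w0 (f' m) (mult_X (g w0 n)) + pair w0 (f w0 m) (mult_X (g' n)) + pair w0 (D * f w0 m) (mult_X (g w0 n))) (at w0)"
      by (rule pair_has_deriv[where n = m and m = "n + 1"])
        (use f' g' degs in \<open>auto intro!: coeff_deriv_mult_X degree_mult_X[unfolded Suc_eq_plus1[symmetric]]\<close>)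
    moreover have "pair w0 (f' m) (mult_X (g w0 n)) = (\<Sum>a<M. L m a * Y n a)"
      by (subst exp_f') (use M in \<open>auto simp: sum_left smult_left Y_def\<close>)
    moreover have "pair w0 (f w0 m) (mult_X (g' n)) = (\<Sum>a<M. R n a * Y a m)"
      by (subst exp_g') (use M in \<open>auto simp: mult_X_sum sum_right smult_right Y_def\<close>)
    moreover have "pair w0 (D * f w0 m) (mult_X (g w0 n)) = - (1 / of_nat K) * (\<Sum>a<M. QK m a * Y n a)"
      unfolding DX smult_left by (subst exp_XK) (use M in \<open>auto simp: sum_left smult_left Y_def\<close>)
    moreover have "(\<Sum>a<M. L m a * Y n a) + (\<Sum>a<M. R n a * Y a m) + - (1 / of_nat K) * (\<Sum>a<M. QK m a * Y n a)
      = (\<Sum>l<M. Y n l * U m l - U l n * Y l m)"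
      unfolding sum_distrib_left sum.distrib[symmetric]
      by (intro sum.cong refl) (simp add: LU RU algebra_simps)
    ultimately show ?thesis by simp
  qed
qed

end

section \<open>Differentiation under the integral sign\<close>

text \<open>Convergence is available only for exponentials holomorphic in the parameter, not for
  \<open>exp (t * norm z)\<close>. Exponentials in the four directions 1, -1, i, -i dominate it; the
  factor 2 comes from bounding \<open>norm z\<close> by twice the larger of
  \<open>\<bar>Re z\<bar>\<close> and \<open>\<bar>Im z\<bar>\<close>.\<close>

lemma exp_norm_le_four_exps:
  fixes z :: complex
  assumes "0 \<le> t"
  shows "exp (t * norm z) \<le> norm (exp (of_real (2 * t) * z)) + norm (exp (- of_real (2 * t) * z))
    + norm (exp (\<i> * of_real (2 * t) * z)) + norm (exp (- \<i> * of_real (2 * t) * z))"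
    (is "_ \<le> ?R")
proof -
  have "norm z \<le> 2 * max \<bar>Re z\<bar> \<bar>Im z\<bar>" using cmod_le[of z] by linarith
  then have "t * norm z \<le> t * (2 * max \<bar>Re z\<bar> \<bar>Im z\<bar>)" by (rule mult_left_mono) fact
  then have "exp (t * norm z) \<le> exp (2 * t * max \<bar>Re z\<bar> \<bar>Im z\<bar>)" by (simp add: mult_ac)
  also have "\<dots> \<le> exp (2 * t * Re z) + exp (- (2 * t * Re z)) + exp (- (2 * t * Im z)) + exp (2 * t * Im z)"
  proof -
    consider "max \<bar>Re z\<bar> \<bar>Im z\<bar> = Re z" | "max \<bar>Re z\<bar> \<bar>Im z\<bar> = - Re z"
      | "max \<bar>Re z\<bar> \<bar>Im z\<bar> = - Im z" | "max \<bar>Re z\<bar> \<bar>Im z\<bar> = Im z"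
      by linarith
    then show ?thesis
      by cases (simp_all add: add_nonneg_nonneg add_increasing add_increasing2)
  qed
  also have "\<dots> = ?R" by (simp add: norm_exp_eq_Re)
  finally show ?thesis .
qed

text \<open>On a disc of radius \<open>e/4\<close> the remainder of the linear approximation is quadratically small,
  dominated by the integrands at the four parameter values \<open>w0 \<plusminus> e/2\<close>, \<open>w0 \<plusminus> \<i>e/2\<close>.\<close>

lemma has_field_derivative_exp_integral:
  fixes u \<xi> :: "'a \<Rightarrow> complex"
  assumes e: "e > 0"
    and int: "\<And>\<eta>. norm \<eta> < e \<Longrightarrow> integrable M (\<lambda>z. u z * exp (\<eta> * \<xi> z))"
    and int1: "integrable M (\<lambda>z. \<xi> z * u z)"
    and int2: "\<And>\<eta>. norm \<eta> < e \<Longrightarrow> integrable M (\<lambda>z. \<xi> z ^ 2 * u z * exp (\<eta> * \<xi> z))"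
  shows "((\<lambda>w. integral\<^sup>L M (\<lambda>z. u z * exp ((w - w0) * \<xi> z))) has_field_derivative
    integral\<^sup>L M (\<lambda>z. \<xi> z * u z)) (at w0)"
proof -
  define G where "G \<eta> = integral\<^sup>L M (\<lambda>z. u z * exp (\<eta> * \<xi> z))" for \<eta>
  define D where "D = integral\<^sup>L M (\<lambda>z. \<xi> z * u z)"
  define s where "s = e / 4"
  have s: "0 < s" "2 * s < e" using e by (auto simp: s_def)
  define B where "B z = norm (\<xi> z ^ 2 * u z * exp (of_real (2 * s) * \<xi> z))
      + norm (\<xi> z ^ 2 * u z * exp (- of_real (2 * s) * \<xi> z))
      + norm (\<xi> z ^ 2 * u z * exp (\<i> * of_real (2 * s) * \<xi> z))
      + norm (\<xi> z ^ 2 * u z * exp (- \<i> * of_real (2 * s) * \<xi> z))" for z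
  have B: "integrable M B" unfolding B_def
    by (intro Bochner_Integration.integrable_add integrable_norm int2) (use s in \<open>auto simp: norm_mult\<close>)
  have bound: "norm (G \<eta> - G 0 - \<eta> * D) \<le> norm \<eta> ^ 2 * integral\<^sup>L M B" if \<eta>: "norm \<eta> \<le> s" for \<eta>
  proof -
    have \<eta>e: "norm \<eta> < e" using \<eta> s by simp
    have i0: "integrable M u" using int[of 0] e by simp
    have "G \<eta> - G 0 - \<eta> * D = integral\<^sup>L M (\<lambda>z. u z * exp (\<eta> * \<xi> z) - u z - \<eta> * (\<xi> z * u z))"
      unfolding G_def D_def using int[OF \<eta>e] i0 int1
      by (simp add: Bochner_Integration.integral_diff)
    also have "norm \<dots> \<le> integral\<^sup>L M (\<lambda>z. norm (u z * exp (\<eta> * \<xi> z) - u z - \<eta> * (\<xi> z * u z)))"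
      by (rule integral_norm_bound)
    also have "\<dots> \<le> integral\<^sup>L M (\<lambda>z. norm \<eta> ^ 2 * B z)"
    proof (rule Bochner_Integration.integral_mono)
      show "integrable M (\<lambda>z. norm (u z * exp (\<eta> * \<xi> z) - u z - \<eta> * (\<xi> z * u z)))"
        by (intro integrable_norm Bochner_Integration.integrable_diff integrable_mult_right int \<eta>e i0 int1)
      show "integrable M (\<lambda>z. norm \<eta> ^ 2 * B z)" using B by simp
      fix z
      let ?y = "\<eta> * \<xi> z"
      have "u z * exp ?y - u z - \<eta> * (\<xi> z * u z) = u z * (exp ?y - (\<Sum>k\<le>1. ?y ^ k / fact k))"
        by (simp add: algebra_simps)
      then have "norm (u z * exp ?y - u z - \<eta> * (\<xi> z * u z)) = norm (u z) * norm (exp ?y - (\<Sum>k\<le>1. ?y ^ k / fact k))"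
        by (simp only: norm_mult)
      also have "\<dots> \<le> norm (u z) * (exp \<bar>Re ?y\<bar> * norm ?y ^ Suc 1 / fact 1)"
        by (rule mult_left_mono[OF Taylor_exp norm_ge_zero])
      also have "\<dots> = norm (u z) * (exp \<bar>Re ?y\<bar> * norm ?y ^ 2)"
        by (simp add: power2_eq_square)
      also have "\<dots> \<le> norm (u z) * (exp (s * norm (\<xi> z)) * norm ?y ^ 2)"
      proof -
        have "\<bar>Re ?y\<bar> \<le> norm ?y" by (rule abs_Re_le_cmod)
        also have "\<dots> \<le> s * norm (\<xi> z)" using \<eta> by (simp add: norm_mult mult_right_mono)
        finally have "exp \<bar>Re ?y\<bar> \<le> exp (s * norm (\<xi> z))" by simp
        then show ?thesis by (intro mult_left_mono[OF mult_right_mono]) simp_all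
      qed
      also have "\<dots> = norm \<eta> ^ 2 * (norm (\<xi> z ^ 2 * u z) * exp (s * norm (\<xi> z)))"
        by (simp add: norm_mult norm_power power_mult_distrib)
      also have "\<dots> \<le> norm \<eta> ^ 2 * B z"
      proof -
        have "norm (\<xi> z ^ 2 * u z) * exp (s * norm (\<xi> z)) \<le> B z"
          using mult_left_mono[OF exp_norm_le_four_exps[of s "\<xi> z"], of "norm (\<xi> z ^ 2 * u z)"] s
          unfolding B_def norm_mult[of "\<xi> z ^ 2 * u z"] by (simp only: distrib_left norm_ge_zero less_imp_le)
        then show ?thesis by (rule mult_left_mono) simp
      qed
      finally show "norm (u z * exp ?y - u z - \<eta> * (\<xi> z * u z)) \<le> norm \<eta> ^ 2 * B z" .
    qed
    finally show ?thesis by simp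
  qed
  have "((\<lambda>\<eta>. (G \<eta> - G 0) / \<eta>) \<longlongrightarrow> D) (at 0)"
  proof (rule Lim_null[THEN iffD2], rule Lim_null_comparison)
    show "\<forall>\<^sub>F \<eta> in at 0. norm ((G \<eta> - G 0) / \<eta> - D) \<le> norm \<eta> * integral\<^sup>L M B"
    proof -
      have "norm ((G \<eta> - G 0) / \<eta> - D) \<le> norm \<eta> * integral\<^sup>L M B" if "\<eta> \<noteq> 0" "dist \<eta> 0 \<le> s" for \<eta>
      proof -
        have "(G \<eta> - G 0) / \<eta> - D = (G \<eta> - G 0 - \<eta> * D) / \<eta>" using that by (simp add: field_simps)
        then have "norm ((G \<eta> - G 0) / \<eta> - D) = norm (G \<eta> - G 0 - \<eta> * D) / norm \<eta>" by (simp add: norm_divide)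
        also have "\<dots> \<le> norm \<eta> ^ 2 * integral\<^sup>L M B / norm \<eta>"
          by (intro divide_right_mono bound) (use that in auto)
        finally show ?thesis using that by (simp add: power2_eq_square)
      qed
      then show ?thesis unfolding eventually_at using s by (intro exI[of _ s]) auto
    qed
    show "((\<lambda>\<eta>. norm \<eta> * integral\<^sup>L M B) \<longlongrightarrow> 0) (at 0)"
      by (intro tendsto_mult_left_zero tendsto_norm_zero tendsto_ident_at)
  qed
  then have "(G has_field_derivative D) (at 0)" unfolding has_field_derivative_iff by simp
  then have "(G has_field_derivative D) (at (w0 - w0))" by simp
  moreover have "((\<lambda>w. w - w0) has_field_derivative 1) (at w0)"
    by (auto intro!: derivative_eq_intros)
  ultimately have "((\<lambda>w. G (w - w0)) has_field_derivative D * 1) (at w0)"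
    by (rule DERIV_chain2)
  then show ?thesis by (simp add: G_def D_def)
qed

lemma double_integral_linear:
  assumes "double_integrable \<Gamma>x \<Gamma>y F" "double_integrable \<Gamma>x \<Gamma>y H"
  shows "double_integral \<Gamma>x \<Gamma>y (\<lambda>x y. s * F x y + H x y) = s * double_integral \<Gamma>x \<Gamma>y F + double_integral \<Gamma>x \<Gamma>y H"
proof -
  let ?I = "\<lambda>g k F. integral\<^sup>L (lborel \<Otimes>\<^sub>M lborel) (pullback g k F)"
  have *: "a * b * ?I g k (\<lambda>x y. s * F x y + H x y) = s * (a * b * ?I g k F) + a * b * ?I g k H"
    if "(a, g) \<in> set \<Gamma>x" "(b, k) \<in> set \<Gamma>y" for a b g k
  proof -
    have i: "integrable (lborel \<Otimes>\<^sub>M lborel) (pullback g k F)" "integrable (lborel \<Otimes>\<^sub>M lborel) (pullback g k H)"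
      using assms that by (auto simp: double_integrable_def)
    have "pullback g k (\<lambda>x y. s * F x y + H x y) = (\<lambda>st. s * pullback g k F st + pullback g k H st)"
      by (auto simp: pullback_def fun_eq_iff algebra_simps)
    then have "?I g k (\<lambda>x y. s * F x y + H x y) = s * ?I g k F + ?I g k H" using i by simp
    then show ?thesis by (simp only:) (simp add: algebra_simps)
  qed
  have "double_integral \<Gamma>x \<Gamma>y (\<lambda>x y. s * F x y + H x y)
    = (\<Sum>(a, g)\<leftarrow>\<Gamma>x. \<Sum>(b, k)\<leftarrow>\<Gamma>y. s * (a * b * ?I g k F) + a * b * ?I g k H)"
    unfolding double_integral_def
    by (rule arg_cong[of _ _ sum_list], rule map_cong[OF refl], clarify,
        rule arg_cong[of _ _ sum_list], rule map_cong[OF refl], clarify, rule *)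
  also have "\<dots> = s * double_integral \<Gamma>x \<Gamma>y F + double_integral \<Gamma>x \<Gamma>y H"
    unfolding double_integral_def by (simp add: split_def sum_list_addf sum_list_const_mult)
  finally show ?thesis .
qed

lemma has_field_derivative_sum_list:
  assumes "\<And>x. x \<in> set xs \<Longrightarrow> (F x has_field_derivative F' x) (at w)"
  shows "((\<lambda>w. \<Sum>x\<leftarrow>xs. F x w) has_field_derivative (\<Sum>x\<leftarrow>xs. F' x)) (at w)"
  using assms by (induction xs) (auto intro!: DERIV_add)

lemma double_integral_has_derivative:
  assumes e: "e > 0"
    and int: "\<And>\<eta>. norm \<eta> < e \<Longrightarrow> double_integrable \<Gamma>x \<Gamma>y (\<lambda>x y. F x y * exp (\<eta> * \<xi> x y))"
    and int1: "double_integrable \<Gamma>x \<Gamma>y (\<lambda>x y. \<xi> x y * F x y)"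
    and int2: "\<And>\<eta>. norm \<eta> < e \<Longrightarrow> double_integrable \<Gamma>x \<Gamma>y (\<lambda>x y. \<xi> x y ^ 2 * F x y * exp (\<eta> * \<xi> x y))"
  shows "((\<lambda>w. double_integral \<Gamma>x \<Gamma>y (\<lambda>x y. F x y * exp ((w - w0) * \<xi> x y))) has_field_derivative
    double_integral \<Gamma>x \<Gamma>y (\<lambda>x y. \<xi> x y * F x y)) (at w0)"
  unfolding double_integral_def
proof (intro has_field_derivative_sum_list, clarify, intro has_field_derivative_sum_list, clarify, rule DERIV_cmult)
  fix a g b k assume gk: "(a, g) \<in> set \<Gamma>x" "(b, k) \<in> set \<Gamma>y"
  let ?\<xi> = "\<lambda>(s, t). \<xi> (g s) (k t)"
  have eq: "pullback g k (\<lambda>x y. F x y * exp (\<eta> * \<xi> x y)) = (\<lambda>z. pullback g k F z * exp (\<eta> * ?\<xi> z))"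
    "pullback g k (\<lambda>x y. \<xi> x y * F x y) = (\<lambda>z. ?\<xi> z * pullback g k F z)"
    "pullback g k (\<lambda>x y. \<xi> x y ^ 2 * F x y * exp (\<eta> * \<xi> x y)) = (\<lambda>z. ?\<xi> z ^ 2 * pullback g k F z * exp (\<eta> * ?\<xi> z))" for \<eta>
    by (auto simp: pullback_def fun_eq_iff)
  show "((\<lambda>w. integral\<^sup>L (lborel \<Otimes>\<^sub>M lborel) (pullback g k (\<lambda>x y. F x y * exp ((w - w0) * \<xi> x y)))) has_field_derivative
      integral\<^sup>L (lborel \<Otimes>\<^sub>M lborel) (pullback g k (\<lambda>x y. \<xi> x y * F x y))) (at w0)"
    unfolding eq
    by (rule has_field_derivative_exp_integral[OF e])
      (use int int1 int2 gk in \<open>force simp: double_integrable_def eq\<close>)+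
qed

section \<open>Parameter flows in the biorthogonal setting\<close>

lemma poly_mult_X [simp]: "poly (mult_X a) x = x * poly a x"
  by (simp add: mult_X_def poly_monom)

definition potential_deriv :: "nat \<Rightarrow> (nat \<Rightarrow> complex) \<Rightarrow> complex poly" where
  "potential_deriv d u = (\<Sum>K = 1..d+1. monom (u K) (K - 1))"

lemma potential_has_derivative: "(potential d u has_field_derivative poly (potential_deriv d u) x) (at x)"
proof -
  have "((\<lambda>x. \<Sum>K = 1..d+1. u K / of_nat K * x ^ K) has_field_derivative
      (\<Sum>K = 1..d+1. u K / of_nat K * (of_nat K * x ^ (K - 1)))) (at x)"
    by (intro DERIV_sum DERIV_cmult) (auto intro!: derivative_eq_intros)
  also have "(\<Sum>K = 1..d+1. u K / of_nat K * (of_nat K * x ^ (K - 1))) = poly (potential_deriv d u) x"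
    unfolding potential_deriv_def poly_sum poly_monom by (intro sum.cong refl) auto
  finally show ?thesis by (simp add: potential_def[abs_def])
qed

lemma potential_fun_upd:
  assumes "K \<in> {1..d+1}"
  shows "potential d (u(K := w)) x = potential d u x + (w - u K) * (x ^ K / of_nat K)"
proof -
  have "potential d (u(K := w)) x - potential d u x
      = (\<Sum>k = 1..d+1. if k = K then (w - u K) * (x ^ K / of_nat K) else 0)"
    unfolding potential_def sum_subtractf[symmetric] by (intro sum.cong refl) (auto simp: field_simps)
  then show ?thesis using assms by (simp add: algebra_simps)
qed

lemma coeff_potential_deriv: "coeff (potential_deriv d u) i = (if i \<le> d then u (Suc i) else 0)"
proof -
  have "coeff (potential_deriv d u) i = (\<Sum>K = 1..d+1. if K = Suc i then u (Suc i) else 0)"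
    unfolding potential_deriv_def coeff_sum by (intro sum.cong refl) auto
  then show ?thesis by auto
qed

abbreviation u_slice :: "param \<Rightarrow> nat \<Rightarrow> complex \<Rightarrow> param" where
  "u_slice p K w \<equiv> ((fst p)(K := w), snd p)"

abbreviation v_slice :: "param \<Rightarrow> nat \<Rightarrow> complex \<Rightarrow> param" where
  "v_slice p J w \<equiv> (fst p, (snd p)(J := w))"

lemma continuous_slice:
  "continuous_on A (\<lambda>w. u_slice p K w)" "continuous_on A (\<lambda>w. v_slice p K w)"
proof -
  have "continuous_on A (\<lambda>w. f(K := w))" for f :: "nat \<Rightarrow> complex"
  proof (rule continuous_on_coordinatewise_then_product)
    show "continuous_on A (\<lambda>w. (f(K := w)) i)" for i
      by (cases "i = K") (auto intro: continuous_on_id continuous_on_const)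
  qed
  then show "continuous_on A (\<lambda>w. u_slice p K w)" "continuous_on A (\<lambda>w. v_slice p K w)"
    by (intro continuous_on_Pair continuous_on_const; simp)+
qed

context biorthogonal_setting
begin

definition pairing :: "param \<Rightarrow> complex poly \<Rightarrow> complex poly \<Rightarrow> complex" where
  "pairing p a b = double_integral \<Gamma>x \<Gamma>y (\<lambda>x y. poly a x * poly b y * weight d1 d2 p x y)"

lemma pairing_bilinear:
  assumes p: "p \<in> \<Omega>" shows "bilinear_pairing (pairing p)"
proof -
  have l: "pairing p (Polynomial.smult s a + a') b = s * pairing p a b + pairing p a' b" for s a a' b
    using double_integral_linear[OF convergence[OF p, of a b] convergence[OF p, of a' b], of s]
    by (simp add: pairing_def algebra_simps)
  have r: "pairing p a (Polynomial.smult s b + b') = s * pairing p a b + pairing p a b'" for s a b b'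
    using double_integral_linear[OF convergence[OF p, of a b] convergence[OF p, of a b'], of s]
    by (simp add: pairing_def algebra_simps)
  \<comment> \<open>The case \<open>s = -1\<close> makes pairings with the zero polynomial vanish;
    setting one summand to zero then separates scaling from additivity.\<close>
  have "pairing p 0 b = 0" "pairing p b 0 = 0" for b using l[of "-1" b b b] r[of b "-1" b b] by simp_all
  then show ?thesis
    using l[of 1] l[of _ _ 0] r[of _ 1] r[of _ _ _ 0] by unfold_locales simp_all
qed

text \<open>Integration by parts in x: differentiating \<open>exp (x * y)\<close> produces the
  factor y, so multiplication by y on the second argument is adjoint to minus the derivative
  conjugated by the exponential of the potential.\<close>

lemma boundary_x:
  assumes p: "p \<in> \<Omega>"
  shows "pairing p (pderiv a - potential_deriv d1 (fst p) * a) b + pairing p a (mult_X b) = 0"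
proof -
  let ?a = "pderiv a - potential_deriv d1 (fst p) * a"
  have "deriv (\<lambda>z. poly a z * poly b y * weight d1 d2 p z y) x
    = 1 * (poly ?a x * poly b y * weight d1 d2 p x y) + poly a x * poly (mult_X b) y * weight d1 d2 p x y" for x y
    unfolding weight_def
    by (rule DERIV_imp_deriv)
      (auto intro!: derivative_eq_intros potential_has_derivative poly_DERIV simp: algebra_simps)
  then show ?thesis
    using no_boundary_x[OF p, of a b] double_integral_linear[OF convergence[OF p, of ?a b] convergence[OF p, of a "mult_X b"], of 1]
    by (simp add: pairing_def)
qed

lemma boundary_y:
  assumes p: "p \<in> \<Omega>"
  shows "pairing p a (pderiv b - potential_deriv d2 (snd p) * b) + pairing p (mult_X a) b = 0"
proof -
  let ?b = "pderiv b - potential_deriv d2 (snd p) * b"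
  have "deriv (\<lambda>z. poly a x * poly b z * weight d1 d2 p x z) y
    = 1 * (poly a x * poly ?b y * weight d1 d2 p x y) + poly (mult_X a) x * poly b y * weight d1 d2 p x y" for x y
    unfolding weight_def
    by (rule DERIV_imp_deriv)
      (auto intro!: derivative_eq_intros potential_has_derivative poly_DERIV simp: algebra_simps)
  then show ?thesis
    using no_boundary_y[OF p, of a b] double_integral_linear[OF convergence[OF p, of a ?b] convergence[OF p, of "mult_X a" b], of 1]
    by (simp add: pairing_def)
qed

text \<open>\<Omega> is open only relative to \<open>param_space\<close>. Changing an admissible
  coordinate stays in that subspace, so the slice is the continuous preimage of an ambient open
  set.\<close>

lemma slice_open:
  assumes p: "p \<in> \<Omega>"
  shows "K \<in> {1..d1+1} \<Longrightarrow> open {w. u_slice p K w \<in> \<Omega>}" "J \<in> {1..d2+1} \<Longrightarrow> open {w. v_slice p J w \<in> \<Omega>}"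
proof -
  obtain T where T: "open T" "\<Omega> = param_space d1 d2 \<inter> T"
    using param_domain(1) by (auto simp: openin_open)
  show "open {w. u_slice p K w \<in> \<Omega>}" if K: "K \<in> {1..d1+1}"
  proof -
    have "u_slice p K w \<in> param_space d1 d2" for w using p K T by (auto simp: param_space_def)
    then have "{w. u_slice p K w \<in> \<Omega>} = (\<lambda>w. u_slice p K w) -` T" using T by auto
    then show ?thesis using open_vimage[OF T(1) continuous_slice(1)] by simp
  qed
  show "open {w. v_slice p J w \<in> \<Omega>}" if J: "J \<in> {1..d2+1}"
  proof -
    have "v_slice p J w \<in> param_space d1 d2" for w using p J T by (auto simp: param_space_def)
    then have "{w. v_slice p J w \<in> \<Omega>} = (\<lambda>w. v_slice p J w) -` T" using T by auto
    then show ?thesis using open_vimage[OF T(1) continuous_slice(2)] by simp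
  qed
qed

lemma slice_isCont_r:
  assumes p: "p \<in> \<Omega>"
  shows "K \<in> {1..d1+1} \<Longrightarrow> isCont (\<lambda>w. r (u_slice p K w) n) (fst p K)"
    "J \<in> {1..d2+1} \<Longrightarrow> isCont (\<lambda>w. r (v_slice p J w) n) (snd p J)"
proof -
  assume "K \<in> {1..d1+1}"
  moreover have "continuous_on {w. u_slice p K w \<in> \<Omega>} (\<lambda>w. r (u_slice p K w) n)"
    by (rule continuous_on_compose2[OF sqrt_smooth continuous_slice(1)]) auto
  ultimately show "isCont (\<lambda>w. r (u_slice p K w) n) (fst p K)"
    using slice_open(1)[OF p] p by (simp add: continuous_on_eq_continuous_at)
next
  assume "J \<in> {1..d2+1}"
  moreover have "continuous_on {w. v_slice p J w \<in> \<Omega>} (\<lambda>w. r (v_slice p J w) n)"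
    by (rule continuous_on_compose2[OF sqrt_smooth continuous_slice(2)]) auto
  ultimately show "isCont (\<lambda>w. r (v_slice p J w) n) (snd p J)"
    using slice_open(2)[OF p] p by (simp add: continuous_on_eq_continuous_at)
qed

lemma weight_u_slice:
  assumes "K \<in> {1..d1+1}"
  shows "weight d1 d2 (u_slice p K w) x y = weight d1 d2 p x y
    * exp ((w - fst p K) * poly (Polynomial.smult (- (1 / of_nat K)) (monom 1 K)) x)"
  unfolding weight_def fst_conv snd_conv potential_fun_upd[OF assms] exp_add[symmetric]
  by (rule arg_cong[of _ _ exp]) (simp add: poly_monom)

lemma weight_v_slice:
  assumes "J \<in> {1..d2+1}"
  shows "weight d1 d2 (v_slice p J w) x y = weight d1 d2 p x y
    * exp ((w - snd p J) * poly (Polynomial.smult (- (1 / of_nat J)) (monom 1 J)) y)"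
  unfolding weight_def fst_conv snd_conv potential_fun_upd[OF assms] exp_add[symmetric]
  by (rule arg_cong[of _ _ exp]) (simp add: poly_monom)

text \<open>Moving u_K multiplies the weight by an exponential of -x^K/K times the displacement.
  Convergence at neighbouring parameters therefore bounds the perturbed integrands, and the extra
  powers of -x^K/K are absorbed into the polynomial \<open>a\<close>.\<close>

lemma pairing_u_derivative:
  assumes p: "p \<in> \<Omega>" and K: "K \<in> {1..d1+1}"
  shows "((\<lambda>w. pairing (u_slice p K w) a b) has_field_derivative
    pairing p (Polynomial.smult (- (1 / of_nat K)) (monom 1 K) * a) b) (at (fst p K))"
proof -
  let ?D = "Polynomial.smult (- (1 / of_nat K)) (monom 1 K) :: complex poly"
  let ?w0 = "fst p K"
  have "?w0 \<in> {w. u_slice p K w \<in> \<Omega>}" using p by simp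
  then obtain e where e: "e > 0" "ball ?w0 e \<subseteq> {w. u_slice p K w \<in> \<Omega>}"
    using slice_open(1)[OF p K] open_contains_ball by blast
  have inO: "u_slice p K (?w0 + \<eta>) \<in> \<Omega>" if "norm \<eta> < e" for \<eta>
  proof -
    have "?w0 + \<eta> \<in> ball ?w0 e" using that by (simp add: dist_norm)
    then show ?thesis using e(2) by blast
  qed
  have "((\<lambda>w. double_integral \<Gamma>x \<Gamma>y (\<lambda>x y. poly a x * poly b y * weight d1 d2 p x y * exp ((w - ?w0) * poly ?D x)))
    has_field_derivative double_integral \<Gamma>x \<Gamma>y (\<lambda>x y. poly ?D x * (poly a x * poly b y * weight d1 d2 p x y))) (at ?w0)"
  proof (rule double_integral_has_derivative[OF e(1)])
    fix \<eta> :: complex assume \<eta>: "norm \<eta> < e"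
    show "double_integrable \<Gamma>x \<Gamma>y (\<lambda>x y. poly a x * poly b y * weight d1 d2 p x y * exp (\<eta> * poly ?D x))"
      using convergence[OF inO[OF \<eta>], of a b] by (simp add: weight_u_slice[OF K] mult.assoc)
    show "double_integrable \<Gamma>x \<Gamma>y (\<lambda>x y. poly ?D x ^ 2 * (poly a x * poly b y * weight d1 d2 p x y) * exp (\<eta> * poly ?D x))"
      using convergence[OF inO[OF \<eta>], of "?D * ?D * a" b]
      by (simp add: weight_u_slice[OF K] mult.assoc power2_eq_square del: mult_smult_left mult_smult_right)
  next
    show "double_integrable \<Gamma>x \<Gamma>y (\<lambda>x y. poly ?D x * (poly a x * poly b y * weight d1 d2 p x y))"
      using convergence[OF p, of "?D * a" b] by (simp add: mult.assoc del: mult_smult_left mult_smult_right)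
  qed
  then show ?thesis
    by (simp add: pairing_def weight_u_slice[OF K] mult.assoc del: mult_smult_left mult_smult_right)
qed

lemma pairing_v_derivative:
  assumes p: "p \<in> \<Omega>" and J: "J \<in> {1..d2+1}"
  shows "((\<lambda>w. pairing (v_slice p J w) a b) has_field_derivative
    pairing p a (Polynomial.smult (- (1 / of_nat J)) (monom 1 J) * b)) (at (snd p J))"
proof -
  let ?D = "Polynomial.smult (- (1 / of_nat J)) (monom 1 J) :: complex poly"
  let ?w0 = "snd p J"
  have "?w0 \<in> {w. v_slice p J w \<in> \<Omega>}" using p by simp
  then obtain e where e: "e > 0" "ball ?w0 e \<subseteq> {w. v_slice p J w \<in> \<Omega>}"
    using slice_open(2)[OF p J] open_contains_ball by blast
  have inO: "v_slice p J (?w0 + \<eta>) \<in> \<Omega>" if "norm \<eta> < e" for \<eta>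
  proof -
    have "?w0 + \<eta> \<in> ball ?w0 e" using that by (simp add: dist_norm)
    then show ?thesis using e(2) by blast
  qed
  have "((\<lambda>w. double_integral \<Gamma>x \<Gamma>y (\<lambda>x y. poly a x * poly b y * weight d1 d2 p x y * exp ((w - ?w0) * poly ?D y)))
    has_field_derivative double_integral \<Gamma>x \<Gamma>y (\<lambda>x y. poly ?D y * (poly a x * poly b y * weight d1 d2 p x y))) (at ?w0)"
  proof (rule double_integral_has_derivative[OF e(1)])
    fix \<eta> :: complex assume \<eta>: "norm \<eta> < e"
    show "double_integrable \<Gamma>x \<Gamma>y (\<lambda>x y. poly a x * poly b y * weight d1 d2 p x y * exp (\<eta> * poly ?D y))"
      using convergence[OF inO[OF \<eta>], of a b] by (simp add: weight_v_slice[OF J] mult.assoc)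
    show "double_integrable \<Gamma>x \<Gamma>y (\<lambda>x y. poly ?D y ^ 2 * (poly a x * poly b y * weight d1 d2 p x y) * exp (\<eta> * poly ?D y))"
      using convergence[OF inO[OF \<eta>], of a "?D * ?D * b"]
      by (simp add: weight_v_slice[OF J] mult_ac power2_eq_square del: mult_smult_left mult_smult_right)
  next
    show "double_integrable \<Gamma>x \<Gamma>y (\<lambda>x y. poly ?D y * (poly a x * poly b y * weight d1 d2 p x y))"
      using convergence[OF p, of a "?D * b"] by (simp add: mult_ac del: mult_smult_left mult_smult_right)
  qed
  then show ?thesis
    by (simp add: pairing_def weight_v_slice[OF J] mult_ac del: mult_smult_left mult_smult_right)
qed

lemma monic_coeff: "p \<in> \<Omega> \<Longrightarrow> coeff (\<pi> p n) n = 1" "p \<in> \<Omega> \<Longrightarrow> coeff (\<sigma> p n) n = 1"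
  using monic by metis+

lemma pairing_biorthogonal: "p \<in> \<Omega> \<Longrightarrow> pairing p (\<pi> p n) (\<sigma> p m) = (if n = m then h p n else 0)"
  unfolding pairing_def by (rule biorthogonal)

lemma u_flow:
  assumes p: "p \<in> \<Omega>" and K: "K \<in> {1..d1+1}"
  shows "monic_flow (\<lambda>w. pairing (u_slice p K w)) {w. u_slice p K w \<in> \<Omega>} (fst p K)
    (Polynomial.smult (- (1 / of_nat K)) (monom 1 K))
    (\<lambda>w. \<pi> (u_slice p K w)) (\<lambda>w. \<sigma> (u_slice p K w)) (\<lambda>w. h (u_slice p K w)) (\<lambda>w. r (u_slice p K w))"
proof (intro monic_flow.intro pairing_flow.intro monic_flow_axioms.intro)
  show "((\<lambda>w. pairing (u_slice p K w) a b) has_field_derivative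
     pairing (u_slice p K (fst p K)) (Polynomial.smult (- (1 / of_nat K)) (monom 1 K) * a) b) (at (fst p K))" for a b
    using pairing_u_derivative[OF p K] by simp
qed (use p slice_open(1)[OF p K] slice_isCont_r(1)[OF p K] pairing_bilinear monic monic_coeff pairing_biorthogonal nonzero sqrt in
    \<open>auto simp del: split_paired_All\<close>)

text \<open>The weight now varies through y. Exchanging the arguments of the pairing, and with them
  \<pi> and \<sigma>, makes its derivative act on the first argument again.\<close>

lemma v_flow:
  assumes p: "p \<in> \<Omega>" and J: "J \<in> {1..d2+1}"
  shows "monic_flow (\<lambda>w a b. pairing (v_slice p J w) b a) {w. v_slice p J w \<in> \<Omega>} (snd p J)
    (Polynomial.smult (- (1 / of_nat J)) (monom 1 J))
    (\<lambda>w. \<sigma> (v_slice p J w)) (\<lambda>w. \<pi> (v_slice p J w)) (\<lambda>w. h (v_slice p J w)) (\<lambda>w. r (v_slice p J w))"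
proof (intro monic_flow.intro pairing_flow.intro monic_flow_axioms.intro)
  show "((\<lambda>w. pairing (v_slice p J w) b a) has_field_derivative
     pairing (v_slice p J (snd p J)) b (Polynomial.smult (- (1 / of_nat J)) (monom 1 J) * a)) (at (snd p J))" for a b
    using pairing_v_derivative[OF p J] by simp
qed (use p slice_open(2)[OF p J] slice_isCont_r(2)[OF p J] bilinear_pairing.transposed[OF pairing_bilinear]
    monic monic_coeff pairing_biorthogonal nonzero sqrt in \<open>auto simp del: split_paired_All\<close>)

end

text \<open>In both products the summation index is bounded in terms of \<open>n\<close> through one
  factor and of \<open>m\<close> through the other, hence in terms of the smaller of the two. This
  converts bounds growing with \<open>n + m\<close>, as in \<open>toda_flow\<close>, to the form
  that the intertwining lemmas require.\<close>

lemma band_commutator_stable: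
  assumes A: "banded a b A" and W: "banded a' b' W"
    and M: "min n m + (a + b + a' + b' + 1) \<le> M" "min n m + (a + b + a' + b' + 1) \<le> M'"
  shows "(\<Sum>l<M. A n l * W l m - W n l * A l m) = (\<Sum>l<M'. A n l * W l m - W n l * A l m)"
proof -
  let ?B = "min n m + (a + b + a' + b' + 1)"
  have "A n l * W l m - W n l * A l m = 0" if "?B \<le> l" for l
  proof -
    have "A n l = 0 \<or> W l m = 0" using that bandedD[OF A, of n l] bandedD[OF W, of l m] by linarith
    moreover have "W n l = 0 \<or> A l m = 0" using that bandedD[OF A, of l m] bandedD[OF W, of n l] by linarith
    ultimately show ?thesis by auto
  qed
  then have "(\<Sum>l<R. A n l * W l m - W n l * A l m) = (\<Sum>l<?B. A n l * W l m - W n l * A l m)" if "?B \<le> R" for R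
    by (intro sum.mono_neutral_right) (use that in auto)
  then show ?thesis using M by simp
qed

lemma CD_mat_has_derivative:
  assumes N: "1 \<le> N" "d \<le> N" "1 \<le> d"
    and L: "\<And>n m. ((\<lambda>w. Q_imat d (c w) n m) has_field_derivative L n m) (at w0)"
  shows "has_mat_derivative (\<lambda>w. CD_mat d (c w) N) (cut_mat d N L) w0" "banded d 1 L"
proof -
  show "has_mat_derivative (\<lambda>w. CD_mat d (c w) N) (cut_mat d N L) w0"
    unfolding has_mat_derivative_def CD_mat_eq_cut_mat[OF N]
    by (auto simp: cut_mat_def intro!: DERIV_cmult_right L)
  show "banded d 1 L"
    unfolding banded_def
  proof (intro allI impI, rule ccontr)
    fix n m assume nz: "L n m \<noteq> 0" and out: "\<not> (n \<le> m + d \<and> m \<le> n + 1)"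
    have "(\<lambda>w. Q_imat d (c w) n m) = (\<lambda>w. 0)"
      using banded_zero[OF banded_Q_imat out] by auto
    then have "((\<lambda>w. 0) has_field_derivative L n m) (at w0)" using L[of n m] by simp
    then show False using nz DERIV_unique DERIV_const by blast
  qed
qed

lemma diff_eq_cut_mat_uminus:
  assumes "A \<in> carrier_mat (d + 1) (d + 1)" "B \<in> carrier_mat (d + 1) (d + 1)"
    and "A - B = cut_mat d N (\<lambda>n m. - L n m)"
  shows "B - A = cut_mat d N L"
proof (rule eq_matI)
  fix i k assume "i < dim_row (cut_mat d N L)" "k < dim_col (cut_mat d N L)"
  then have ik: "i < d + 1" "k < d + 1" by (auto simp: cut_mat_def)
  have "(A - B) $$ (i, k) = - (cut_mat d N L $$ (i, k))"
    unfolding assms(3) using ik by (simp add: cut_mat_def)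
  then show "(B - A) $$ (i, k) = cut_mat d N L $$ (i, k)"
    using assms(1,2) ik by (simp add: algebra_simps)
qed (use assms(1,2) in \<open>auto simp: cut_mat_def\<close>)

text \<open>With \<open>V\<close> the derivative of the potential, the hypothesis is integration by
  parts. The polynomial on its right has degree exactly \<open>n\<close>, so pairing it with
  \<open>f n\<close> sees only its leading coefficient, the product of those of \<open>V\<close> and
  \<open>g m\<close>.\<close>

lemma (in biorthonormal) top_coeff_nonzero:
  assumes "pair (mult_X (f n)) (g m) = pair (f n) (V * g m - pderiv (g m))"
    and V: "degree V = d" "V \<noteq> 0" "1 \<le> d" and n: "n = m + d"
  shows "pair (mult_X (f n)) (g m) \<noteq> 0"
proof -
  interpret t: biorthonormal "\<lambda>a b. pair b a" g f by (rule transposed_biorthonormal)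
  let ?q = "V * g m - pderiv (g m)"
  have dp: "degree (pderiv (g m)) < n" using deg_g[of m] V n by (simp add: degree_pderiv)
  have dv: "degree (V * g m) = n" using deg_g[of m] V n by (simp add: degree_mult_eq)
  have "degree ?q \<le> n" using dp dv by (intro degree_diff_le) auto
  then have "pair (f n) ?q = coeff ?q n / coeff (g n) n" by (rule t.lead_left)
  moreover have "coeff (V * g m) n = lead_coeff V * lead_coeff (g m)"
    using coeff_mult_degree_sum[of V "g m"] deg_g[of m] V n by (simp add: add.commute)
  then have "coeff ?q n \<noteq> 0"
    using coeff_eq_0[OF dp] V deg_g[of m] by (simp add: leading_coeff_0_iff[symmetric])
  moreover have "coeff (g n) n \<noteq> 0" using deg_g[of n] leading_coeff_0_iff[of "g n"] by auto
  ultimately show ?thesis using assms(1) by simp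
qed

text \<open>The matrix \<open>-P\<^sup>t\<close> has the shape of \<open>Q\<close> with \<open>(\<beta>, d1)\<close> in place of \<open>(\<alpha>, d2)\<close>, so each statement on
  \<open>\<B>\<^sup>N\<close> is one on \<open>\<A>\<^sup>N\<close> with the two sides exchanged.\<close>

lemma dual_side_eqs:
  "D2 d1 d2 a b N x = D1 d2 d1 b a N x"
  "dual_D2 d1 d2 a b N x = dual_D1 d2 d1 b a N x"
  "U_Phi d1 d2 a b K N x = V_Psi d2 d1 b a K N x"
  "dual_U_Psi d1 d2 a b K N x = dual_V_Phi d2 d1 b a K N x"
  "V_Phi d1 d2 a b K N x = U_Psi d2 d1 b a K N x"
  "dual_V_Psi d1 d2 a b K N x = dual_U_Phi d2 d1 b a K N x"
  by (simp_all add: add.commute D2_def D1_def dual_D2_def dual_D1_def U_Phi_def V_Psi_def dual_U_Psi_def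
      dual_V_Phi_def V_Phi_def U_Psi_def dual_V_Psi_def dual_U_Phi_def V_imat_eq_U_imat)

text \<open>One flow moves both matrices: that of multiplication in the first variable through
  \<open>U\<close>, that of the second variable through the transpose of \<open>U\<close>. Instances
  for u and for v, the latter with exchanged roles, yield the four deformation equations.\<close>

lemma (in monic_flow) CD_mat_flow:
  fixes b c :: "complex \<Rightarrow> coeffs"
  assumes D: "D = Polynomial.smult (- (1 / of_nat K)) (monom 1 K)"
    and c: "\<And>w n m. w \<in> S \<Longrightarrow> Q_imat d (c w) n m = pair w (mult_X (f w n)) (g w m)"
    and b: "\<And>w n m. w \<in> S \<Longrightarrow> Q_imat e (b w) n m = pair w (f w m) (mult_X (g w n))"
    and c_nz: "\<And>n. c w0 (-1) n \<noteq> 0" "\<And>n. d \<le> n \<Longrightarrow> c w0 (int d) n \<noteq> 0"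
    and b_nz: "\<And>n. b w0 (-1) n \<noteq> 0" "\<And>n. e \<le> n \<Longrightarrow> b w0 (int e) n \<noteq> 0"
    and de: "1 \<le> d" "1 \<le> e"
  shows "max d (K + 1) \<le> N \<Longrightarrow> has_mat_derivative (\<lambda>w. CD_mat d (c w) N)
      (dual_U_Phi e d (c w0) (b w0) K N x * CD_mat d (c w0) N
        - CD_mat d (c w0) N * U_Psi e d (c w0) (b w0) K N x) w0"
    and "e + K \<le> N \<Longrightarrow> has_mat_derivative (\<lambda>w. CD_mat e (b w) N)
      (CD_mat e (b w0) N * V_Psi d e (b w0) (c w0) K N x
        - dual_V_Phi d e (b w0) (c w0) K N x * CD_mat e (b w0) N) w0"
proof -
  let ?Q = "Q_imat d (c w0)" and ?Y = "Q_imat e (b w0)" and ?U = "U_imat d (c w0) K"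
  define LQ where "LQ n m = (\<Sum>l<n + m + K + 2. ?U n l * ?Q l m - ?Q n l * ?U l m)" for n m
  define LY where "LY n m = (\<Sum>l<n + m + K + 2. ?Y n l * ?U m l - ?U l n * ?Y l m)" for n m
  note w0 = c[OF S(2)] b[OF S(2)]
  have dQ': "((\<lambda>w. Q_imat d (c w) n m) has_field_derivative (\<Sum>l<M. ?U n l * ?Q l m - ?Q n l * ?U l m)) (at w0)"
    if "n + m + K + 2 \<le> M" for n m M
    by (rule has_field_derivative_transform_within_open[OF toda_flow(1)[OF D w0(1) that] S]) (rule c[symmetric])
  have dY': "((\<lambda>w. Q_imat e (b w) n m) has_field_derivative (\<Sum>l<M. ?Y n l * ?U m l - ?U l n * ?Y l m)) (at w0)"
    if "n + m + K + 2 \<le> M" for n m M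
    unfolding w0(2)
    by (rule has_field_derivative_transform_within_open[OF toda_flow(2)[OF D w0(1) that] S]) (rule b[symmetric])
  have dQ: "((\<lambda>w. Q_imat d (c w) n m) has_field_derivative LQ n m) (at w0)" for n m
    unfolding LQ_def by (rule dQ') simp
  have dY: "((\<lambda>w. Q_imat e (b w) n m) has_field_derivative LY n m) (at w0)" for n m
    unfolding LY_def by (rule dY') simp
  show "has_mat_derivative (\<lambda>w. CD_mat d (c w) N)
      (dual_U_Phi e d (c w0) (b w0) K N x * CD_mat d (c w0) N
        - CD_mat d (c w0) N * U_Psi e d (c w0) (b w0) K N x) w0" if N: "max d (K + 1) \<le> N"
  proof -
    have N': "1 \<le> N" "d \<le> N" "K + 1 \<le> N" using N by auto
    note L = CD_mat_has_derivative[of N d c, OF N'(1,2) de(1) dQ]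
    have eq: "CD_mat d (c w0) N * U_Psi e d (c w0) (b w0) K N x - dual_U_Phi e d (c w0) (b w0) K N x * CD_mat d (c w0) N
      = cut_mat d N (\<lambda>n m. - LQ n m)"
    proof (rule U_Psi_intertwine[where B = "d + 1 + 0 + K + 1", OF de(1) N'(2,3) c_nz])
      show "banded d 1 (\<lambda>n m. - LQ n m)" using L(2) by (simp add: banded_def)
      fix n m M assume M: "min n m + (d + 1 + 0 + K + 1) \<le> M"
      have "- LQ n m = (\<Sum>l<n + m + K + 2 + d. ?Q n l * ?U l m - ?U n l * ?Q l m)"
      proof -
        \<comment> \<open>Both truncations are the derivative of the same entry. The added
          \<open>d\<close> raises the bound above the threshold of
          \<open>band_commutator_stable\<close> as well as that of the flow.\<close>
        have "LQ n m = (\<Sum>l<n + m + K + 2 + d. ?U n l * ?Q l m - ?Q n l * ?U l m)"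
          by (rule DERIV_unique[OF dQ dQ']) simp
        then show ?thesis by (simp add: sum_negf[symmetric])
      qed
      also have "\<dots> = (\<Sum>l<M. ?Q n l * ?U l m - ?U n l * ?Q l m)"
        by (rule band_commutator_stable[OF banded_Q_imat U_imat_banded]) (use M in auto)
      finally show "- LQ n m = (\<Sum>l<M. ?Q n l * ?U l m - ?U n l * ?Q l m)" .
    qed
    have "U_Psi e d (c w0) (b w0) K N x \<in> carrier_mat (d + 1) (d + 1)"
      "dual_U_Phi e d (c w0) (b w0) K N x \<in> carrier_mat (d + 1) (d + 1)"
      unfolding U_Psi_def dual_U_Phi_def by (rule mat_sum_carrier)+
    from diff_eq_cut_mat_uminus[OF mult_carrier_mat[OF CD_mat_carrier this(1)] mult_carrier_mat[OF this(2) CD_mat_carrier] eq]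
    have "dual_U_Phi e d (c w0) (b w0) K N x * CD_mat d (c w0) N
        - CD_mat d (c w0) N * U_Psi e d (c w0) (b w0) K N x = cut_mat d N LQ" .
    then show ?thesis using L(1) by simp
  qed
  show "has_mat_derivative (\<lambda>w. CD_mat e (b w) N)
      (CD_mat e (b w0) N * V_Psi d e (b w0) (c w0) K N x
        - dual_V_Phi d e (b w0) (c w0) K N x * CD_mat e (b w0) N) w0" if N: "e + K \<le> N"
  proof -
    have N': "1 \<le> N" "e \<le> N" using N de by auto
    note L = CD_mat_has_derivative[of N e b, OF N' de(2) dY]
    have "CD_mat e (b w0) N * V_Psi d e (b w0) (c w0) K N x - dual_V_Phi d e (b w0) (c w0) K N x * CD_mat e (b w0) N
      = cut_mat e N LY"
    proof (rule V_Psi_intertwine[where B = "e + 1 + K + 0 + 1", OF de(2) N b_nz L(2)])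
      fix n m M assume M: "min n m + (e + 1 + K + 0 + 1) \<le> M"
      have Ub: "banded K 0 (\<lambda>n m. ?U m n)" using U_imat_banded[of K d "c w0"] by (auto simp: banded_def)
      have "LY n m = (\<Sum>l<n + m + K + 2 + e. ?Y n l * ?U m l - ?U l n * ?Y l m)"
        by (rule DERIV_unique[OF dY dY']) simp
      also have "\<dots> = (\<Sum>l<M. ?Y n l * ?U m l - ?U l n * ?Y l m)"
        by (rule band_commutator_stable[OF banded_Q_imat Ub]) (use M in auto)
      finally show "LY n m = (\<Sum>l<M. ?Y n l * ?U m l - ?U l n * ?Y l m)" .
    qed
    then show ?thesis using L(1) by simp
  qed
qed

section \<open>Recursion coefficients as pairings, the string equation, and the duality
  relations\<close>

context recursion_setting
begin

definition orthonormal_x where "orthonormal_x p n = Polynomial.smult (1 / r p n) (\<pi> p n)"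

definition orthonormal_y where "orthonormal_y p n = Polynomial.smult (1 / r p n) (\<sigma> p n)"

lemma orthonormal:
  assumes p: "p \<in> \<Omega>" shows "biorthonormal (pairing p) (orthonormal_x p) (orthonormal_y p)"
proof -
  \<comment> \<open>The choice 1 is just an admissible index: only biorthonormality at the base
    point of the flow is extracted.\<close>
  interpret monic_flow "\<lambda>w. pairing (u_slice p 1 w)" "{w. u_slice p 1 w \<in> \<Omega>}" "fst p 1"
    "Polynomial.smult (- (1 / of_nat 1)) (monom 1 1)"
    "\<lambda>w. \<pi> (u_slice p 1 w)" "\<lambda>w. \<sigma> (u_slice p 1 w)" "\<lambda>w. h (u_slice p 1 w)" "\<lambda>w. r (u_slice p 1 w)"
    by (rule u_flow[OF p]) auto
  have "f (fst p 1) = orthonormal_x p" "g (fst p 1) = orthonormal_y p"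
    by (rule ext, simp add: f_def g_def orthonormal_x_def orthonormal_y_def del: One_nat_def)+
  then show ?thesis using fg_biorthonormal[of "fst p 1"] p by simp
qed

lemma psi_eq: "psi p n = (\<lambda>x. poly (orthonormal_x p n) x * exp (- potential d1 (fst p) x))"
  by (auto simp: psi_def quasi_polynomial_def orthonormal_x_def)

text \<open>Cancelling the exponential turns the recursion for \<psi> into an identity of
  polynomials, and pairing with the dual basis selects one coefficient. From here on \<alpha> is
  accessible through pairings, which the flows can differentiate.\<close>

lemma Q_entry:
  assumes p: "p \<in> \<Omega>"
  shows "Q_imat d2 (\<alpha> p) n m = pairing p (mult_X (orthonormal_x p n)) (orthonormal_y p m)"
proof -
  interpret biorthonormal "pairing p" "orthonormal_x p" "orthonormal_y p" by (rule orthonormal[OF p])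
  let ?J = "{j. j \<in> {-1..int d2} \<and> int n - j \<ge> 0}"
  have "mult_X (orthonormal_x p n) = (\<Sum>j\<in>?J. Polynomial.smult (\<alpha> p j n) (orthonormal_x p (nat (int n - j))))"
  proof (rule poly_eq_poly_eq_iff[THEN iffD1], rule ext)
    fix x
    have "x * poly (orthonormal_x p n) x * exp (- potential d1 (fst p) x)
      = (\<Sum>j\<in>?J. \<alpha> p j n * poly (orthonormal_x p (nat (int n - j))) x) * exp (- potential d1 (fst p) x)"
      using x_recursion[OF p, of x n] unfolding psi_eq sum_distrib_right by (simp add: mult.assoc)
    then show "poly (mult_X (orthonormal_x p n)) x
      = poly (\<Sum>j\<in>?J. Polynomial.smult (\<alpha> p j n) (orthonormal_x p (nat (int n - j)))) x"
      by (simp add: poly_sum)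
  qed
  then have "pairing p (mult_X (orthonormal_x p n)) (orthonormal_y p m)
    = (\<Sum>j\<in>?J. \<alpha> p j n * (if nat (int n - j) = m then 1 else 0))"
    by (simp only: sum_left smult_left orth)
  also have "\<dots> = (\<Sum>j\<in>?J. if j = int n - int m then \<alpha> p (int n - int m) n else 0)"
    by (intro sum.cong refl) auto
  also have "\<dots> = Q_imat d2 (\<alpha> p) n m"
  proof -
    have "finite ?J" by (rule finite_subset[of _ "{-1..int d2}"]) auto
    then show ?thesis by (auto simp: Q_imat_def)
  qed
  finally show ?thesis by simp
qed

text \<open>The derivative recursion describes the conjugated x-derivative in the first family;
  \<open>boundary_x\<close> moves it to multiplication by y in the second family. This is why -P^t
  behaves like \<open>Q\<close> with the two variables exchanged.\<close>

lemma P_entry: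
  assumes p: "p \<in> \<Omega>"
  shows "Q_imat d1 (\<beta> p) n m = pairing p (orthonormal_x p m) (mult_X (orthonormal_y p n))"
proof -
  interpret biorthonormal "pairing p" "orthonormal_x p" "orthonormal_y p" by (rule orthonormal[OF p])
  let ?J = "{j. j \<in> {-1..int d1} \<and> int m + j \<ge> 0}"
  let ?D = "pderiv (orthonormal_x p m) - potential_deriv d1 (fst p) * orthonormal_x p m"
  have "?D = (\<Sum>j\<in>?J. Polynomial.smult (- \<beta> p j (nat (int m + j))) (orthonormal_x p (nat (int m + j))))"
  proof (rule poly_eq_poly_eq_iff[THEN iffD1], rule ext)
    fix x
    have "deriv (psi p m) x = poly ?D x * exp (- potential d1 (fst p) x)"
      unfolding psi_eq
      by (rule DERIV_imp_deriv)
        (auto intro!: derivative_eq_intros potential_has_derivative poly_DERIV simp: algebra_simps)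
    then have "poly ?D x * exp (- potential d1 (fst p) x)
      = (\<Sum>j\<in>?J. - \<beta> p j (nat (int m + j)) * poly (orthonormal_x p (nat (int m + j))) x) * exp (- potential d1 (fst p) x)"
      using d_recursion[OF p, of m x] unfolding psi_eq sum_distrib_right sum_negf[symmetric] by (simp add: mult.assoc)
    then show "poly ?D x = poly (\<Sum>j\<in>?J. Polynomial.smult (- \<beta> p j (nat (int m + j))) (orthonormal_x p (nat (int m + j)))) x"
      by (simp add: poly_sum)
  qed
  then have "pairing p ?D (orthonormal_y p n)
    = (\<Sum>j\<in>?J. - \<beta> p j (nat (int m + j)) * (if nat (int m + j) = n then 1 else 0))"
    by (simp only: sum_left smult_left orth)
  also have "\<dots> = (\<Sum>j\<in>?J. if j = int n - int m then - \<beta> p (int n - int m) n else 0)"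
    by (intro sum.cong refl) auto
  also have "\<dots> = - Q_imat d1 (\<beta> p) n m"
  proof -
    have "finite ?J" by (rule finite_subset[of _ "{-1..int d1}"]) auto
    then show ?thesis by (auto simp: Q_imat_def)
  qed
  finally have "- Q_imat d1 (\<beta> p) n m + pairing p (orthonormal_x p m) (mult_X (orthonormal_y p n)) = 0"
    using boundary_x[OF p, of "orthonormal_x p m" "orthonormal_y p n"] by (simp only:)
  then show ?thesis by simp
qed

lemma r_nonzero: "p \<in> \<Omega> \<Longrightarrow> r p n \<noteq> 0"
  using sqrt[of p n] nonzero[of p n] by auto

lemma gamma_nonzero: "p \<in> \<Omega> \<Longrightarrow> \<alpha> p (-1) n \<noteq> 0" "p \<in> \<Omega> \<Longrightarrow> \<beta> p (-1) n \<noteq> 0"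
  using gamma[of p n] r_nonzero[of p] by auto

lemma potential_deriv_degree:
  assumes "u (d + 1) \<noteq> 0"
  shows "degree (potential_deriv d u) = d" "potential_deriv d u \<noteq> 0"
proof -
  have "coeff (potential_deriv d u) d \<noteq> 0" using assms by (simp add: coeff_potential_deriv)
  moreover have "degree (potential_deriv d u) \<le> d" by (intro degree_le) (simp add: coeff_potential_deriv)
  ultimately show "degree (potential_deriv d u) = d" "potential_deriv d u \<noteq> 0"
    using le_degree by (fastforce, force)
qed

lemma top_nonzero:
  assumes p: "p \<in> \<Omega>"
  shows "d2 \<le> n \<Longrightarrow> \<alpha> p (int d2) n \<noteq> 0" "d1 \<le> n \<Longrightarrow> \<beta> p (int d1) n \<noteq> 0"
proof -
  interpret biorthonormal "pairing p" "orthonormal_x p" "orthonormal_y p" by (rule orthonormal[OF p])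
  interpret t: biorthonormal "\<lambda>a b. pairing p b a" "orthonormal_y p" "orthonormal_x p" by (rule transposed_biorthonormal)
  have uv: "fst p (d1 + 1) \<noteq> 0" "snd p (d2 + 1) \<noteq> 0" using leading_coeffs[of "fst p" "snd p"] p by auto
  show "\<alpha> p (int d2) n \<noteq> 0" if n: "d2 \<le> n"
  proof -
    let ?m = "n - d2"
    have "pairing p (mult_X (orthonormal_x p n)) (orthonormal_y p ?m) \<noteq> 0"
    proof (rule top_coeff_nonzero[OF _ potential_deriv_degree[where d = d2 and u = "snd p", OF uv(2)]])
      show "pairing p (mult_X (orthonormal_x p n)) (orthonormal_y p ?m) = pairing p (orthonormal_x p n)
         (potential_deriv d2 (snd p) * orthonormal_y p ?m - pderiv (orthonormal_y p ?m))"
        using boundary_y[OF p, of "orthonormal_x p n" "orthonormal_y p ?m"] by (simp add: t.minus_left algebra_simps)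
    qed (use n degrees in auto)
    then show ?thesis unfolding Q_entry[OF p, symmetric] using n by (simp add: Q_imat_def of_nat_diff)
  qed
  show "\<beta> p (int d1) n \<noteq> 0" if n: "d1 \<le> n"
  proof -
    let ?m = "n - d1"
    have "pairing p (orthonormal_x p ?m) (mult_X (orthonormal_y p n)) \<noteq> 0"
    proof (rule t.top_coeff_nonzero[OF _ potential_deriv_degree[where d = d1 and u = "fst p", OF uv(1)]])
      show "pairing p (orthonormal_x p ?m) (mult_X (orthonormal_y p n)) =
         pairing p (potential_deriv d1 (fst p) * orthonormal_x p ?m - pderiv (orthonormal_x p ?m)) (orthonormal_y p n)"
        using boundary_x[OF p, of "orthonormal_x p ?m" "orthonormal_y p n"] by (simp add: minus_left algebra_simps)
    qed (use n degrees in auto)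
    then show ?thesis unfolding P_entry[OF p, symmetric] using n by (simp add: Q_imat_def of_nat_diff)
  qed
qed

text \<open>The conjugated derivative \<open>D\<close> satisfies
  \<open>D (mult_X a) = a + mult_X (D a)\<close>. Paired with the dual basis, the extra
  \<open>a\<close> contributes a Kronecker delta, which is zero for
  \<open>n \<noteq> m\<close>.\<close>

lemma string_equation:
  assumes p: "p \<in> \<Omega>" and "n \<noteq> m" and M: "min n m + (d2 + 1 + 1 + d1 + 1) \<le> M"
  shows "(\<Sum>l<M. Q_imat d2 (\<alpha> p) n l * Q_imat d1 (\<beta> p) m l - Q_imat d1 (\<beta> p) l n * Q_imat d2 (\<alpha> p) l m) = 0"
proof -
  interpret biorthonormal "pairing p" "orthonormal_x p" "orthonormal_y p" by (rule orthonormal[OF p])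
  let ?f = "orthonormal_x p" and ?g = "orthonormal_y p"
  let ?Q = "Q_imat d2 (\<alpha> p)" and ?Y = "Q_imat d1 (\<beta> p)"
  define R where "R = n + m + d1 + d2 + 3"
  define D where "D a = pderiv a - potential_deriv d1 (fst p) * a" for a
  have bx: "pairing p (D a) b = - pairing p a (mult_X b)" for a b
    using boundary_x[OF p, of a b] by (simp add: D_def eq_neg_iff_add_eq_0)
  have DX: "D (mult_X a) = a + mult_X (D a)" for a
    by (simp add: D_def mult_X_def pderiv_mult pderiv_monom algebra_simps)
  have degD: "degree (D (?f n)) \<le> n + d1"
  proof -
    have "degree (potential_deriv d1 (fst p)) \<le> d1" by (intro degree_le) (simp add: coeff_potential_deriv)
    then have "degree (potential_deriv d1 (fst p) * ?f n) \<le> n + d1"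
      using degree_mult_le[of "potential_deriv d1 (fst p)" "?f n"] deg_f[of n] by simp
    moreover have "degree (pderiv (?f n)) \<le> n + d1" using deg_f[of n] by (simp add: degree_pderiv)
    ultimately show ?thesis unfolding D_def by (intro degree_diff_le)
  qed
  have X: "mult_X (?f n) = (\<Sum>l<R. Polynomial.smult (?Q n l) (?f l))"
    unfolding Q_entry[OF p] by (rule expand_left_degree) (use degree_mult_X[of "?f n" n] deg_f R_def in auto)
  have Y: "D (?f n) = (\<Sum>l<R. Polynomial.smult (- ?Y l n) (?f l))"
    unfolding P_entry[OF p] bx[symmetric] by (rule expand_left_degree) (use degD R_def in auto)
  have "pairing p (mult_X (D (?f n))) (?g m) = (\<Sum>l<R. - ?Y l n * ?Q l m)"
    unfolding Y mult_X_sum sum_left smult_left Q_entry[OF p] ..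
  moreover have "pairing p (mult_X (?f n)) (mult_X (?g m)) = (\<Sum>l<R. ?Q n l * ?Y m l)"
    by (subst X) (simp only: sum_left smult_left P_entry[OF p])
  moreover have "pairing p (mult_X (D (?f n))) (?g m) = - pairing p (mult_X (?f n)) (mult_X (?g m))"
    using bx[of "mult_X (?f n)" "?g m"] \<open>n \<noteq> m\<close> by (simp add: DX add_left orth)
  ultimately have "(\<Sum>l<R. ?Q n l * ?Y m l - ?Y l n * ?Q l m) = 0"
    by (simp add: sum_subtractf sum_negf)
  moreover have B: "banded 1 d1 (\<lambda>n m. ?Y m n)" using banded_Q_imat[of d1 "\<beta> p"] by (auto simp: banded_def)
  have "(\<Sum>l<M. ?Q n l * ?Y m l - ?Y l n * ?Q l m) = (\<Sum>l<R. ?Q n l * ?Y m l - ?Y l n * ?Q l m)"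
    by (rule band_commutator_stable[OF banded_Q_imat B]) (use M in \<open>auto simp: R_def\<close>)
  ultimately show ?thesis by simp
qed

lemma D_intertwine:
  assumes p: "p \<in> \<Omega>" and N: "max d1 d2 + 1 \<le> N"
  shows "CD_mat d2 (\<alpha> p) N * D1 d1 d2 (\<alpha> p) (\<beta> p) N x = dual_D1 d1 d2 (\<alpha> p) (\<beta> p) N x * CD_mat d2 (\<alpha> p) N"
    and "CD_mat d1 (\<beta> p) N * D2 d1 d2 (\<alpha> p) (\<beta> p) N x = dual_D2 d1 d2 (\<alpha> p) (\<beta> p) N x * CD_mat d1 (\<beta> p) N"
proof -
  have N': "d1 + 1 \<le> N" "d2 + 1 \<le> N" using N by auto
  show "CD_mat d2 (\<alpha> p) N * D1 d1 d2 (\<alpha> p) (\<beta> p) N x = dual_D1 d1 d2 (\<alpha> p) (\<beta> p) N x * CD_mat d2 (\<alpha> p) N"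
    by (rule D1_intertwine[OF degrees(2) N'(2,1) gamma_nonzero(1)[OF p] top_nonzero(1)[OF p] string_equation[OF p]])
  show "CD_mat d1 (\<beta> p) N * D2 d1 d2 (\<alpha> p) (\<beta> p) N x = dual_D2 d1 d2 (\<alpha> p) (\<beta> p) N x * CD_mat d1 (\<beta> p) N"
    unfolding dual_side_eqs
  proof (rule D1_intertwine[OF degrees(1) N'(1,2) gamma_nonzero(2)[OF p] top_nonzero(2)[OF p],
        where B = "d2 + 1 + 1 + d1 + 1"])
    fix n m M :: nat assume nm: "n \<noteq> m" "min n m + (d2 + 1 + 1 + d1 + 1) \<le> M"
    \<comment> \<open>With -P^t in the role of \<open>Q\<close>, the required commutator is the
      transpose of the original one, so the string equation is used with \<open>n\<close> and
      \<open>m\<close> exchanged.\<close>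
    have "(\<Sum>l<M. Q_imat d2 (\<alpha> p) m l * Q_imat d1 (\<beta> p) n l - Q_imat d1 (\<beta> p) l m * Q_imat d2 (\<alpha> p) l n) = 0"
      by (rule string_equation[OF p]) (use nm in auto)
    then show "(\<Sum>l<M. Q_imat d1 (\<beta> p) n l * Q_imat d2 (\<alpha> p) m l - Q_imat d2 (\<alpha> p) l n * Q_imat d1 (\<beta> p) l m) = 0"
      by (simp add: mult.commute)
  qed
qed

lemma u_deformation:
  assumes p: "p \<in> \<Omega>" and K: "1 \<le> K" "K \<le> d1 + 1"
  shows "max d2 (K + 1) \<le> N \<Longrightarrow> has_u_derivative K (\<lambda>q. CD_mat d2 (\<alpha> q) N)
      (dual_U_Phi d1 d2 (\<alpha> p) (\<beta> p) K N x * CD_mat d2 (\<alpha> p) N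
        - CD_mat d2 (\<alpha> p) N * U_Psi d1 d2 (\<alpha> p) (\<beta> p) K N x) p"
    and "d1 + K \<le> N \<Longrightarrow> has_u_derivative K (\<lambda>q. CD_mat d1 (\<beta> q) N)
      (CD_mat d1 (\<beta> p) N * U_Phi d1 d2 (\<alpha> p) (\<beta> p) K N x
        - dual_U_Psi d1 d2 (\<alpha> p) (\<beta> p) K N x * CD_mat d1 (\<beta> p) N) p"
proof -
  have K': "K \<in> {1..d1+1}" using K by simp
  interpret monic_flow "\<lambda>w. pairing (u_slice p K w)" "{w. u_slice p K w \<in> \<Omega>}" "fst p K"
    "Polynomial.smult (- (1 / of_nat K)) (monom 1 K)"
    "\<lambda>w. \<pi> (u_slice p K w)" "\<lambda>w. \<sigma> (u_slice p K w)" "\<lambda>w. h (u_slice p K w)" "\<lambda>w. r (u_slice p K w)"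
    by (rule u_flow[OF p K'])
  have fg: "f w = orthonormal_x (u_slice p K w)" "g w = orthonormal_y (u_slice p K w)" for w
    by (rule ext, simp add: f_def g_def orthonormal_x_def orthonormal_y_def)+
  have c: "Q_imat d2 (\<alpha> (u_slice p K w)) n m = pairing (u_slice p K w) (mult_X (f w n)) (g w m)"
    and b: "Q_imat d1 (\<beta> (u_slice p K w)) n m = pairing (u_slice p K w) (f w m) (mult_X (g w n))"
    if "w \<in> {w. u_slice p K w \<in> \<Omega>}" for w n m
    using Q_entry[of "u_slice p K w"] P_entry[of "u_slice p K w"] that unfolding fg by blast+
  have p0: "u_slice p K (fst p K) = p" by simp
  note flow = CD_mat_flow[where c = "\<lambda>w. \<alpha> (u_slice p K w)" and b = "\<lambda>w. \<beta> (u_slice p K w)",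
      OF refl c b, unfolded p0,
      OF _ _ gamma_nonzero(1)[OF p] top_nonzero(1)[OF p] gamma_nonzero(2)[OF p] top_nonzero(2)[OF p] degrees(2,1)]
  show "has_u_derivative K (\<lambda>q. CD_mat d2 (\<alpha> q) N)
      (dual_U_Phi d1 d2 (\<alpha> p) (\<beta> p) K N x * CD_mat d2 (\<alpha> p) N
        - CD_mat d2 (\<alpha> p) N * U_Psi d1 d2 (\<alpha> p) (\<beta> p) K N x) p" if "max d2 (K + 1) \<le> N"
    unfolding has_u_derivative_def by (rule flow(1)) (rule that | assumption)+
  show "has_u_derivative K (\<lambda>q. CD_mat d1 (\<beta> q) N)
      (CD_mat d1 (\<beta> p) N * U_Phi d1 d2 (\<alpha> p) (\<beta> p) K N x
        - dual_U_Psi d1 d2 (\<alpha> p) (\<beta> p) K N x * CD_mat d1 (\<beta> p) N) p" if "d1 + K \<le> N"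
    unfolding has_u_derivative_def dual_side_eqs by (rule flow(2)) (rule that | assumption)+
qed

lemma v_deformation:
  assumes p: "p \<in> \<Omega>" and J: "1 \<le> J" "J \<le> d2 + 1"
  shows "max d1 (J + 1) \<le> N \<Longrightarrow> has_v_derivative J (\<lambda>q. CD_mat d1 (\<beta> q) N)
      (dual_V_Psi d1 d2 (\<alpha> p) (\<beta> p) J N x * CD_mat d1 (\<beta> p) N
        - CD_mat d1 (\<beta> p) N * V_Phi d1 d2 (\<alpha> p) (\<beta> p) J N x) p"
    and "d2 + J \<le> N \<Longrightarrow> has_v_derivative J (\<lambda>q. CD_mat d2 (\<alpha> q) N)
      (CD_mat d2 (\<alpha> p) N * V_Psi d1 d2 (\<alpha> p) (\<beta> p) J N x
        - dual_V_Phi d1 d2 (\<alpha> p) (\<beta> p) J N x * CD_mat d2 (\<alpha> p) N) p"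
proof -
  have J': "J \<in> {1..d2+1}" using J by simp
  interpret monic_flow "\<lambda>w a b. pairing (v_slice p J w) b a" "{w. v_slice p J w \<in> \<Omega>}" "snd p J"
    "Polynomial.smult (- (1 / of_nat J)) (monom 1 J)"
    "\<lambda>w. \<sigma> (v_slice p J w)" "\<lambda>w. \<pi> (v_slice p J w)" "\<lambda>w. h (v_slice p J w)" "\<lambda>w. r (v_slice p J w)"
    by (rule v_flow[OF p J'])
  have fg: "f w = orthonormal_y (v_slice p J w)" "g w = orthonormal_x (v_slice p J w)" for w
    by (rule ext, simp add: f_def g_def orthonormal_x_def orthonormal_y_def)+
  have c: "Q_imat d1 (\<beta> (v_slice p J w)) n m = pairing (v_slice p J w) (g w m) (mult_X (f w n))"
    and b: "Q_imat d2 (\<alpha> (v_slice p J w)) n m = pairing (v_slice p J w) (mult_X (g w n)) (f w m)"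
    if "w \<in> {w. v_slice p J w \<in> \<Omega>}" for w n m
    using Q_entry[of "v_slice p J w"] P_entry[of "v_slice p J w"] that unfolding fg by blast+
  have p0: "v_slice p J (snd p J) = p" by simp
  note flow = CD_mat_flow[where c = "\<lambda>w. \<beta> (v_slice p J w)" and b = "\<lambda>w. \<alpha> (v_slice p J w)",
      OF refl c b, unfolded p0,
      OF _ _ gamma_nonzero(2)[OF p] top_nonzero(2)[OF p] gamma_nonzero(1)[OF p] top_nonzero(1)[OF p] degrees]
  show "has_v_derivative J (\<lambda>q. CD_mat d1 (\<beta> q) N)
      (dual_V_Psi d1 d2 (\<alpha> p) (\<beta> p) J N x * CD_mat d1 (\<beta> p) N
        - CD_mat d1 (\<beta> p) N * V_Phi d1 d2 (\<alpha> p) (\<beta> p) J N x) p" if "max d1 (J + 1) \<le> N"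
    unfolding has_v_derivative_def dual_side_eqs by (rule flow(1)) (rule that | assumption)+
  show "has_v_derivative J (\<lambda>q. CD_mat d2 (\<alpha> q) N)
      (CD_mat d2 (\<alpha> p) N * V_Psi d1 d2 (\<alpha> p) (\<beta> p) J N x
        - dual_V_Phi d1 d2 (\<alpha> p) (\<beta> p) J N x * CD_mat d2 (\<alpha> p) N) p" if "d2 + J \<le> N"
    unfolding has_v_derivative_def by (rule flow(2)) (rule that | assumption)+
qed

lemma D_spectral:
  assumes p: "p \<in> \<Omega>" and N: "max d1 d2 + 1 \<le> N"
  shows "spectral_det (d2 + 1) (D1 d1 d2 (\<alpha> p) (\<beta> p) N x) y = spectral_det (d2 + 1) (dual_D1 d1 d2 (\<alpha> p) (\<beta> p) N x) y"
    and "similar_mat (D2 d1 d2 (\<alpha> p) (\<beta> p) N y) (dual_D2 d1 d2 (\<alpha> p) (\<beta> p) N y)"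
    and "spectral_det (d1 + 1) (D2 d1 d2 (\<alpha> p) (\<beta> p) N y) x = spectral_det (d1 + 1) (dual_D2 d1 d2 (\<alpha> p) (\<beta> p) N y) x"
proof -
  have N': "d1 \<le> N" "d2 \<le> N" using N by auto
  have carriers: "D1 e d a b N x \<in> carrier_mat (d + 1) (d + 1)" "dual_D1 e d a b N x \<in> carrier_mat (d + 1) (d + 1)" for e d a b x
    unfolding D1_def dual_D1_def by (intro add_carrier_mat mat_sum_carrier)+
  note similar1 = intertwined_similar[OF CD_mat_carrier carriers CD_mat_det[OF degrees(2) N'(2)
        gamma_nonzero(1)[OF p] top_nonzero(1)[OF p]] D_intertwine(1)[OF p N]]
  note similar2 = intertwined_similar[OF CD_mat_carrier carriers CD_mat_det[OF degrees(1) N'(1)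
        gamma_nonzero(2)[OF p] top_nonzero(2)[OF p]] D_intertwine(2)[OF p N, unfolded dual_side_eqs]]
  show "spectral_det (d2 + 1) (D1 d1 d2 (\<alpha> p) (\<beta> p) N x) y = spectral_det (d2 + 1) (dual_D1 d1 d2 (\<alpha> p) (\<beta> p) N x) y"
    by (rule similar1(2))
  show "similar_mat (D2 d1 d2 (\<alpha> p) (\<beta> p) N y) (dual_D2 d1 d2 (\<alpha> p) (\<beta> p) N y)"
    unfolding dual_side_eqs by (rule similar2(1))
  show "spectral_det (d1 + 1) (D2 d1 d2 (\<alpha> p) (\<beta> p) N y) x = spectral_det (d1 + 1) (dual_D2 d1 d2 (\<alpha> p) (\<beta> p) N y) x"
    unfolding dual_side_eqs by (rule similar2(2))
qed

end

theorem theorem4p2: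
  fixes d1 d2 :: nat
    and \<Gamma>x \<Gamma>y :: contour
    and \<Omega> :: "param set"
    and \<pi> \<sigma> :: "param \<Rightarrow> nat \<Rightarrow> complex poly"
    and h r :: "param \<Rightarrow> nat \<Rightarrow> complex"
    and \<alpha> \<beta> :: "param \<Rightarrow> int \<Rightarrow> nat \<Rightarrow> complex"
    and p :: param
    and K J :: nat
  assumes setting: "recursion_setting d1 d2 \<Gamma>x \<Gamma>y \<Omega> \<pi> \<sigma> h r \<alpha> \<beta>"
    and p: "p \<in> \<Omega>"
    and K: "1 \<le> K" "K \<le> d1 + 1"
    and J: "1 \<le> J" "J \<le> d2 + 1"
  shows
    "(\<forall>N y. N \<ge> max d1 d2 + 1 \<longrightarrow>
       CD_mat d1 (\<beta> p) N * D2 d1 d2 (\<alpha> p) (\<beta> p) N y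
         = dual_D2 d1 d2 (\<alpha> p) (\<beta> p) N y * CD_mat d1 (\<beta> p) N) \<and>
     (\<forall>N y. N \<ge> d1 + K \<longrightarrow>
       has_u_derivative K (\<lambda>q. CD_mat d1 (\<beta> q) N)
         (CD_mat d1 (\<beta> p) N * U_Phi d1 d2 (\<alpha> p) (\<beta> p) K N y
           - dual_U_Psi d1 d2 (\<alpha> p) (\<beta> p) K N y * CD_mat d1 (\<beta> p) N) p) \<and>
     (\<forall>N y. N \<ge> max d1 (J + 1) \<longrightarrow>
       has_v_derivative J (\<lambda>q. CD_mat d1 (\<beta> q) N)
         (dual_V_Psi d1 d2 (\<alpha> p) (\<beta> p) J N y * CD_mat d1 (\<beta> p) N
           - CD_mat d1 (\<beta> p) N * V_Phi d1 d2 (\<alpha> p) (\<beta> p) J N y) p) \<and>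
     (\<forall>N y. N \<ge> max d1 d2 + 1 \<longrightarrow>
       similar_mat (D2 d1 d2 (\<alpha> p) (\<beta> p) N y) (dual_D2 d1 d2 (\<alpha> p) (\<beta> p) N y)) \<and>
     (\<forall>N x y. N \<ge> max d1 d2 + 1 \<longrightarrow>
       spectral_det (d1 + 1) (D2 d1 d2 (\<alpha> p) (\<beta> p) N y) x
         = spectral_det (d1 + 1) (dual_D2 d1 d2 (\<alpha> p) (\<beta> p) N y) x) \<and>
     (\<forall>N x. N \<ge> max d1 d2 + 1 \<longrightarrow>
       CD_mat d2 (\<alpha> p) N * D1 d1 d2 (\<alpha> p) (\<beta> p) N x
         = dual_D1 d1 d2 (\<alpha> p) (\<beta> p) N x * CD_mat d2 (\<alpha> p) N) \<and>
     (\<forall>N x. N \<ge> d2 + J \<longrightarrow>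
       has_v_derivative J (\<lambda>q. CD_mat d2 (\<alpha> q) N)
         (CD_mat d2 (\<alpha> p) N * V_Psi d1 d2 (\<alpha> p) (\<beta> p) J N x
           - dual_V_Phi d1 d2 (\<alpha> p) (\<beta> p) J N x * CD_mat d2 (\<alpha> p) N) p) \<and>
     (\<forall>N x. N \<ge> max d2 (K + 1) \<longrightarrow>
       has_u_derivative K (\<lambda>q. CD_mat d2 (\<alpha> q) N)
         (dual_U_Phi d1 d2 (\<alpha> p) (\<beta> p) K N x * CD_mat d2 (\<alpha> p) N
           - CD_mat d2 (\<alpha> p) N * U_Psi d1 d2 (\<alpha> p) (\<beta> p) K N x) p) \<and>
     (\<forall>N x y. N \<ge> max d1 d2 + 1 \<longrightarrow>
       spectral_det (d2 + 1) (D1 d1 d2 (\<alpha> p) (\<beta> p) N x) y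
         = spectral_det (d2 + 1) (dual_D1 d1 d2 (\<alpha> p) (\<beta> p) N x) y)"
  proof -
  interpret recursion_setting d1 d2 \<Gamma>x \<Gamma>y \<Omega> \<pi> \<sigma> h r \<alpha> \<beta> by (rule setting)
  show ?thesis
    using D_intertwine[OF p] D_spectral[OF p] u_deformation[OF p K] v_deformation[OF p J] by blast
qed

end
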